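(* Let $V$ be a discrete gradient vector field on a finite cell complex $M$, and let $M'$ be a refinement of $M$. Then there is a discrete gradient vector field $V'$ on $M'$ which is a refinement of $V$. If moreover $\dim M\le 2$, then $V'$ can be taken to have exactly one critical cell for each critical cell of $V$, which is the minimum possible number of critical cells for a refinement of $V$.
   Context: A cell complex means a regular CW complex, i.e. a CW complex in which each cell attaching map is an embedding onto a subcomplex. Write $\alpha<\beta$ if $\alpha$ is a codimension-one face of $\beta$. A discrete vector field $V$ on a cell complex $M$ is a collection of pairs $(\alpha^{(p)},\beta^{(p+1)})$ of cells of $M$ (superscripts denote dimension) with $\alpha<\beta$, such that each cell of $M$ lies in at most one pair of $V$. A cell is critical for $V$ if it lies in no pair of $V$. A discrete Morse function on $M$ is a function $f$ from the set of cells of $M$ to $\mathbf{R}$ such that for every cell $\alpha^{(p)}$ one has $\#\{\beta^{(p+1)}>\alpha : f(\beta)\le f(\alpha)\}\le 1$ and $\#\{\gamma^{(p-1)}<\alpha : f(\gamma)\ge f(\alpha)\}\le 1$. Its gradient vector field is the set of pairs $(\alpha,\beta)$ with $\alpha<\beta$ and $f(\beta)\le f(\alpha)$. A discrete gradient vector field is a discrete vector field that is the gradient vector field of some discrete Morse function. Equivalently (Forman), it is a discrete vector field $V$ with no nontrivial closed $V$-paths, where a $V$-path is a sequence of cells $\alpha_0^{(p)},\beta_0^{(p+1)},\alpha_1^{(p)},\beta_1^{(p+1)},\dots,\beta_r^{(p+1)},\alpha_{r+1}^{(p)}$ such that $(\alpha_i,\beta_i)\in V$ and $\beta_i>\alpha_{i+1}\ne\alpha_i$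 for $i=0,\dots,r$, and it is nontrivial closed if $r\ge 1$ and $\alpha_0=\alpha_{r+1}$. A cellulation (cell complex structure) $N$ of a space is a refinement of a cellulation $M$ of the same space if each (open) cell of $N$ is contained in some (open) cell of $M$; that is, $N$ is a subdivision of $M$. Refinement of vector fields: let $V$ be a discrete vector field on $M$ and let $N$ be a refinement of $M$. For a cell $\sigma$ of $N$ let $g(\sigma)$ denote the smallest dimensional cell of $M$ with $\sigma\subset g(\sigma)$. A discrete vector field $W$ on $N$ is a refinement of $V$ if for each $k$-cell $\alpha$ of $M$ (for every $k$) one can choose a $k$-cell $h(\alpha)$ of $N$ so that: (1) $h(\alpha)\subset\alpha$; (2) if $\alpha$ is critical for $V$, then $h(\alpha)$ is critical for $W$; (3) if $(\alpha,\beta)\in V$, then $(h(\alpha),h(\beta))\in W$; (4) if $(\kappa,\sigma)\in W$ and $\kappa\ne h(g(\kappa))$, then $g(\kappa)=g(\sigma)$. *)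

theory Defs
  imports "HOL-Analysis.Analysis"
begin

text \<open>The closed unit ball in \<open>Euclidean_space n\<close>, its interior and its boundary sphere. The library's
  \<open>nsphere m\<close> is the sphere of dimension \<open>m\<close>; here the boundary of the \<open>0\<close>-ball, the empty sphere of
  dimension \<open>-1\<close>, is needed as well.\<close>

definition cball_set :: "nat \<Rightarrow> (nat \<Rightarrow> real) set" where
  "cball_set n = {x \<in> topspace (Euclidean_space n). (\<Sum>i<n. (x i)\<^sup>2) \<le> 1}"

definition oball_set :: "nat \<Rightarrow> (nat \<Rightarrow> real) set" where
  "oball_set n = {x \<in> topspace (Euclidean_space n). (\<Sum>i<n. (x i)\<^sup>2) < 1}"

definition bsphere_set :: "nat \<Rightarrow> (nat \<Rightarrow> real) set" where
  "bsphere_set n = {x \<in> topspace (Euclidean_space n). (\<Sum>i<n. (x i)\<^sup>2) = 1}"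

text \<open>A cellulation of a space is recorded by its set of open cells and their dimensions; the closed
  cell belonging to an open cell \<open>e\<close> is \<open>X closure_of e\<close>. The value of \<open>cdim\<close> matters on cells only.\<close>

record 'a cellulation =
  cells :: "'a set set"
  cdim :: "'a set \<Rightarrow> nat"

definition characteristic_map ::
    "'a topology \<Rightarrow> 'a cellulation \<Rightarrow> 'a set \<Rightarrow> ((nat \<Rightarrow> real) \<Rightarrow> 'a) \<Rightarrow> bool" where
  "characteristic_map X M e \<phi> \<longleftrightarrow>
     continuous_map (subtopology (Euclidean_space (cdim M e)) (cball_set (cdim M e))) X \<phi> \<and>
     homeomorphic_map (subtopology (Euclidean_space (cdim M e)) (oball_set (cdim M e)))
       (subtopology X e) \<phi> \<and>
     \<phi> ` bsphere_set (cdim M e) \<subseteq> \<Union>{c \<in> cells M. cdim M c < cdim M e}"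

definition cw_complex :: "'a topology \<Rightarrow> 'a cellulation \<Rightarrow> bool" where
  "cw_complex X M \<longleftrightarrow>
     Hausdorff_space X \<and>
     \<Union>(cells M) = topspace X \<and>
     pairwise disjnt (cells M) \<and>
     (\<forall>e\<in>cells M. \<exists>\<phi>. characteristic_map X M e \<phi>) \<and>
     (\<forall>e\<in>cells M. finite {c \<in> cells M. c \<inter> X closure_of e \<noteq> {}}) \<and>
     (\<forall>A. A \<subseteq> topspace X \<longrightarrow>
        (\<forall>e\<in>cells M. closedin X (A \<inter> X closure_of e)) \<longrightarrow> closedin X A)"

definition is_subcomplex :: "'a topology \<Rightarrow> 'a cellulation \<Rightarrow> 'a set \<Rightarrow> bool" where
  "is_subcomplex X M S \<longleftrightarrow>
     (\<exists>D. D \<subseteq> cells M \<and> S = \<Union>D \<and> (\<forall>e\<in>D. X closure_of e \<subseteq> S))"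

text \<open>Cell complexes are regular CW complexes. The attaching map of a cell is the restriction of a
  characteristic map to the boundary sphere.\<close>

definition cell_complex :: "'a topology \<Rightarrow> 'a cellulation \<Rightarrow> bool" where
  "cell_complex X M \<longleftrightarrow>
     cw_complex X M \<and>
     (\<forall>e\<in>cells M. \<exists>\<phi>. characteristic_map X M e \<phi> \<and>
        embedding_map (subtopology (Euclidean_space (cdim M e)) (bsphere_set (cdim M e))) X \<phi> \<and>
        is_subcomplex X M (\<phi> ` bsphere_set (cdim M e)))"

definition cellulation_refines :: "'a cellulation \<Rightarrow> 'a cellulation \<Rightarrow> bool" where
  "cellulation_refines N M \<longleftrightarrow> (\<forall>\<sigma>\<in>cells N. \<exists>\<alpha>\<in>cells M. \<sigma> \<subseteq> \<alpha>)"

definition facet :: "'a topology \<Rightarrow> 'a cellulation \<Rightarrow> 'a set \<Rightarrow> 'a set \<Rightarrow> bool" where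
  "facet X M \<alpha> \<beta> \<longleftrightarrow>
     \<alpha> \<in> cells M \<and> \<beta> \<in> cells M \<and> cdim M \<beta> = Suc (cdim M \<alpha>) \<and> \<alpha> \<subseteq> X closure_of \<beta>"

definition discrete_vector_field ::
    "'a topology \<Rightarrow> 'a cellulation \<Rightarrow> ('a set \<times> 'a set) set \<Rightarrow> bool" where
  "discrete_vector_field X M V \<longleftrightarrow>
     (\<forall>(\<alpha>, \<beta>)\<in>V. facet X M \<alpha> \<beta>) \<and>
     (\<forall>c\<in>cells M. \<forall>p\<in>V. \<forall>q\<in>V.
        c \<in> {fst p, snd p} \<longrightarrow> c \<in> {fst q, snd q} \<longrightarrow> p = q)"

definition critical_cells :: "'a cellulation \<Rightarrow> ('a set \<times> 'a set) set \<Rightarrow> 'a set set" where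
  "critical_cells M V = {c \<in> cells M. \<forall>p\<in>V. c \<noteq> fst p \<and> c \<noteq> snd p}"

text \<open>Finiteness is required explicitly since \<open>card\<close> is \<open>0\<close> on infinite sets.\<close>

definition discrete_morse_function ::
    "'a topology \<Rightarrow> 'a cellulation \<Rightarrow> ('a set \<Rightarrow> real) \<Rightarrow> bool" where
  "discrete_morse_function X M f \<longleftrightarrow>
     (\<forall>\<alpha>\<in>cells M.
        finite {\<beta>. facet X M \<alpha> \<beta> \<and> f \<beta> \<le> f \<alpha>} \<and>
        card {\<beta>. facet X M \<alpha> \<beta> \<and> f \<beta> \<le> f \<alpha>} \<le> 1 \<and>
        finite {\<gamma>. facet X M \<gamma> \<alpha> \<and> f \<gamma> \<ge> f \<alpha>} \<and>
        card {\<gamma>. facet X M \<gamma> \<alpha> \<and> f \<gamma> \<ge> f \<alpha>} \<le> 1)"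

definition gradient_field ::
    "'a topology \<Rightarrow> 'a cellulation \<Rightarrow> ('a set \<Rightarrow> real) \<Rightarrow> ('a set \<times> 'a set) set" where
  "gradient_field X M f = {(\<alpha>, \<beta>). facet X M \<alpha> \<beta> \<and> f \<beta> \<le> f \<alpha>}"

definition discrete_gradient_vector_field ::
    "'a topology \<Rightarrow> 'a cellulation \<Rightarrow> ('a set \<times> 'a set) set \<Rightarrow> bool" where
  "discrete_gradient_vector_field X M V \<longleftrightarrow>
     discrete_vector_field X M V \<and>
     (\<exists>f. discrete_morse_function X M f \<and> V = gradient_field X M f)"

text \<open>The cell of \<open>M\<close> of smallest dimension containing the cell \<open>\<sigma>\<close> of a refinement of \<open>M\<close>.
  Containment between cells of a refinement and cells of \<open>M\<close> refers to closed cells, here and below.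
  (For open cells there would be only one cell of \<open>M\<close> containing \<open>\<sigma>\<close>, and it is the same cell.)\<close>

definition carrier_cell :: "'a topology \<Rightarrow> 'a cellulation \<Rightarrow> 'a set \<Rightarrow> 'a set" where
  "carrier_cell X M \<sigma> =
     (ARG_MIN (cdim M) \<alpha>. \<alpha> \<in> cells M \<and> X closure_of \<sigma> \<subseteq> X closure_of \<alpha>)"

definition refinement_choice ::
    "'a topology \<Rightarrow> 'a cellulation \<Rightarrow> ('a set \<times> 'a set) set \<Rightarrow>
     'a cellulation \<Rightarrow> ('a set \<times> 'a set) set \<Rightarrow> ('a set \<Rightarrow> 'a set) \<Rightarrow> bool" where
  "refinement_choice X M V N W h \<longleftrightarrow>
     (\<forall>\<alpha>\<in>cells M. h \<alpha> \<in> cells N \<and> cdim N (h \<alpha>) = cdim M \<alpha>) \<and>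
     (\<forall>\<alpha>\<in>cells M. X closure_of (h \<alpha>) \<subseteq> X closure_of \<alpha>) \<and>
     (\<forall>\<alpha>\<in>critical_cells M V. h \<alpha> \<in> critical_cells N W) \<and>
     (\<forall>(\<alpha>, \<beta>)\<in>V. (h \<alpha>, h \<beta>) \<in> W) \<and>
     (\<forall>(\<kappa>, \<sigma>)\<in>W. \<kappa> \<noteq> h (carrier_cell X M \<kappa>) \<longrightarrow> carrier_cell X M \<kappa> = carrier_cell X M \<sigma>)"

definition vector_field_refinement ::
    "'a topology \<Rightarrow> 'a cellulation \<Rightarrow> ('a set \<times> 'a set) set \<Rightarrow>
     'a cellulation \<Rightarrow> ('a set \<times> 'a set) set \<Rightarrow> bool" where
  "vector_field_refinement X M V N W \<longleftrightarrow>
     discrete_vector_field X N W \<and> (\<exists>h. refinement_choice X M V N W h)"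

end

theory Submission
  imports Defs "HOL-Homology.Invariance_of_Domain"
begin

text \<open>
  Choose in each cell \<open>\<alpha>\<close> of \<open>M\<close> a cell \<open>h \<alpha>\<close> of the refinement of the same dimension, with \<open>h \<alpha>\<close> a facet
  of \<open>h \<beta>\<close> whenever \<open>(\<alpha>, \<beta>)\<close> is in \<open>V\<close>; invariance of domain provides enough cells of full dimension.
  The pairs \<open>(h \<alpha>, h \<beta>)\<close> alone form a gradient refinement, since a closed path of them would project to a
  closed \<open>V\<close>-path.

  In dimension at most two, all cells inside \<open>\<alpha>\<close> other than \<open>h \<alpha>\<close> can in addition be matched acyclically
  within \<open>\<alpha>\<close>. Take a spanning tree of the dual graph rooted at \<open>h \<alpha>\<close> and match each top cell with the
  facet towards its parent. If \<open>\<alpha>\<close> is a disc, the edges not crossed by the tree connect every interior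
  vertex to the boundary circle, and match each interior vertex with its edge towards the boundary; by the
  Jordan curve theorem no edge remains. Paths cannot return from \<open>\<beta>\<close> to \<open>h \<alpha>\<close> because a facet in the
  boundary of \<open>\<beta>\<close> lies in only one top cell inside \<open>\<beta>\<close>.
\<close>

section \<open>Model balls\<close>

text \<open>In any refinement choice the cell \<open>h \<alpha>\<close> has carrier \<alpha>, so
  \<open>h\<close> is injective on critical cells. This is the lower bound on their number, and it
  is attained once every other cell inside each \<alpha> is matched. The obstacle is topological:
  the definition of a cell complex does not tell how many top cells inside \<alpha> contain a given
  codimension-one cell, nor how dimensions in the two cellulations compare. Regularity makes this
  accessible, because a closed cell is then homeomorphic to a closed ball, so that questions about
  its subdivision become questions about subsets of \<open>Euclidean_space\<close>. There injective
  continuous maps on open sets are open, which gives equality of dimensions, at most two top cells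
  around an interior wall, and at most one at the boundary. Tree and forest are both oriented by
  graph distance, and the same distance supplies the rank that certifies acyclicity. The bound on
  the dimension enters through the forest, since its exhausting the remaining edges is a fact about
  the plane.\<close>

definition sqsum :: "nat \<Rightarrow> (nat \<Rightarrow> real) \<Rightarrow> real" where
  "sqsum n x = (\<Sum>i<n. (x i)\<^sup>2)"

text \<open>All three sets become preimages of sets of reals under one continuous function, from
  which they inherit being open or closed.\<close>

lemma cball_set_sqsum: "cball_set n = {x \<in> topspace (Euclidean_space n). sqsum n x \<in> {..1}}"
  and oball_set_sqsum: "oball_set n = {x \<in> topspace (Euclidean_space n). sqsum n x \<in> {..<1}}"
  and bsphere_set_sqsum: "bsphere_set n = {x \<in> topspace (Euclidean_space n). sqsum n x \<in> {1}}"
  by (auto simp: cball_set_def oball_set_def bsphere_set_def sqsum_def)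

lemma sqsum_nonneg [simp]: "0 \<le> sqsum n x"
  by (simp add: sqsum_def sum_nonneg)

lemma sqsum_scale: "sqsum n (\<lambda>i. c * x i) = c\<^sup>2 * sqsum n x"
  by (simp add: sqsum_def power_mult_distrib sum_distrib_left)

lemma scale_in_Euclidean_space:
  "x \<in> topspace (Euclidean_space n) \<Longrightarrow> (\<lambda>i. c * x i) \<in> topspace (Euclidean_space n)"
  by (simp add: topspace_Euclidean_space)

lemma continuous_map_sqsum: "continuous_map (Euclidean_space n) euclideanreal (sqsum n)"
  unfolding sqsum_def Euclidean_space_def
  by (intro continuous_intros continuous_map_from_subtopology continuous_map_product_projection) auto

lemma closedin_cball_set: "closedin (Euclidean_space n) (cball_set n)"
  unfolding cball_set_sqsum by (rule closedin_continuous_map_preimage [OF continuous_map_sqsum]) auto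

lemma openin_oball_set: "openin (Euclidean_space n) (oball_set n)"
  unfolding oball_set_sqsum by (rule openin_continuous_map_preimage [OF continuous_map_sqsum]) auto

lemma closedin_bsphere_set: "closedin (Euclidean_space n) (bsphere_set n)"
  unfolding bsphere_set_sqsum by (rule closedin_continuous_map_preimage [OF continuous_map_sqsum]) auto

lemma ball_sets_subset:
  "cball_set n \<subseteq> topspace (Euclidean_space n)" "oball_set n \<subseteq> topspace (Euclidean_space n)"
  "bsphere_set n \<subseteq> topspace (Euclidean_space n)"
  by (auto simp: cball_set_def oball_set_def bsphere_set_def)

lemma ball_sets_Un: "oball_set n \<union> bsphere_set n = cball_set n"
  and ball_sets_Int: "oball_set n \<inter> bsphere_set n = {}"
  by (auto simp: cball_set_def oball_set_def bsphere_set_def)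

text \<open>Every coordinate of a point of the ball lies in \<open>{-1..1}\<close>, so the ball is a
  closed subset of a product of compact intervals. The product runs over all indices because
  \<open>Euclidean_space n\<close> is a subspace of \<open>powertop_real UNIV\<close>.\<close>

lemma compactin_cball_set: "compactin (Euclidean_space n) (cball_set n)"
  unfolding Euclidean_space_def compactin_subtopology
proof
  have sub: "cball_set n \<subseteq> UNIV \<rightarrow>\<^sub>E {-1..1}"
  proof
    fix x assume x: "x \<in> cball_set n"
    have "x i \<in> {-1..1}" for i
    proof (cases "i < n")
      case True
      have "(x i)\<^sup>2 \<le> (\<Sum>i<n. (x i)\<^sup>2)"
        using True by (intro member_le_sum) auto
      then have "(x i)\<^sup>2 \<le> 1"
        using x by (simp add: cball_set_def)
      then show ?thesis
        by (simp add: abs_le_iff abs_square_le_1) 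
    next
      case False
      then show ?thesis
        using x by (simp add: cball_set_def topspace_Euclidean_space)
    qed
    then show "x \<in> UNIV \<rightarrow>\<^sub>E {-1..1}" by auto
  qed
  show "compactin (powertop_real UNIV) (cball_set n)"
  proof (rule closed_compactin [OF _ sub])
    show "closedin (powertop_real UNIV) (cball_set n)"
      by (metis Euclidean_space_def closedin_cball_set closedin_Euclidean_space closedin_closed_subtopology topspace_Euclidean_space)
  qed (simp add: compactin_PiE)
qed (auto simp: cball_set_def topspace_Euclidean_space)

lemma continuous_map_Euclidean_space_scale:
  assumes "continuous_map T euclideanreal g" "continuous_map T (Euclidean_space n) f"
  shows "continuous_map T (Euclidean_space n) (\<lambda>x i. g x * f x i)"
  using assms unfolding Euclidean_space_def continuous_map_in_subtopology
  by (auto simp: continuous_map_componentwise_UNIV Pi_iff intro: continuous_map_real_mult)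

text \<open>A point of the closed ball is the limit of its multiples by \<open>t < 1\<close> as
  \<open>t\<close> tends to 1.\<close>

lemma cball_set_closure_of: "cball_set n \<subseteq> Euclidean_space n closure_of oball_set n"
proof
  fix x assume x: "x \<in> cball_set n"
  let ?f = "\<lambda>t i. t * x i"
  have cm: "continuous_map euclideanreal (Euclidean_space n) ?f"
    by (rule continuous_map_Euclidean_space_scale) (use x ball_sets_subset in auto)
  have "?f ` {0..<1} \<subseteq> oball_set n"
  proof clarify
    fix t :: real assume "t \<in> {0..<1}"
    then have "t\<^sup>2 < 1" by (simp add: power_less_one_iff)
    have "t\<^sup>2 * sqsum n x \<le> t\<^sup>2 * 1" using x by (intro mult_left_mono) (auto simp: cball_set_sqsum)
    then show "?f t \<in> oball_set n"
      using x \<open>t\<^sup>2 < 1\<close> subsetD [OF ball_sets_subset(1) x]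
      by (simp add: oball_set_sqsum sqsum_scale scale_in_Euclidean_space)
  qed
  moreover have "(1::real) \<in> closure {0..<1}" by simp
  ultimately show "x \<in> Euclidean_space n closure_of oball_set n"
    using continuous_map_image_closure_subset [OF cm, of "{0..<1}"]
      closure_of_mono [of "?f ` {0..<1}" "oball_set n" "Euclidean_space n"]
    by (auto simp: image_subset_iff dest!: bspec[where x=1])
qed

lemma path_connectedin_starlike:
  assumes S: "S \<subseteq> topspace (Euclidean_space n)"
    and star: "\<And>x t. x \<in> S \<Longrightarrow> 0 \<le> t \<Longrightarrow> t \<le> 1 \<Longrightarrow> (\<lambda>i. t * x i) \<in> S"
  shows "path_connectedin (Euclidean_space n) S"
proof -
  have *: "path_component_of (subtopology (Euclidean_space n) S) (\<lambda>i. 0) x" if "x \<in> S" for x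
    unfolding path_component_of_def pathin_def
  proof (intro exI conjI)
    show "continuous_map (top_of_set {0..1}) (subtopology (Euclidean_space n) S) (\<lambda>t i. t * x i)"
      unfolding continuous_map_in_subtopology
      by (intro conjI continuous_map_Euclidean_space_scale) (use S star that in auto)
  qed auto
  show ?thesis
    unfolding path_connectedin_def path_connected_space_iff_path_component
    using S * by (auto simp: Int_absorb1) (meson path_component_of_sym path_component_of_trans)
qed

lemma
  shows path_connectedin_cball_set: "path_connectedin (Euclidean_space n) (cball_set n)"
    and path_connectedin_oball_set: "path_connectedin (Euclidean_space n) (oball_set n)"
proof -
  have *: "t\<^sup>2 * sqsum n x \<le> sqsum n x" if "0 \<le> t" "t \<le> 1" for t x
    using that by (simp add: mult_left_le_one_le power_le_one)
  have "(\<lambda>i. t * x i) \<in> cball_set n" if "x \<in> cball_set n" "0 \<le> t" "t \<le> 1" for t x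
    using that order_trans [OF *] by (simp add: cball_set_sqsum sqsum_scale scale_in_Euclidean_space)
  then show "path_connectedin (Euclidean_space n) (cball_set n)"
    by (intro path_connectedin_starlike ball_sets_subset)
  have "(\<lambda>i. t * x i) \<in> oball_set n" if "x \<in> oball_set n" "0 \<le> t" "t \<le> 1" for t x
    using that order_le_less_trans [OF *, of t x 1] by (simp add: oball_set_sqsum sqsum_scale scale_in_Euclidean_space)
  then show "path_connectedin (Euclidean_space n) (oball_set n)"
    by (intro path_connectedin_starlike ball_sets_subset)
qed

lemma bsphere_set_nonempty: "0 < n \<Longrightarrow> bsphere_set n \<noteq> {}"
  by (auto simp: bsphere_set_def topspace_Euclidean_space power2_eq_square if_distrib
      [of "\<lambda>x. x * _"] cong: if_cong intro!: exI[of _ "\<lambda>i. if i = 0 then 1 else 0"])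

lemma zero_in_oball_set: "(\<lambda>i. 0) \<in> oball_set n"
  by (simp add: oball_set_def topspace_Euclidean_space)

lemma oball_set_0: "oball_set 0 = {\<lambda>i. 0}" and cball_set_0: "cball_set 0 = {\<lambda>i. 0}"
  by (auto simp: oball_set_def cball_set_def topspace_Euclidean_space)

text \<open>Regarded as a map into \<open>Euclidean_space m\<close>, an injective \<open>f\<close>
  would have open image by invariance of domain. The image lies in \<open>Euclidean_space n\<close>,
  however, and a small change of the coordinate with index \<open>n\<close> leads out of it.\<close>

lemma no_injection_lower_dimension:
  assumes "n < m" "openin (Euclidean_space m) U" "U \<noteq> {}"
    and f: "continuous_map (subtopology (Euclidean_space m) U) (Euclidean_space n) f"
  shows "\<not> inj_on f U"
proof
  assume inj: "inj_on f U"
  have fU: "f ` U \<subseteq> topspace (Euclidean_space n)"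
    using f assms(2) by (metis continuous_map_image_subset_topspace openin_subset topspace_subtopology_subset)
  have *: "continuous_map (subtopology (Euclidean_space m) U) (Euclidean_space m) f"
    using f \<open>n < m\<close> unfolding Euclidean_space_def continuous_map_in_subtopology
    by (auto simp: Pi_iff)
  have op: "openin (Euclidean_space m) (f ` U)"
    by (rule invariance_of_domain_Euclidean_space [OF assms(2) * inj])
  obtain x where x: "x \<in> f ` U" using \<open>U \<noteq> {}\<close> by blast
  define g where "g t i = (if i = n then t else x i)" for t i
  have xn: "x \<in> topspace (Euclidean_space n)" using x fU by auto
  then have "g 0 = x" by (auto simp: g_def topspace_Euclidean_space)
  have cm: "continuous_map euclideanreal (Euclidean_space m) g"
    unfolding Euclidean_space_def continuous_map_in_subtopology continuous_map_componentwise_UNIV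
    using xn \<open>n < m\<close> by (auto simp: g_def topspace_Euclidean_space)
  have "open {t \<in> UNIV. g t \<in> f ` U}"
    using openin_continuous_map_preimage [OF cm op] by simp
  moreover have "0 \<in> {t \<in> UNIV. g t \<in> f ` U}"
    using \<open>g 0 = x\<close> x by simp
  ultimately obtain e where "e > 0" and e: "ball 0 e \<subseteq> {t \<in> UNIV. g t \<in> f ` U}"
    by (meson openE)
  then have "e/2 \<in> {t \<in> UNIV. g t \<in> f ` U}" by (intro subsetD[OF e]) (auto simp: dist_norm)
  then have "g (e/2) \<in> topspace (Euclidean_space n)" using fU by auto
  then show False using \<open>e > 0\<close> by (auto simp: g_def topspace_Euclidean_space)
qed

section \<open>The two-dimensional ball as the unit disc of the complex plane\<close>

definition to_complex :: "(nat \<Rightarrow> real) \<Rightarrow> complex" where "to_complex x = Complex (x 0) (x 1)"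

definition of_complex :: "complex \<Rightarrow> nat \<Rightarrow> real" where
  "of_complex z i = (if i = 0 then Re z else if i = 1 then Im z else 0)"

lemma homeomorphic_maps_complex: "homeomorphic_maps (Euclidean_space 2) euclidean to_complex of_complex"
proof -
  have "continuous_map (Euclidean_space 2) euclideanreal (\<lambda>x. x i)" for i
    unfolding Euclidean_space_def
    by (intro continuous_map_from_subtopology continuous_map_product_projection) auto
  then have "continuous_map (Euclidean_space 2) euclidean (\<lambda>x. complex_of_real (x 0) + \<i> * complex_of_real (x 1))"
    unfolding continuous_map_Euclidean_space_iff by (intro continuous_intros) auto
  moreover have "to_complex = (\<lambda>x. complex_of_real (x 0) + \<i> * complex_of_real (x 1))"
    by (auto simp: to_complex_def complex_eq_iff)
  moreover have "continuous_map euclidean (Euclidean_space 2) of_complex"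
    unfolding Euclidean_space_def continuous_map_in_subtopology continuous_map_componentwise_UNIV
  proof (intro conjI allI)
    fix i :: nat
    consider "i = 0" | "i = 1" | "i \<ge> 2" by linarith
    then show "continuous_map euclidean euclideanreal (\<lambda>z. of_complex z i)"
      by cases (auto simp: of_complex_def intro!: continuous_intros)
  qed (auto simp: of_complex_def)
  moreover have "of_complex (to_complex x) = x" if "x \<in> topspace (Euclidean_space 2)" for x
  proof
    fix i :: nat
    consider "i = 0" | "i = 1" | "i \<ge> 2" by linarith
    then show "of_complex (to_complex x) i = x i"
      using that by cases (auto simp: of_complex_def to_complex_def topspace_Euclidean_space)
  qed
  moreover have "to_complex (of_complex z) = z" for z
    by (auto simp: of_complex_def to_complex_def complex_eq_iff)
  ultimately show ?thesis
    by (simp add: homeomorphic_maps_def)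
qed

lemma sqsum_of_complex: "sqsum 2 (of_complex z) = (norm z)\<^sup>2"
  by (simp add: sqsum_def of_complex_def cmod_def numeral_2_eq_2)

lemma image_of_complex:
  "of_complex ` ball 0 1 = oball_set 2" "of_complex ` cball 0 1 = cball_set 2"
  "of_complex ` sphere 0 1 = bsphere_set 2"
proof -
  have *: "{x \<in> topspace (Euclidean_space 2). sqsum 2 x \<in> T} = of_complex ` {z. (norm z)\<^sup>2 \<in> T}" for T
    using homeomorphic_maps_complex
    by (auto simp: homeomorphic_maps_def continuous_map_def image_iff Pi_iff sqsum_of_complex; metis sqsum_of_complex)
  show "of_complex ` ball 0 1 = oball_set 2" "of_complex ` cball 0 1 = cball_set 2"
    "of_complex ` sphere 0 1 = bsphere_set 2"
    unfolding oball_set_sqsum cball_set_sqsum bsphere_set_sqsum *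
    by (auto intro!: arg_cong [where f = "(`) of_complex"] simp: abs_square_less_1 abs_square_le_1 abs_square_eq_1)
qed

lemma connectedin_of_complex: "connected S \<Longrightarrow> connectedin (Euclidean_space 2) (of_complex ` S)"
  using homeomorphic_maps_complex connectedin_continuous_map_image [of euclidean "Euclidean_space 2" of_complex S]
  by (simp add: homeomorphic_maps_def)

lemma connected_to_complex: "connectedin (Euclidean_space 2) S \<Longrightarrow> connected (to_complex ` S)"
  using homeomorphic_maps_complex connectedin_continuous_map_image [of "Euclidean_space 2" euclidean to_complex S]
  by (simp add: homeomorphic_maps_def)

lemma of_complex_to_complex: "x \<in> topspace (Euclidean_space 2) \<Longrightarrow> of_complex (to_complex x) = x"
  using homeomorphic_maps_complex by (simp add: homeomorphic_maps_def)

lemma to_complex_of_complex [simp]: "to_complex (of_complex z) = z"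
  using homeomorphic_maps_complex by (simp add: homeomorphic_maps_def)

lemma inj_of_complex: "inj of_complex"
  by (metis injI to_complex_of_complex)

text \<open>Presenting the circle as a simple closed path allows it to be cut into two arcs at any
  two of its points.\<close>

lemma simple_closed_path_unit_circle:
  fixes g :: "real \<Rightarrow> complex"
  defines "g \<equiv> \<lambda>t. cis (2 * pi * t)"
  shows "simple_path g" "pathfinish g = pathstart g" "path_image g = sphere 0 1"
proof -
  have "x = y \<or> x = 0 \<and> y = 1 \<or> x = 1 \<and> y = 0"
    if xy: "x \<in> {0..1}" "y \<in> {0..1}" and eq: "g x = g y" for x y
  proof -
    from eq have "sin (2 * pi * x) = sin (2 * pi * y) \<and> cos (2 * pi * x) = cos (2 * pi * y)"
      by (auto simp: g_def cis.code)
    then obtain k :: int where "2 * pi * x = 2 * pi * y + 2 * pi * k"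
      unfolding sin_cos_eq_iff by blast
    then have "2 * pi * x = 2 * pi * (y + k)" by (simp add: algebra_simps)
    then have k: "x = y + k" by simp
    with xy have "k \<in> {-1..1}" by auto
    then have "k = -1 \<or> k = 0 \<or> k = 1" by auto
    then show ?thesis using k xy by auto
  qed
  moreover have "path g"
    unfolding path_def g_def by (intro continuous_intros)
  ultimately show "simple_path g" by (auto simp: simple_path_def loop_free_def)
  show "pathfinish g = pathstart g" by (simp add: g_def pathfinish_def pathstart_def)
  have "z \<in> path_image g" if "norm z = 1" for z
  proof -
    have "z = g (Arg2pi z / (2 * pi))"
      using Arg2pi_eq [of z] that by (simp add: g_def cis_conv_exp)
    then show ?thesis
      using Arg2pi_ge_0 [of z] Arg2pi_lt_2pi [of z] by (auto simp: path_image_def image_iff intro!: bexI[of _ "Arg2pi z / (2 * pi)"])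
  qed
  then show "path_image g = sphere 0 1" by (auto simp: path_image_def g_def)
qed

text \<open>Two points outside \<open>C\<close> cut the circle into two closed arcs that meet only
  in these points. A connected \<open>C\<close> cannot meet both arcs, and the arc it misses joins
  the two points in the complement.\<close>

lemma connected_circle_diff_connected:
  fixes C :: "complex set"
  assumes "connected C" "C \<subseteq> sphere 0 1"
  shows "connected (sphere 0 1 - C)"
  unfolding connected_iff_connected_component
proof (intro ballI)
  fix a b :: complex assume a: "a \<in> sphere 0 1 - C" and b: "b \<in> sphere 0 1 - C"
  show "connected_component (sphere 0 1 - C) a b"
  proof (cases "a = b")
    case True
    then show ?thesis using a by simp
  next
    case False
    obtain u d where "arc u" "arc d" and u: "pathstart u = a" "pathfinish u = b"
      and d: "pathstart d = b" "pathfinish d = a"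
      and ud: "path_image u \<inter> path_image d = {a, b}" "path_image u \<union> path_image d = sphere 0 1"
      using exists_double_arc [OF simple_closed_path_unit_circle(1,2), of a b] a b False
      unfolding simple_closed_path_unit_circle(3) by blast
    have cl: "closed (path_image u)" "closed (path_image d)"
      and cn: "connected (path_image u)" "connected (path_image d)"
      using \<open>arc u\<close> \<open>arc d\<close> by (auto simp: closed_path_image connected_path_image arc_imp_path)
    have ab: "a \<in> path_image u" "b \<in> path_image u" "a \<in> path_image d" "b \<in> path_image d"
      using ud by auto
    have "path_image u \<inter> path_image d \<inter> C = {}"
      using a b unfolding ud(1) by simp
    moreover have "C \<subseteq> path_image u \<union> path_image d"
      using assms(2) ud(2) by simp
    ultimately have "path_image u \<inter> C = {} \<or> path_image d \<inter> C = {}"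
      by (rule connected_closedD [OF assms(1) _ _ cl])
    then show ?thesis
      using cn ab ud(2) unfolding connected_component_def by blast
  qed
qed

section \<open>The one-dimensional ball as an interval\<close>

definition of_line :: "real \<Rightarrow> nat \<Rightarrow> real" where "of_line t i = (if i = 0 then t else 0)"

lemma homeomorphic_maps_line: "homeomorphic_maps (Euclidean_space 1) euclideanreal (\<lambda>x. x 0) of_line"
proof -
  have "continuous_map (Euclidean_space 1) euclideanreal (\<lambda>x. x 0)"
    unfolding Euclidean_space_def
    by (intro continuous_map_from_subtopology continuous_map_product_projection) auto
  moreover have "continuous_map euclideanreal (Euclidean_space 1) of_line"
    unfolding Euclidean_space_def continuous_map_in_subtopology continuous_map_componentwise_UNIV
  proof (intro conjI allI)
    show "continuous_map euclideanreal euclideanreal (\<lambda>t. of_line t i)" for i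
      by (cases "i = 0") (auto simp: of_line_def)
  qed (auto simp: of_line_def)
  ultimately show ?thesis
    by (auto simp: homeomorphic_maps_def of_line_def topspace_Euclidean_space)
qed

lemma bsphere_set_1: "bsphere_set 1 = {of_line (-1), of_line 1}"
  by (auto simp: bsphere_set_def topspace_Euclidean_space of_line_def power2_eq_1_iff fun_eq_iff)

lemma cball_set_1: "cball_set 1 = of_line ` {-1..1}"
proof -
  have "x \<in> of_line ` {-1..1}" if "x \<in> cball_set 1" for x
    using that
    by (intro image_eqI [of _ _ "x 0"]) (auto simp: cball_set_def topspace_Euclidean_space of_line_def abs_square_le_1 abs_le_iff)
  moreover have "of_line t \<in> cball_set 1" if "t \<in> {-1..1}" for t
    using that by (auto simp: cball_set_def topspace_Euclidean_space of_line_def abs_square_le_1 abs_le_iff)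
  ultimately show ?thesis by blast
qed

lemma path_connectedin_bsphere_set_2: "path_connectedin (Euclidean_space 2) (bsphere_set 2)"
proof -
  have "path_connected (sphere (0::complex) 1)"
    by (intro path_connected_sphere) simp
  then show ?thesis
    unfolding image_of_complex(3) [symmetric]
    using path_connectedin_continuous_map_image [of euclidean "Euclidean_space 2" of_complex]
      homeomorphic_maps_complex by (simp add: homeomorphic_maps_def)
qed

text \<open>Needed for the boundary of a two-dimensional face after removal of its open edge towards
  the parent in the dual tree.\<close>

lemma connectedin_bsphere_set_2_diff:
  assumes "connectedin (Euclidean_space 2) C" "C \<subseteq> bsphere_set 2"
  shows "connectedin (Euclidean_space 2) (bsphere_set 2 - C)"
proof -
  have C: "of_complex ` to_complex ` C = C"
    using assms(2) ball_sets_subset(3)[of 2] of_complex_to_complex by (force simp: image_image)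
  have "to_complex ` C \<subseteq> sphere 0 1"
    using assms(2) unfolding image_of_complex(3) [symmetric] by auto
  then have "connected (sphere 0 1 - to_complex ` C)"
    by (intro connected_circle_diff_connected connected_to_complex assms)
  moreover have "of_complex ` (sphere 0 1 - to_complex ` C) = bsphere_set 2 - C"
    by (simp add: image_set_diff [OF inj_of_complex] C image_of_complex)
  ultimately show ?thesis
    using connectedin_of_complex by metis
qed

lemma connectedin_oball_set_2_diff_finite:
  assumes "finite A"
  shows "connectedin (Euclidean_space 2) (oball_set 2 - A)"
proof -
  have "connected (ball 0 1 - of_complex -` A)"
    using assms by (intro connected_open_delete_finite finite_vimageI inj_of_complex) auto
  moreover have "of_complex ` (ball 0 1 - of_complex -` A) = oball_set 2 - A"
    by (auto simp: image_of_complex(1) [symmetric])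
  ultimately show ?thesis
    using connectedin_of_complex by metis
qed

section \<open>Regular cell complexes\<close>

locale regular_complex =
  fixes X :: "'a topology" and N :: "'a cellulation"
  assumes complex: "cell_complex X N"
begin

abbreviation cl :: "'a set \<Rightarrow> 'a set" where "cl S \<equiv> X closure_of S"

abbreviation dim :: "'a set \<Rightarrow> nat" where "dim \<equiv> cdim N"

lemma Hausdorff: "Hausdorff_space X"
  and cover: "\<Union>(cells N) = topspace X"
  and disjoint_cells: "pairwise disjnt (cells N)"
  and finite_meeting_cells: "e \<in> cells N \<Longrightarrow> finite {c \<in> cells N. c \<inter> cl e \<noteq> {}}"
  and weak_topology: "A \<subseteq> topspace X \<Longrightarrow> (\<And>e. e \<in> cells N \<Longrightarrow> closedin X (A \<inter> cl e)) \<Longrightarrow> closedin X A"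
  using complex by (auto simp: cell_complex_def cw_complex_def)

lemma cell_subset_topspace: "e \<in> cells N \<Longrightarrow> e \<subseteq> topspace X"
  using cover by blast

lemma cell_subset_closure: "e \<in> cells N \<Longrightarrow> e \<subseteq> cl e"
  by (simp add: cell_subset_topspace closure_of_subset)

lemma cells_eqI: "e \<in> cells N \<Longrightarrow> c \<in> cells N \<Longrightarrow> x \<in> e \<Longrightarrow> x \<in> c \<Longrightarrow> e = c"
  using disjoint_cells by (metis disjnt_iff pairwise_def)

lemma cell_nonempty:
  assumes "e \<in> cells N" shows "e \<noteq> {}"
proof -
  obtain \<phi> where "homeomorphic_map (subtopology (Euclidean_space (dim e)) (oball_set (dim e))) (subtopology X e) \<phi>"
    using complex assms by (auto simp: cell_complex_def characteristic_map_def)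
  then have "\<phi> ` (topspace (Euclidean_space (dim e)) \<inter> oball_set (dim e)) = topspace X \<inter> e"
    using homeomorphic_imp_surjective_map by fastforce
  then show ?thesis
    using zero_in_oball_set [of "dim e"] ball_sets_subset(2)[of "dim e"] by auto
qed

text \<open>The homeomorphism covers the whole closed cell, not only the open one; this is what
  regularity provides. The inverse is carried along explicitly so that sets and maps can be moved in
  both directions.\<close>

definition chart :: "'a set \<Rightarrow> ((nat \<Rightarrow> real) \<Rightarrow> 'a) \<Rightarrow> ('a \<Rightarrow> nat \<Rightarrow> real) \<Rightarrow> bool" where
  "chart e \<phi> \<psi> \<longleftrightarrow>
     homeomorphic_maps (subtopology (Euclidean_space (dim e)) (cball_set (dim e))) (subtopology X (cl e)) \<phi> \<psi> \<and>
     \<phi> ` oball_set (dim e) = e"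

text \<open>The characteristic map is injective on the open ball and on the sphere, and the two
  images are disjoint because the sphere lands in cells of smaller dimension. A continuous bijection
  from the compact ball to a Hausdorff space is a homeomorphism.\<close>

lemma obtain_chart_subcomplex:
  assumes e: "e \<in> cells N"
  obtains \<phi> \<psi> D where "chart e \<phi> \<psi>" "cl e - e = \<Union>D" "D \<subseteq> cells N" "\<And>c. c \<in> D \<Longrightarrow> dim c < dim e"
proof -
  let ?n = "dim e"
  obtain \<phi> where \<phi>: "characteristic_map X N e \<phi>"
    and emb: "embedding_map (subtopology (Euclidean_space ?n) (bsphere_set ?n)) X \<phi>"
    and "is_subcomplex X N (\<phi> ` bsphere_set ?n)"
    using complex e unfolding cell_complex_def by blast
  then obtain D where D: "D \<subseteq> cells N" "\<phi> ` bsphere_set ?n = \<Union>D"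
    by (auto simp: is_subcomplex_def)
  have cont: "continuous_map (subtopology (Euclidean_space ?n) (cball_set ?n)) X \<phi>"
    and hom: "homeomorphic_map (subtopology (Euclidean_space ?n) (oball_set ?n)) (subtopology X e) \<phi>"
    and low: "\<phi> ` bsphere_set ?n \<subseteq> \<Union>{c \<in> cells N. dim c < ?n}"
    using \<phi> by (auto simp: characteristic_map_def)
  have img: "\<phi> ` oball_set ?n = e" and inj_o: "inj_on \<phi> (oball_set ?n)"
    using homeomorphic_imp_surjective_map [OF hom] homeomorphic_imp_injective_map [OF hom]
      ball_sets_subset(2)[of ?n] cell_subset_topspace [OF e]
    by (auto simp: Int_absorb1)
  have inj_b: "inj_on \<phi> (bsphere_set ?n)"
    using emb [unfolded embedding_map_def, THEN homeomorphic_imp_injective_map] ball_sets_subset(3)[of ?n]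
    by (simp add: Int_absorb1)
  have disj: "e \<inter> \<phi> ` bsphere_set ?n = {}"
    using low cells_eqI [OF e] by fastforce
  have inj: "inj_on \<phi> (cball_set ?n)"
    unfolding ball_sets_Un [symmetric]
    using inj_o inj_b disj img by (auto simp: inj_on_Un)
  have top: "topspace (subtopology (Euclidean_space ?n) (cball_set ?n)) = cball_set ?n"
    using ball_sets_subset(1) by (simp add: Int_absorb1)
  have "compactin X (\<phi> ` cball_set ?n)"
    by (rule image_compactin [OF _ cont]) (simp add: compactin_subtopology compactin_cball_set)
  then have "closedin X (\<phi> ` cball_set ?n)"
    using Hausdorff compactin_imp_closedin by blast
  \<comment> \<open>The image of the closed ball is closed and contains \<open>e\<close>, which
    gives one inclusion; the other holds because the open ball is dense in the closed one.\<close>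
  then have "cl e \<subseteq> \<phi> ` cball_set ?n"
    using img ball_sets_Un[of ?n] by (intro closure_of_minimal) blast+
  moreover have "\<phi> ` cball_set ?n \<subseteq> cl e"
  proof -
    have "\<phi> ` (subtopology (Euclidean_space ?n) (cball_set ?n) closure_of oball_set ?n) \<subseteq> cl (\<phi> ` oball_set ?n)"
      by (rule continuous_map_image_closure_subset [OF cont])
    moreover have "cball_set ?n \<subseteq> subtopology (Euclidean_space ?n) (cball_set ?n) closure_of oball_set ?n"
      using cball_set_closure_of [of ?n] ball_sets_Un[of ?n]
      by (metis closure_of_subtopology Int_absorb1 Un_upper1 le_inf_iff order_refl)
    ultimately show ?thesis unfolding img by blast
  qed
  ultimately have cle: "\<phi> ` cball_set ?n = cl e" by blast
  have "homeomorphic_map (subtopology (Euclidean_space ?n) (cball_set ?n)) (subtopology X (cl e)) \<phi>"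
  proof (rule continuous_imp_homeomorphic_map)
    show "continuous_map (subtopology (Euclidean_space ?n) (cball_set ?n)) (subtopology X (cl e)) \<phi>"
      using cont cle by (auto simp: continuous_map_in_subtopology top Pi_iff)
    show "compact_space (subtopology (Euclidean_space ?n) (cball_set ?n))"
      by (simp add: compact_space_subtopology compactin_cball_set)
    show "Hausdorff_space (subtopology X (cl e))"
      by (simp add: Hausdorff Hausdorff_space_subtopology)
    show "\<phi> ` topspace (subtopology (Euclidean_space ?n) (cball_set ?n)) = topspace (subtopology X (cl e))"
      using closure_of_subset_topspace [of X e] unfolding top cle by (simp add: Int_absorb1)
  qed (unfold top, rule inj)
  then obtain \<psi> where "chart e \<phi> \<psi>"
    using img by (auto simp: chart_def homeomorphic_map_maps)
  moreover have "cl e - e = \<Union>D"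
  proof -
    have "cl e = e \<union> \<Union>D"
      unfolding cle [symmetric] ball_sets_Un [symmetric] image_Un img D(2) ..
    then show ?thesis using disj D(2) by auto
  qed
  moreover have "dim c < ?n" if "c \<in> D" for c
  proof -
    have c: "c \<in> cells N" using that D(1) by blast
    then obtain x where x: "x \<in> c" using cell_nonempty by blast
    then have "x \<in> \<phi> ` bsphere_set ?n" using that D(2) by blast
    then obtain d where "d \<in> cells N" "dim d < ?n" "x \<in> d" using low by blast
    then show ?thesis using cells_eqI [OF c _ x] by blast
  qed
  ultimately show thesis by (rule that [OF _ _ D(1)])
qed

lemma obtain_chart: 
  assumes "e \<in> cells N" obtains \<phi> \<psi> where "chart e \<phi> \<psi>"
  using obtain_chart_subcomplex [OF assms] by metis


lemma chartD:
  assumes "chart e \<phi> \<psi>"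
  shows "continuous_map (subtopology (Euclidean_space (dim e)) (cball_set (dim e))) (subtopology X (cl e)) \<phi>"
    "continuous_map (subtopology X (cl e)) (subtopology (Euclidean_space (dim e)) (cball_set (dim e))) \<psi>"
    "\<And>x. x \<in> cball_set (dim e) \<Longrightarrow> \<psi> (\<phi> x) = x"
    "\<And>y. y \<in> cl e \<Longrightarrow> \<phi> (\<psi> y) = y"
    "\<phi> ` cball_set (dim e) = cl e" "\<psi> ` cl e = cball_set (dim e)"
    "\<phi> ` oball_set (dim e) = e" "\<psi> ` e = oball_set (dim e)"
    "\<phi> ` bsphere_set (dim e) = cl e - e" "\<psi> ` (cl e - e) = bsphere_set (dim e)"
    "inj_on \<phi> (cball_set (dim e))" "inj_on \<psi> (cl e)"
proof -
  let ?n = "dim e"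
  have top: "topspace (subtopology (Euclidean_space ?n) (cball_set ?n)) = cball_set ?n"
    "topspace (subtopology X (cl e)) = cl e"
    using ball_sets_subset(1) closure_of_subset_topspace [of X e] by (auto simp: Int_absorb1)
  from assms show 1: "continuous_map (subtopology (Euclidean_space ?n) (cball_set ?n)) (subtopology X (cl e)) \<phi>"
    "continuous_map (subtopology X (cl e)) (subtopology (Euclidean_space ?n) (cball_set ?n)) \<psi>"
    and 2: "\<And>x. x \<in> cball_set ?n \<Longrightarrow> \<psi> (\<phi> x) = x" "\<And>y. y \<in> cl e \<Longrightarrow> \<phi> (\<psi> y) = y"
    and o: "\<phi> ` oball_set ?n = e"
    unfolding chart_def homeomorphic_maps_def top by blast+
  have sub: "\<phi> ` cball_set ?n \<subseteq> cl e" "\<psi> ` cl e \<subseteq> cball_set ?n"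
    using continuous_map_image_subset_topspace [OF 1(1)] continuous_map_image_subset_topspace [OF 1(2)]
    unfolding top by auto
  then show c: "\<phi> ` cball_set ?n = cl e" and c': "\<psi> ` cl e = cball_set ?n"
    using 2 by (auto simp: image_iff image_subset_iff; metis)+
  show inj: "inj_on \<phi> (cball_set ?n)" "inj_on \<psi> (cl e)"
    using 2 by (auto intro: inj_on_inverseI)
  show b: "\<phi> ` bsphere_set ?n = cl e - e"
  proof -
    have "bsphere_set ?n = cball_set ?n - oball_set ?n"
      using ball_sets_Un[of ?n] ball_sets_Int[of ?n] by auto
    then show ?thesis
      using o c inj_on_image_set_diff [OF inj(1), of "cball_set ?n" "oball_set ?n"] ball_sets_Un[of ?n]
      by (metis Diff_subset Un_upper1)
  qed
  have "\<psi> ` \<phi> ` T = T" if "T \<subseteq> cball_set ?n" for T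
    using 2(1) that by (force simp: image_image)
  then show "\<psi> ` e = oball_set ?n" "\<psi> ` (cl e - e) = bsphere_set ?n"
    using o b ball_sets_Un[of ?n] by (metis Un_upper1 Un_upper2)+
qed

lemma boundary_Union:
  assumes "e \<in> cells N"
  obtains D where "cl e - e = \<Union>D" "D \<subseteq> cells N" "\<And>c. c \<in> D \<Longrightarrow> dim c < dim e"
  using obtain_chart_subcomplex [OF assms] by metis

text \<open>By regularity the boundary of \<open>e\<close> is a union of whole cells of smaller
  dimension, so a different cell that meets the closure in a single point must be one of
  them.\<close>

lemma meets_closure:
  assumes e: "e \<in> cells N" and c: "c \<in> cells N" and x: "x \<in> c" "x \<in> cl e" and "c \<noteq> e"
  shows "c \<subseteq> cl e - e" "dim c < dim e"
proof -
  obtain D where D: "cl e - e = \<Union>D" "D \<subseteq> cells N" "\<And>c. c \<in> D \<Longrightarrow> dim c < dim e"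
    using boundary_Union [OF e] by metis
  have "x \<notin> e" using cells_eqI [OF e c] x assms(5) by blast
  then obtain d where d: "d \<in> D" "x \<in> d" using D(1) x(2) by blast
  then have "d = c" using cells_eqI [OF _ c _ x(1)] D(2) by blast
  then show "c \<subseteq> cl e - e" "dim c < dim e" using d D by auto
qed

lemma meets_closure_subset:
  "e \<in> cells N \<Longrightarrow> c \<in> cells N \<Longrightarrow> x \<in> c \<Longrightarrow> x \<in> cl e \<Longrightarrow> c \<subseteq> cl e"
  using meets_closure(1) cell_subset_closure by blast

lemma subset_closure_dim:
  "e \<in> cells N \<Longrightarrow> c \<in> cells N \<Longrightarrow> c \<subseteq> cl e \<Longrightarrow> c \<noteq> e \<Longrightarrow> dim c < dim e"
  using meets_closure(2) cell_nonempty by blast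

lemma subset_closure_trans: "c \<subseteq> cl d \<Longrightarrow> d \<subseteq> cl e \<Longrightarrow> c \<subseteq> cl e"
  by (meson closedin_closure_of closure_of_minimal subset_trans)

lemma closure_mono_cells: "d \<subseteq> cl e \<Longrightarrow> cl d \<subseteq> cl e"
  by (simp add: closure_of_minimal)

lemma obtain_cell:
  assumes "x \<in> topspace X" obtains e where "e \<in> cells N" "x \<in> e"
  using assms cover by blast

lemma compactin_closure: "e \<in> cells N \<Longrightarrow> compactin X (cl e)"
  by (metis chartD(1) chartD(5) compactin_cball_set compactin_subtopology continuous_map_in_subtopology
      image_compactin obtain_chart order_refl)

lemma connectedin_cell: 
  assumes e: "e \<in> cells N" shows "connectedin X e" "path_connectedin X (cl e)"
proof -
  obtain \<phi> \<psi> where ch: "chart e \<phi> \<psi>" using obtain_chart [OF e] .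
  have c: "continuous_map (subtopology (Euclidean_space (dim e)) (cball_set (dim e))) X \<phi>"
    using chartD(1)[OF ch] continuous_map_in_subtopology by blast
  have "connectedin (subtopology (Euclidean_space (dim e)) (cball_set (dim e))) (oball_set (dim e))"
    using path_connectedin_imp_connectedin [OF path_connectedin_oball_set] ball_sets_Un
    by (metis connectedin_subtopology Un_upper1)
  then show "connectedin X e"
    using connectedin_continuous_map_image [OF c] chartD(7)[OF ch] by metis
  have "path_connectedin (subtopology (Euclidean_space (dim e)) (cball_set (dim e))) (cball_set (dim e))"
    by (simp add: path_connectedin_subtopology path_connectedin_cball_set)
  then show "path_connectedin X (cl e)"
    using path_connectedin_continuous_map_image [OF c] chartD(5)[OF ch] by metis
qed

text \<open>Pick one point in every cell. A closed cell meets only finitely many cells, so by the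
  weak topology every set of picked points is closed. The picked points thus form a closed discrete
  subspace, which is finite in a compact space.\<close>

lemma compact_imp_finite_cells:
  assumes "compact_space X"
  shows "finite (cells N)"
proof -
  define p where "p e = (SOME x. x \<in> e)" for e :: "'a set"
  have p: "p e \<in> e" if "e \<in> cells N" for e
    using cell_nonempty [OF that] by (simp add: p_def some_in_eq)
  have inj: "inj_on p (cells N)"
    using p cells_eqI by (metis inj_onI)
  have cl: "closedin X A" if A: "A \<subseteq> p ` cells N" for A
  proof (rule weak_topology)
    show A': "A \<subseteq> topspace X" using A p cell_subset_topspace by blast
    fix e assume e: "e \<in> cells N"
    have "A \<inter> cl e \<subseteq> p ` {c \<in> cells N. c \<inter> cl e \<noteq> {}}"
      using A p by blast
    then have "finite (A \<inter> cl e)"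
      using finite_meeting_cells [OF e] finite_subset by blast
    then show "closedin X (A \<inter> cl e)"
      using A' Hausdorff by (meson Hausdorff_imp_t1_space inf.coboundedI1 t1_space_closedin_finite)
  qed
  have top: "p ` cells N \<subseteq> topspace X" using p cell_subset_topspace by blast
  have "compactin X (p ` cells N)"
    using cl [OF order_refl] assms closedin_compact_space by blast
  moreover have "subtopology X (p ` cells N) = discrete_topology (p ` cells N)"
  proof -
    have "x \<notin> X derived_set_of (p ` cells N)" if "x \<in> p ` cells N" for x
    proof
      assume "x \<in> X derived_set_of (p ` cells N)"
      moreover have "openin X (topspace X - (p ` cells N - {x}))"
        using cl by blast
      moreover have "x \<in> topspace X - (p ` cells N - {x})"
        using that top by blast
      ultimately obtain y where "y \<noteq> x" "y \<in> p ` cells N" "y \<in> topspace X - (p ` cells N - {x})"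
        unfolding in_derived_set_of by meson
      then show False by blast
    qed
    then show ?thesis
      using top by (subst subtopology_eq_discrete_topology_eq) blast
  qed
  ultimately have "finite (p ` cells N)"
    using compactin_subspace compact_space_discrete_topology by metis
  then show ?thesis
    using inj finite_imageD by blast
qed

lemma finite_imp_compact: 
  assumes "finite (cells N)" shows "compact_space X"
proof -
  have "topspace X = \<Union>(cl ` cells N)"
    using cover cell_subset_closure closure_of_subset_topspace [of X] by blast
  moreover have "compactin X (\<Union>(cl ` cells N))"
    using assms compactin_closure by (intro compactin_Union) auto
  ultimately show ?thesis by (simp add: compact_space_def)
qed

lemma vertex_singleton:
  assumes "v \<in> cells N" "dim v = 0" obtains p where "v = {p}" "cl v = {p}"
proof -
  obtain \<phi> \<psi> where ch: "chart v \<phi> \<psi>" using obtain_chart [OF assms(1)] .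
  show thesis
    using chartD(5)[OF ch] chartD(7)[OF ch] that unfolding assms(2) oball_set_0 cball_set_0 by auto
qed

lemma exists_vertex:
  assumes "e \<in> cells N" obtains v where "v \<in> cells N" "dim v = 0" "v \<subseteq> cl e"
  using assms
proof (induction "dim e" arbitrary: e thesis rule: less_induct)
  case less
  show ?case
  proof (cases "dim e = 0")
    case True
    then show ?thesis using less(2,3) cell_subset_closure by blast
  next
    case False
    obtain \<phi> \<psi> where ch: "chart e \<phi> \<psi>" using obtain_chart [OF less(3)] .
    have "cl e - e \<noteq> {}"
      using chartD(9)[OF ch] bsphere_set_nonempty False by blast
    then obtain x where x: "x \<in> cl e" "x \<notin> e" by blast
    then obtain c where c: "c \<in> cells N" "x \<in> c"
      using obtain_cell closure_of_subset_topspace by (metis subsetD)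
    then have "c \<noteq> e" using x by blast
    then have "c \<subseteq> cl e" "dim c < dim e"
      using meets_closure [OF less(3) c x(1)] by auto
    then show ?thesis
      using less(1)[of c] less(2) c(1) subset_closure_trans by metis
  qed
qed

lemma edge_ends:
  assumes e: "e \<in> cells N" "dim e = 1"
  obtains p q where "p \<noteq> q" "{p} \<in> cells N" "{q} \<in> cells N" "dim {p} = 0" "dim {q} = 0" "cl e - e = {p, q}"
proof -
  obtain \<phi> \<psi> where ch: "chart e \<phi> \<psi>" using obtain_chart [OF e(1)] .
  have b: "cl e - e = {\<phi> (of_line (-1)), \<phi> (of_line 1)}"
    using chartD(9)[OF ch] unfolding e(2) bsphere_set_1 by simp
  have ne: "\<phi> (of_line (-1)) \<noteq> \<phi> (of_line 1)"
  proof
    assume "\<phi> (of_line (-1)) = \<phi> (of_line 1)"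
    then have "of_line (-1) = of_line 1"
      by (rule inj_onD [OF chartD(11)[OF ch]]) (auto simp: e(2) cball_set_1 simp del: One_nat_def)
    then show False by (auto simp: of_line_def fun_eq_iff dest: spec[of _ 0])
  qed
  have "{p} \<in> cells N \<and> dim {p} = 0" if p: "p \<in> cl e - e" for p
  proof -
    obtain c where c: "c \<in> cells N" "p \<in> c"
      using obtain_cell closure_of_subset_topspace p by (metis DiffD1 subsetD)
    have "c \<noteq> e" using c(2) p by blast
    then have "dim c = 0" using meets_closure(2)[OF e(1) c] p e(2) by simp
    then show ?thesis using vertex_singleton [OF c(1)] c by (metis singletonD)
  qed
  then show thesis using that [OF ne] unfolding b by simp
qed

end

section \<open>Refinements and local dimension\<close>

context regular_complex
begin

lemma topspace_subtopology_closure: "W \<subseteq> cl e \<Longrightarrow> topspace (subtopology X W) = W"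
  using closure_of_subset_topspace [of X e] by (simp add: Int_absorb1 subset_trans)

lemma chart_restrict:
  assumes ch: "chart e \<phi> \<psi>" and W: "W \<subseteq> cl e"
  shows "continuous_map (subtopology (Euclidean_space (dim e)) (\<psi> ` W)) (subtopology X W) \<phi>"
    "continuous_map (subtopology X W) (subtopology (Euclidean_space (dim e)) (\<psi> ` W)) \<psi>"
    "inj_on \<phi> (\<psi> ` W)" "inj_on \<psi> W" "\<phi> ` \<psi> ` W = W" "\<psi> ` W \<subseteq> cball_set (dim e)"
proof -
  show sub: "\<psi> ` W \<subseteq> cball_set (dim e)"
    using W chartD(6)[OF ch] by blast
  show im: "\<phi> ` \<psi> ` W = W"
    using W chartD(4)[OF ch] by (force simp: image_image)
  show "inj_on \<phi> (\<psi> ` W)" "inj_on \<psi> W"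
    using chartD(11,12)[OF ch] sub W inj_on_subset by blast+
  have top: "topspace (subtopology (Euclidean_space (dim e)) (\<psi> ` W)) = \<psi> ` W"
    using sub ball_sets_subset(1)[of "dim e"] by (simp add: Int_absorb1)
  have 1: "continuous_map (subtopology (Euclidean_space (dim e)) (\<psi> ` W)) X \<phi>"
    using chartD(1)[OF ch] sub by (metis continuous_map_from_subtopology_mono continuous_map_in_subtopology)
  then show "continuous_map (subtopology (Euclidean_space (dim e)) (\<psi> ` W)) (subtopology X W) \<phi>"
    unfolding continuous_map_in_subtopology top using im by blast
  have 2: "continuous_map (subtopology X W) (Euclidean_space (dim e)) \<psi>"
    using chartD(2)[OF ch] W by (metis continuous_map_from_subtopology_mono continuous_map_in_subtopology)
  then show "continuous_map (subtopology X W) (subtopology (Euclidean_space (dim e)) (\<psi> ` W)) \<psi>"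
    unfolding continuous_map_in_subtopology topspace_subtopology_closure [OF W] by blast
qed

lemma chart_openin:
  assumes ch: "chart e \<phi> \<psi>" and W: "openin (subtopology X e) W" and e: "e \<in> cells N"
  shows "openin (Euclidean_space (dim e)) (\<psi> ` W)"
proof -
  have ee: "e \<subseteq> cl e" by (rule cell_subset_closure [OF e])
  have We: "W \<subseteq> e" using W openin_imp_subset by blast
  have "continuous_map (subtopology (Euclidean_space (dim e)) (oball_set (dim e))) (subtopology X e) \<phi>"
    using chart_restrict(1)[OF ch ee] chartD(8)[OF ch] by simp
  then have "openin (subtopology (Euclidean_space (dim e)) (oball_set (dim e)))
      {x \<in> topspace (subtopology (Euclidean_space (dim e)) (oball_set (dim e))). \<phi> x \<in> W}"
    using W by (rule openin_continuous_map_preimage)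
  then have "openin (Euclidean_space (dim e)) {x \<in> topspace (subtopology (Euclidean_space (dim e)) (oball_set (dim e))). \<phi> x \<in> W}"
    using openin_oball_set openin_trans_full by blast
  also have "{x \<in> topspace (subtopology (Euclidean_space (dim e)) (oball_set (dim e))). \<phi> x \<in> W} = {x \<in> oball_set (dim e). \<phi> x \<in> W}"
    using ball_sets_subset(2)[of "dim e"] by auto
  also have "\<dots> = \<psi> ` W"
  proof -
    have "oball_set (dim e) \<subseteq> cball_set (dim e)" using ball_sets_Un by blast
    then show ?thesis
      using chartD(3,4,8)[OF ch] We ee by (auto simp: image_iff; metis imageI subsetD)
  qed
  finally show ?thesis .
qed

lemma chart_openin_inverse:
  assumes ch: "chart e \<phi> \<psi>" and U: "openin (Euclidean_space (dim e)) U" "U \<subseteq> oball_set (dim e)" and e: "e \<in> cells N"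
  shows "openin (subtopology X e) (\<phi> ` U)"
proof -
  have ee: "e \<subseteq> cl e" by (rule cell_subset_closure [OF e])
  have ob: "oball_set (dim e) \<subseteq> cball_set (dim e)" using ball_sets_Un by blast
  have "continuous_map (subtopology X e) (Euclidean_space (dim e)) \<psi>"
    using chart_restrict(2)[OF ch ee] continuous_map_in_subtopology by blast
  then have "openin (subtopology X e) {x \<in> topspace (subtopology X e). \<psi> x \<in> U}"
    using U(1) by (rule openin_continuous_map_preimage)
  also have "{x \<in> topspace (subtopology X e). \<psi> x \<in> U} = \<phi> ` U"
    unfolding topspace_subtopology_closure [OF ee]
    using chartD(3,4,7)[OF ch] U(2) ee ob by (auto simp: image_iff; metis imageI subsetD)
  finally show ?thesis .
qed

text \<open>Only finitely many closed cells avoid \<open>x\<close>, so they can be removed together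
  without losing openness. What remains is the open star of \<open>x\<close>.\<close>

lemma open_star:
  assumes "finite (cells N)" "x \<in> topspace X"
  obtains Q where "openin X Q" "x \<in> Q" "\<And>c. c \<in> cells N \<Longrightarrow> c \<inter> Q \<noteq> {} \<Longrightarrow> x \<in> cl c"
proof
  let ?Q = "topspace X - \<Union>(cl ` {c \<in> cells N. x \<notin> cl c})"
  show "openin X ?Q"
    using assms(1) by (intro openin_diff closedin_Union) auto
  show "x \<in> ?Q" using assms(2) by blast
  show "x \<in> cl c" if "c \<in> cells N" "c \<inter> ?Q \<noteq> {}" for c
    using that cell_subset_closure by blast
qed

end

text \<open>The transition maps between the two charts inject an open set of each model space into
  the other, which excludes both strict inequalities.\<close>

lemma openin_two_charts_same_dim:
  assumes "regular_complex X M" "regular_complex X N" "e \<in> cells M" "c \<in> cells N" "W \<noteq> {}"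
    and We: "openin (subtopology X e) W" and Wc: "openin (subtopology X c) W"
  shows "cdim M e = cdim N c"
proof -
  interpret M: regular_complex X M by fact
  interpret N: regular_complex X N by fact
  obtain \<phi> \<psi> where ch: "M.chart e \<phi> \<psi>" using M.obtain_chart assms(3) .
  obtain \<phi>' \<psi>' where ch': "N.chart c \<phi>' \<psi>'" using N.obtain_chart assms(4) .
  have W: "W \<subseteq> M.cl e" and W': "W \<subseteq> M.cl c"
    using openin_imp_subset [OF We] openin_imp_subset [OF Wc] M.cell_subset_closure [OF assms(3)]
      N.cell_subset_closure [OF assms(4)] by auto
  note r = M.chart_restrict [OF ch W] and r' = N.chart_restrict [OF ch' W']
  have 1: "openin (Euclidean_space (cdim M e)) (\<psi> ` W)" and 2: "openin (Euclidean_space (cdim N c)) (\<psi>' ` W)"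
    using M.chart_openin [OF ch We assms(3)] N.chart_openin [OF ch' Wc assms(4)] .
  have "continuous_map (subtopology (Euclidean_space (cdim M e)) (\<psi> ` W)) (Euclidean_space (cdim N c)) (\<psi>' \<circ> \<phi>)"
    using continuous_map_compose [OF r(1) r'(2)] continuous_map_in_subtopology by blast
  moreover have "inj_on (\<psi>' \<circ> \<phi>) (\<psi> ` W)"
    by (intro comp_inj_on) (use r r' in auto)
  ultimately have "\<not> cdim N c < cdim M e"
    using no_injection_lower_dimension 1 assms(5) by blast
  moreover
  have "continuous_map (subtopology (Euclidean_space (cdim N c)) (\<psi>' ` W)) (Euclidean_space (cdim M e)) (\<psi> \<circ> \<phi>')"
    using continuous_map_compose [OF r'(1) r(2)] continuous_map_in_subtopology by blast
  moreover have "inj_on (\<psi> \<circ> \<phi>') (\<psi>' ` W)"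
    by (intro comp_inj_on) (use r r' in auto)
  ultimately show ?thesis
    using no_injection_lower_dimension 2 assms(5) by (metis image_is_empty linorder_neqE_nat)
qed

section \<open>Carriers and dimensions of the cells of a refinement\<close>

locale refined_complex = M: regular_complex X M + N: regular_complex X N
  for X :: "'a topology" and M N :: "'a cellulation" +
  assumes finite_M: "finite (cells M)" and refines: "cellulation_refines N M"
begin

abbreviation cl :: "'a set \<Rightarrow> 'a set" where "cl S \<equiv> X closure_of S"

abbreviation car :: "'a set \<Rightarrow> 'a set" where "car \<equiv> carrier_cell X M"

text \<open>Compactness belongs to the space and not to a cellulation, so it carries finiteness from
  \<open>M\<close> to its refinement.\<close>

lemma finite_N: "finite (cells N)"
  using M.finite_imp_compact [OF finite_M] N.compact_imp_finite_cells by blast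

lemma cell_in_cell: 
  assumes "\<sigma> \<in> cells N" "\<alpha> \<in> cells M" "x \<in> \<sigma>" "x \<in> \<alpha>" shows "\<sigma> \<subseteq> \<alpha>"
proof -
  obtain \<beta> where b: "\<beta> \<in> cells M" "\<sigma> \<subseteq> \<beta>"
    using refines assms(1) by (auto simp: cellulation_refines_def)
  then have "\<beta> = \<alpha>" using M.cells_eqI assms by blast
  then show ?thesis using b by simp
qed

lemma cell_in_closed_cell:
  assumes "\<sigma> \<in> cells N" "\<alpha> \<in> cells M" "x \<in> \<sigma>" "x \<in> cl \<alpha>" shows "\<sigma> \<subseteq> cl \<alpha>"
proof -
  obtain \<beta> where b: "\<beta> \<in> cells M" "\<sigma> \<subseteq> \<beta>"
    using refines assms(1) by (auto simp: cellulation_refines_def)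
  then show ?thesis using M.meets_closure_subset [OF assms(2) b(1)] assms by blast
qed

text \<open>Any other cell of \<open>M\<close> whose closure contains \<sigma> has a closure meeting
  \<alpha>, hence a larger dimension. The minimum over closed cells is therefore attained by the
  open cell containing \<sigma> and by no other.\<close>

lemma carrier_eq:
  assumes s: "\<sigma> \<in> cells N" and a: "\<alpha> \<in> cells M" "\<sigma> \<subseteq> \<alpha>"
  shows "car \<sigma> = \<alpha>"
proof -
  let ?P = "\<lambda>\<beta>. \<beta> \<in> cells M \<and> cl \<sigma> \<subseteq> cl \<beta>"
  have P: "?P \<alpha>" using a by (simp add: closure_of_mono)
  have car: "?P (car \<sigma>)" "cdim M (car \<sigma>) \<le> cdim M \<alpha>"
    unfolding carrier_cell_def using arg_min_nat_lemma [of ?P \<alpha> "cdim M", OF P] P by blast+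
  obtain x where x: "x \<in> \<sigma>" using N.cell_nonempty [OF s] by blast
  then have "x \<in> \<alpha>" "x \<in> cl (car \<sigma>)" using a car N.cell_subset_closure [OF s] by auto
  then show ?thesis
    using M.meets_closure(2)[of "car \<sigma>" \<alpha> x] a car by (metis linorder_not_le)
qed

lemma carrier: 
  assumes "\<sigma> \<in> cells N" shows "car \<sigma> \<in> cells M" "\<sigma> \<subseteq> car \<sigma>"
proof -
  obtain \<beta> where "\<beta> \<in> cells M" "\<sigma> \<subseteq> \<beta>"
    using refines assms by (auto simp: cellulation_refines_def)
  then show "car \<sigma> \<in> cells M" "\<sigma> \<subseteq> car \<sigma>" using carrier_eq [OF assms] by auto
qed

lemma carrier_face:
  assumes "\<tau> \<in> cells N" "\<sigma> \<in> cells N" "\<tau> \<subseteq> cl \<sigma>"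
  shows "car \<tau> \<subseteq> cl (car \<sigma>)"
proof -
  obtain x where "x \<in> \<tau>" using N.cell_nonempty [OF assms(1)] by blast
  then show ?thesis
    using M.meets_closure_subset [of "car \<sigma>" "car \<tau>" x] carrier assms closure_of_mono [of \<sigma> "car \<sigma>" X] by blast
qed

text \<open>Among the cells of \<open>N\<close> that meet \<open>Q\<close> inside \<alpha>, one of
  maximal dimension meets it in a set that is open both in \<alpha> and in that cell, so the two
  dimensions agree. Maximality then also bounds the dimension of the other cells, which is why
  existence and bound are proved together.\<close>

lemma local_dimension_aux:
  assumes a: "\<alpha> \<in> cells M" and Q: "openin X Q" and x: "x \<in> \<alpha>" "x \<in> Q"
  shows "\<exists>\<sigma>\<in>cells N. \<sigma> \<subseteq> \<alpha> \<and> \<sigma> \<inter> Q \<noteq> {} \<and> cdim N \<sigma> = cdim M \<alpha> \<and>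
    (\<forall>c\<in>cells N. c \<inter> (Q \<inter> \<alpha>) \<noteq> {} \<longrightarrow> cdim N c \<le> cdim M \<alpha>)"
proof -
  let ?S = "{c \<in> cells N. c \<inter> (Q \<inter> \<alpha>) \<noteq> {}}"
  obtain c where "c \<in> cells N" "x \<in> c"
    using N.obtain_cell M.cell_subset_topspace [OF a] x(1) by blast
  then have S: "finite ?S" "?S \<noteq> {}" using x finite_N by auto
  have "Max (cdim N ` ?S) \<in> cdim N ` ?S" using S by (intro Max_in) auto
  then obtain \<sigma> where "Max (cdim N ` ?S) = cdim N \<sigma>" and s: "\<sigma> \<in> ?S" by (rule imageE)
  then have max: "cdim N c \<le> cdim N \<sigma>" if "c \<in> ?S" for c
    using Max_ge [OF finite_imageI [OF S(1)] imageI [OF that], of "cdim N"] by simp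
  have sN: "\<sigma> \<in> cells N" using s by blast
  have sa: "\<sigma> \<subseteq> \<alpha>" using s cell_in_cell a by blast
  let ?C = "{c \<in> cells N. c \<noteq> \<sigma> \<and> cdim N c \<le> cdim N \<sigma>}"
  \<comment> \<open>The removed closures do not touch \<sigma>, since a cell meeting the closure of
    another one has strictly smaller dimension. Every other cell that could meet \<open>Q\<close>
    inside \<alpha> is removed.\<close>
  define Q' where "Q' = Q - \<Union>(cl ` ?C)"
  have Q': "openin X Q'"
    unfolding Q'_def using finite_N Q by (intro openin_diff closedin_Union) auto
  have dis: "\<sigma> \<inter> cl c = {}" if "c \<in> ?C" for c
    using N.meets_closure(2)[of c \<sigma>] that sN by fastforce
  have "Q' \<inter> \<alpha> \<subseteq> \<sigma>"
  proof
    fix y assume y: "y \<in> Q' \<inter> \<alpha>"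
    then obtain c where c: "c \<in> cells N" "y \<in> c"
      using N.obtain_cell M.cell_subset_topspace [OF a] by blast
    then have "c \<in> ?S" using y by (auto simp: Q'_def)
    then have "cdim N c \<le> cdim N \<sigma>" by (rule max)
    then have "c = \<sigma>" using y c N.cell_subset_closure [OF c(1)] unfolding Q'_def by blast
    then show "y \<in> \<sigma>" using c by simp
  qed
  moreover have "Q \<inter> \<sigma> \<subseteq> Q'" using dis unfolding Q'_def by blast
  ultimately have eq: "Q' \<inter> \<alpha> = Q \<inter> \<sigma>" using sa unfolding Q'_def by blast
  have "openin (subtopology X \<alpha>) (Q \<inter> \<sigma>)"
    using Q' unfolding eq [symmetric] by (metis openin_subtopology)
  moreover have "openin (subtopology X \<sigma>) (Q \<inter> \<sigma>)"
    using Q by (metis openin_subtopology)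
  moreover have "Q \<inter> \<sigma> \<noteq> {}" using s by blast
  ultimately have d: "cdim M \<alpha> = cdim N \<sigma>"
    by (intro openin_two_charts_same_dim [OF M.regular_complex_axioms N.regular_complex_axioms a sN])
  show ?thesis
    using s sN sa max unfolding d by blast
qed

lemma local_dimension:
  assumes "\<alpha> \<in> cells M" "openin X Q" "x \<in> \<alpha>" "x \<in> Q"
  obtains \<sigma> where "\<sigma> \<in> cells N" "\<sigma> \<subseteq> \<alpha>" "\<sigma> \<inter> Q \<noteq> {}" "cdim N \<sigma> = cdim M \<alpha>"
  using local_dimension_aux [OF assms] by blast

lemma dim_le:
  assumes "\<alpha> \<in> cells M" "\<sigma> \<in> cells N" "\<sigma> \<subseteq> \<alpha>"
  shows "cdim N \<sigma> \<le> cdim M \<alpha>"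
proof -
  obtain x where x: "x \<in> \<sigma>" using N.cell_nonempty [OF assms(2)] by blast
  then have "x \<in> \<alpha>" "x \<in> topspace X" using assms M.cell_subset_topspace by auto
  then show ?thesis
    using local_dimension_aux [OF assms(1) openin_topspace, of x] assms(2) x by blast
qed

lemma exists_top_cell:
  assumes "\<alpha> \<in> cells M"
  obtains \<sigma> where "\<sigma> \<in> cells N" "\<sigma> \<subseteq> \<alpha>" "cdim N \<sigma> = cdim M \<alpha>"
proof -
  obtain x where "x \<in> \<alpha>" using M.cell_nonempty [OF assms] by blast
  then show thesis
    using local_dimension [OF assms openin_topspace] M.cell_subset_topspace [OF assms] that by blast
qed

text \<open>A point of \<tau> is a limit of points of \<beta>, so its open star meets \<beta>. There
  \<open>local_dimension\<close> finds a top cell, and every cell meeting the star has \<tau> in its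
  closure.\<close>

lemma exists_top_coface:
  assumes b: "\<beta> \<in> cells M" and t: "\<tau> \<in> cells N" "\<tau> \<subseteq> cl \<beta>"
  obtains \<sigma> where "\<sigma> \<in> cells N" "\<sigma> \<subseteq> \<beta>" "cdim N \<sigma> = cdim M \<beta>" "\<tau> \<subseteq> cl \<sigma>"
proof -
  obtain x where x: "x \<in> \<tau>" using N.cell_nonempty [OF t(1)] by blast
  obtain Q where Q: "openin X Q" "x \<in> Q" "\<And>c. c \<in> cells N \<Longrightarrow> c \<inter> Q \<noteq> {} \<Longrightarrow> x \<in> cl c"
    using N.open_star [OF finite_N] x N.cell_subset_topspace [OF t(1)] by blast
  have "x \<in> cl \<beta>" using x t by blast
  then obtain y where "y \<in> \<beta>" "y \<in> Q"
    using Q unfolding in_closure_of by blast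
  then obtain \<sigma> where s: "\<sigma> \<in> cells N" "\<sigma> \<subseteq> \<beta>" "\<sigma> \<inter> Q \<noteq> {}" "cdim N \<sigma> = cdim M \<beta>"
    using local_dimension [OF b Q(1)] by metis
  have "\<tau> \<subseteq> cl \<sigma>"
    using N.meets_closure_subset [OF s(1) t(1) x] Q(3)[OF s(1,3)] by blast
  then show thesis using that s by blast
qed

end

section \<open>Cells adjacent to a facet\<close>

definition rad :: "nat \<Rightarrow> (nat \<Rightarrow> real) \<Rightarrow> real" where "rad n w = sqrt (sqsum n w)"

text \<open>This is the radial projection onto the closed unit ball; \<open>max 1\<close> makes it
  the identity inside and gives a continuous formula on the whole space.\<close>

definition clamp :: "nat \<Rightarrow> (nat \<Rightarrow> real) \<Rightarrow> nat \<Rightarrow> real" where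
  "clamp n w = (\<lambda>i. (1 / max 1 (rad n w)) * w i)"

lemma rad_nonneg [simp]: "0 \<le> rad n w" by (simp add: rad_def)

lemma rad_scale: "rad n (\<lambda>i. c * x i) = \<bar>c\<bar> * rad n x"
  by (simp add: rad_def sqsum_scale real_sqrt_mult)

lemma ball_sets_rad: "x \<in> cball_set n \<longleftrightarrow> x \<in> topspace (Euclidean_space n) \<and> rad n x \<le> 1"
  "x \<in> oball_set n \<longleftrightarrow> x \<in> topspace (Euclidean_space n) \<and> rad n x < 1"
  "x \<in> bsphere_set n \<longleftrightarrow> x \<in> topspace (Euclidean_space n) \<and> rad n x = 1"
  by (auto simp: cball_set_sqsum oball_set_sqsum bsphere_set_sqsum rad_def)

lemma continuous_map_rad: "continuous_map (Euclidean_space n) euclideanreal (rad n)"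
  unfolding rad_def
  using continuous_map_compose [OF continuous_map_sqsum, of euclideanreal sqrt n] by (simp add: o_def continuous_on_real_sqrt)

lemma continuous_map_clamp: "continuous_map (Euclidean_space n) (Euclidean_space n) (clamp n)"
  unfolding clamp_def
  by (intro continuous_map_Euclidean_space_scale continuous_map_real_divide continuous_map_real_max
      continuous_map_rad) auto

lemma clamp_inside: "rad n w \<le> 1 \<Longrightarrow> clamp n w = w"
  by (simp add: clamp_def max_def)

lemma rad_clamp: "1 \<le> rad n w \<Longrightarrow> rad n (clamp n w) = 1"
  unfolding clamp_def rad_scale by (auto simp: max_def)

lemma scale_clamp: "1 \<le> rad n w \<Longrightarrow> (\<lambda>i. rad n w * clamp n w i) = w"
  by (auto simp: clamp_def max_def)

lemma clamp_in: "w \<in> topspace (Euclidean_space n) \<Longrightarrow> clamp n w \<in> topspace (Euclidean_space n)"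
  by (simp add: clamp_def topspace_Euclidean_space)

text \<open>The part of the cone over \<open>A\<close> from the origin that lies on or outside the
  unit sphere.\<close>

definition collar :: "nat \<Rightarrow> (nat \<Rightarrow> real) set \<Rightarrow> (nat \<Rightarrow> real) set" where
  "collar n A = {w \<in> topspace (Euclidean_space n). 1 \<le> rad n w \<and> clamp n w \<in> A}"

text \<open>\<open>P\<close> and \<open>Q\<close> agree along \<open>A\<close> and glue to an
  injective continuous map on the ball together with the collar. This domain is open because
  \<open>A\<close> is relatively open in the sphere, so invariance of domain applies.\<close>

lemma openin_collar_extension:
  assumes A: "A \<subseteq> bsphere_set n" "closedin (Euclidean_space n) (bsphere_set n - A)"
    and P: "continuous_map (subtopology (Euclidean_space n) (oball_set n \<union> A)) (Euclidean_space n) P"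
      "inj_on P (oball_set n \<union> A)"
    and Q: "continuous_map (subtopology (Euclidean_space n) (collar n A)) (Euclidean_space n) Q"
      "inj_on Q (collar n A)"
    and PQ: "\<And>z. z \<in> A \<Longrightarrow> Q z = P z" "P ` oball_set n \<inter> Q ` collar n A = {}"
  shows "openin (Euclidean_space n) (P ` oball_set n \<union> Q ` collar n A)"
proof -
  let ?E = "Euclidean_space n"
  define U where "U = oball_set n \<union> collar n A"
  define f where "f w = (if rad n w \<le> 1 then P w else Q w)" for w
  have Utop: "U \<subseteq> topspace ?E" by (auto simp: U_def collar_def ball_sets_rad)
  have mem: "w \<in> A" if "w \<in> collar n A" "rad n w \<le> 1" for w
    using that clamp_inside by (auto simp: collar_def)
  have mem': "w \<in> collar n A" if "w \<in> A" for w
    using that A(1) clamp_inside[of n w] by (auto simp: collar_def ball_sets_rad subset_iff)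
  \<comment> \<open>Openness of \<open>U\<close> is read off from the projection: it is the preimage
    under \<open>clamp n\<close> of the complement of a closed set.\<close>
  have "U = {w \<in> topspace ?E. clamp n w \<in> topspace ?E - (bsphere_set n - A)}"
  proof -
    have "w \<in> U \<longleftrightarrow> clamp n w \<notin> bsphere_set n - A" if w: "w \<in> topspace ?E" for w
    proof (cases "rad n w < 1")
      case True
      then show ?thesis using w by (simp add: U_def ball_sets_rad clamp_inside)
    next
      case False
      then show ?thesis using w clamp_in [OF w] rad_clamp[of n w]
        by (simp add: U_def ball_sets_rad collar_def)
    qed
    then show ?thesis using Utop clamp_in by blast
  qed
  then have Uopen: "openin ?E U"
    using openin_continuous_map_preimage [OF continuous_map_clamp, of n "topspace ?E - (bsphere_set n - A)"] A(2)
    by (simp add: closedin_def openin_diff)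
  have "continuous_map (subtopology ?E U) ?E f"
    unfolding f_def
  proof (rule continuous_map_cases_le)
    show "continuous_map (subtopology ?E U) euclideanreal (rad n)"
      by (intro continuous_map_from_subtopology continuous_map_rad)
    have "U \<inter> {w. rad n w \<le> 1} \<subseteq> oball_set n \<union> A"
      using mem by (auto simp: U_def)
    then show "continuous_map (subtopology (subtopology ?E U) {w \<in> topspace (subtopology ?E U). rad n w \<le> 1}) ?E P"
      using Utop by (auto simp: subtopology_subtopology intro: continuous_map_from_subtopology_mono [OF P(1)])
    have "U \<inter> {w. 1 \<le> rad n w} \<subseteq> collar n A"
      by (auto simp: U_def ball_sets_rad)
    then show "continuous_map (subtopology (subtopology ?E U) {w \<in> topspace (subtopology ?E U). 1 \<le> rad n w}) ?E Q"
      using Utop by (auto simp: subtopology_subtopology intro: continuous_map_from_subtopology_mono [OF Q(1)])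
    show "P w = Q w" if "w \<in> topspace (subtopology ?E U)" "rad n w = 1" for w
      using that PQ(1) mem by (auto simp: U_def ball_sets_rad)
  qed simp
  moreover have fo: "f w = P w" if "w \<in> oball_set n" for w
    using that by (simp add: f_def ball_sets_rad)
  moreover have fc: "f w = Q w" if "w \<in> collar n A" for w
    using that mem PQ(1) by (auto simp: f_def)
  moreover have "inj_on f U"
  proof -
    have "inj_on f (oball_set n)" "inj_on f (collar n A)"
      using P(2) Q(2) fo fc by (auto simp: inj_on_def)
    moreover have "f ` oball_set n = P ` oball_set n" "f ` collar n A = Q ` collar n A"
      using fo fc by auto
    ultimately show ?thesis
      unfolding U_def inj_on_Un using PQ(2) by auto
  qed
  ultimately have "openin ?E (f ` U)"
    by (intro invariance_of_domain_Euclidean_space Uopen)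
  moreover have "f ` U = P ` oball_set n \<union> Q ` collar n A"
    unfolding U_def image_Un using fo fc by auto
  ultimately show ?thesis by simp
qed

context regular_complex
begin

text \<open>All cells in the boundary of \<open>F\<close> have dimension at most that of
  \<open>e\<close>, so the closure of a boundary cell other than \<open>e\<close> never meets
  \<open>e\<close>. The rest of the boundary is then a finite union of closed cells.\<close>

lemma closedin_boundary_minus_facet:
  assumes fin: "finite (cells N)" and F: "F \<in> cells N" and e: "e \<in> cells N" "e \<subseteq> cl F" "dim F = Suc (dim e)"
  shows "closedin X (cl F - F - e)"
proof -
  have "cl F - F - e = \<Union>(cl ` {c \<in> cells N. c \<subseteq> cl F - F \<and> c \<noteq> e})" (is "_ = \<Union>(cl ` ?C)")
  proof (intro equalityI subsetI)
    fix y assume y: "y \<in> cl F - F - e"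
    then obtain c where c: "c \<in> cells N" "y \<in> c"
      using obtain_cell closure_of_subset_topspace by (metis DiffD1 subsetD)
    then have "c \<noteq> F" "c \<noteq> e" using y by auto
    then show "y \<in> \<Union>(cl ` ?C)"
      using meets_closure(1)[OF F c] y c cell_subset_closure [OF c(1)] by auto
  next
    fix y assume "y \<in> \<Union>(cl ` ?C)"
    then obtain c where c: "c \<in> cells N" "c \<subseteq> cl F - F" "c \<noteq> e" "y \<in> cl c" by blast
    have "c \<noteq> F" using c(2) cell_nonempty [OF c(1)] by blast
    then have dc: "dim c < dim F" using subset_closure_dim [OF F c(1)] c(2) by blast
    have "y \<notin> F"
    proof
      assume "y \<in> F"
      then have "dim F < dim c" using meets_closure(2)[OF c(1) F _ c(4)] \<open>c \<noteq> F\<close> by auto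
      then show False using dc by simp
    qed
    moreover have "y \<notin> e"
    proof
      assume "y \<in> e"
      then have "dim e < dim c" using meets_closure(2)[OF c(1) e(1) _ c(4)] c(3) by auto
      then show False using dc e(3) by simp
    qed
    moreover have "y \<in> cl F" using closure_mono_cells [of c F] c by blast
    ultimately show "y \<in> cl F - F - e" by blast
  qed
  then show ?thesis
    using fin by (metis (no_types, lifting) closedin_Union closedin_closure_of finite_imageI finite_subset
        imageE mem_Collect_eq subsetI)
qed

text \<open>In a chart of \<open>F\<close> the facet becomes a relatively open part of the sphere,
  in the form that \<open>openin_collar_extension\<close> expects.\<close>

lemma chart_facet:
  assumes fin: "finite (cells N)" and F: "F \<in> cells N" and e: "e \<in> cells N" "e \<subseteq> cl F" "dim F = Suc (dim e)"
    and ch: "chart F \<phi> \<psi>"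
  shows "\<psi> ` e \<subseteq> bsphere_set (dim F)" "closedin (Euclidean_space (dim F)) (bsphere_set (dim F) - \<psi> ` e)"
    "\<psi> ` (F \<union> e) = oball_set (dim F) \<union> \<psi> ` e"
proof -
  obtain x where x: "x \<in> e" "x \<in> cl F" using cell_nonempty [OF e(1)] e(2) by blast
  have "e \<noteq> F" using e(3) by auto
  then have eF: "e \<subseteq> cl F - F" using meets_closure(1)[OF F e(1) x] by blast
  then show "\<psi> ` e \<subseteq> bsphere_set (dim F)" using chartD(10)[OF ch] by blast
  show "\<psi> ` (F \<union> e) = oball_set (dim F) \<union> \<psi> ` e" using chartD(8)[OF ch] by (simp add: image_Un)
  have "closedin X (cl F - F - e)" by (rule closedin_boundary_minus_facet [OF fin F e])
  then have "compactin X (cl F - F - e)"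
    by (intro closed_compactin [OF compactin_closure [OF F]]) auto
  moreover have "cl F - F - e \<subseteq> cl F" by blast
  ultimately have "compactin (Euclidean_space (dim F)) (\<psi> ` (cl F - F - e))"
    using chartD(2)[OF ch] image_compactin [of "subtopology X (cl F)" _ "Euclidean_space (dim F)" \<psi>]
    by (simp add: compactin_subtopology continuous_map_in_subtopology)
  moreover have "\<psi> ` (cl F - F - e) = bsphere_set (dim F) - \<psi> ` e"
    using inj_on_image_set_diff [OF chartD(12)[OF ch], of "cl F - F" e] chartD(10)[OF ch] e(2) by auto
  ultimately show "closedin (Euclidean_space (dim F)) (bsphere_set (dim F) - \<psi> ` e)"
    using Hausdorff_Euclidean_space compactin_imp_closedin by metis
qed

end

context refined_complex
begin

text \<open>Invariance of domain is applied to \<open>F1 \<union> e\<close>, extended radially over \<open>e\<close> into \<open>F2\<close>: together they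
  cover a neighbourhood of \<open>e\<close>, so no third cell can be adjacent to \<open>e\<close>.\<close>

lemma facet_interior_two_cofaces:
  assumes a: "\<alpha> \<in> cells M" and e: "e \<in> cells N" "e \<subseteq> \<alpha>"
    and F1: "F1 \<in> cells N" "F1 \<subseteq> \<alpha>" "e \<subseteq> cl F1" and F2: "F2 \<in> cells N" "F2 \<subseteq> \<alpha>" "e \<subseteq> cl F2"
    and F3: "F3 \<in> cells N" "F3 \<subseteq> \<alpha>" "e \<subseteq> cl F3"
    and d: "Suc (cdim N e) = cdim M \<alpha>" "cdim N F1 = cdim M \<alpha>" "cdim N F2 = cdim M \<alpha>" "cdim N F3 = cdim M \<alpha>"
    and ne: "F1 \<noteq> F2"
  shows "F3 = F1 \<or> F3 = F2"
proof -
  define n where "n = cdim M \<alpha>"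
  let ?E = "Euclidean_space n"
  note d' = d [folded n_def]
  obtain \<phi> \<psi> where ch: "M.chart \<alpha> \<phi> \<psi>" using M.obtain_chart [OF a] .
  obtain \<phi>1 \<psi>1 where ch1: "N.chart F1 \<phi>1 \<psi>1" using N.obtain_chart [OF F1(1)] .
  obtain \<phi>2 \<psi>2 where ch2: "N.chart F2 \<phi>2 \<psi>2" using N.obtain_chart [OF F2(1)] .
  define A where "A = \<psi>1 ` e"
  have A: "A \<subseteq> bsphere_set n" "closedin ?E (bsphere_set n - A)" "\<psi>1 ` (F1 \<union> e) = oball_set n \<union> A"
    using N.chart_facet [OF finite_N F1(1) e(1) F1(3) _ ch1] d' by (simp_all add: A_def)
  have B: "\<psi>2 ` e \<subseteq> bsphere_set n" "\<psi>2 ` (F2 \<union> e) = oball_set n \<union> \<psi>2 ` e"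
    using N.chart_facet [OF finite_N F2(1) e(1) F2(3) _ ch2] d' by simp_all
  have sub: "F1 \<union> e \<subseteq> cl F1" "F2 \<union> e \<subseteq> cl F2" "F1 \<union> e \<subseteq> cl \<alpha>" "F2 \<union> e \<subseteq> cl \<alpha>"
    using N.cell_subset_closure M.cell_subset_closure [OF a] F1 F2 e by auto
  have disj: "F1 \<inter> F2 = {}" "F1 \<inter> e = {}" "F2 \<inter> e = {}"
    using N.cells_eqI F1(1) F2(1) e(1) ne d' by fastforce+
  note r = M.chart_restrict [OF ch, folded n_def]
  note r1 = N.chart_restrict [OF ch1, unfolded d'] and r2 = N.chart_restrict [OF ch2, unfolded d']
  define P where "P = \<psi> \<circ> \<phi>1"
  \<comment> \<open>Inversion in the sphere: a collar point of radius \<open>s\<close> over a point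
    of \<open>A\<close> goes to radius \<open>1 / s\<close> in the model of \<open>F2\<close>, on
    the ray determined by the identification of the two copies of \<open>e\<close>. The outside of
    the ball of \<open>F1\<close> is thereby folded into the inside of the ball of
    \<open>F2\<close>.\<close>
  define q where "q w = (\<lambda>i. (1 / max 1 (rad n w)) * \<psi>2 (\<phi>1 (clamp n w)) i)" for w
  define Q where "Q = \<psi> \<circ> (\<phi>2 \<circ> q)"
  have P: "continuous_map (subtopology ?E (oball_set n \<union> A)) ?E P" "inj_on P (oball_set n \<union> A)"
    "P ` (oball_set n \<union> A) = \<psi> ` (F1 \<union> e)"
  proof -
    have "continuous_map (subtopology X (F1 \<union> e)) ?E \<psi>"
      using r(2)[OF sub(3)] continuous_map_in_subtopology by blast
    then show "continuous_map (subtopology ?E (oball_set n \<union> A)) ?E P"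
      unfolding P_def using r1(1)[OF sub(1)] A(3) continuous_map_compose by metis
    show "inj_on P (oball_set n \<union> A)"
      unfolding P_def A(3) [symmetric]
      using r1(3,5)[OF sub(1)] r(4)[OF sub(3)] by (intro comp_inj_on) auto
    show "P ` (oball_set n \<union> A) = \<psi> ` (F1 \<union> e)"
      unfolding P_def A(3) [symmetric] image_comp [symmetric] r1(5)[OF sub(1)] ..
  qed
  let ?K = "collar n A"
  have Ktop: "topspace (subtopology ?E ?K) = ?K"
    by (auto simp: collar_def)
  have c0: "continuous_map (subtopology ?E ?K) (subtopology ?E A) (clamp n)"
    unfolding continuous_map_in_subtopology Ktop
    by (auto intro: continuous_map_from_subtopology [OF continuous_map_clamp] simp: collar_def)
  have ecl: "e \<subseteq> cl F1" "e \<subseteq> cl F2" using sub by auto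
  have cl1: "continuous_map (subtopology ?E ?K) (subtopology X e) (\<phi>1 \<circ> clamp n)"
    using continuous_map_compose [OF c0] r1(1)[OF ecl(1)] unfolding A_def by blast
  then have e1: "\<phi>1 (clamp n w) \<in> e" if "w \<in> ?K" for w
    using continuous_map_image_subset_topspace [OF cl1] that unfolding Ktop by auto
  have s2: "\<psi>2 (\<phi>1 (clamp n w)) \<in> bsphere_set n" if "w \<in> ?K" for w
    using e1 [OF that] B(1) by blast
  have "continuous_map (subtopology ?E ?K) ?E (\<psi>2 \<circ> (\<phi>1 \<circ> clamp n))"
    using continuous_map_compose [OF cl1 r2(2)[OF ecl(2)]] continuous_map_in_subtopology by blast
  then have "continuous_map (subtopology ?E ?K) ?E q"
    unfolding q_def
    by (intro continuous_map_Euclidean_space_scale continuous_map_real_divide continuous_map_real_max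
      continuous_map_from_subtopology [OF continuous_map_rad]) (auto simp: o_def)
  moreover
  have radq: "rad n (q w) = 1 / rad n w" and qin: "q w \<in> oball_set n \<union> \<psi>2 ` e" 
    and qin': "rad n w > 1 \<Longrightarrow> q w \<in> oball_set n"
    and qon: "rad n w = 1 \<Longrightarrow> q w = \<psi>2 (\<phi>1 w)" if w: "w \<in> ?K" for w
  proof -
    have w1: "1 \<le> rad n w" using w by (simp add: collar_def)
    have q: "q w = (\<lambda>i. (1 / rad n w) * \<psi>2 (\<phi>1 (clamp n w)) i)"
      using w1 by (simp add: q_def max_def)
    show rq: "rad n (q w) = 1 / rad n w"
      using s2 [OF w] w1 unfolding q rad_scale by (simp add: ball_sets_rad)
    have top: "q w \<in> topspace ?E"
      unfolding q using s2 [OF w] by (intro scale_in_Euclidean_space) (simp add: ball_sets_rad)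
    show 1: "q w \<in> oball_set n" if "rad n w > 1"
      using top that rq by (simp add: ball_sets_rad)
    show 2: "q w = \<psi>2 (\<phi>1 w)" if "rad n w = 1"
      using that by (simp add: q clamp_inside)
    show "q w \<in> oball_set n \<union> \<psi>2 ` e"
      using 1 2 w1 e1 [OF w] clamp_inside[of n w] by (cases "rad n w = 1") auto
  qed
  ultimately have cq: "continuous_map (subtopology ?E ?K) (subtopology ?E (\<psi>2 ` (F2 \<union> e))) q"
    unfolding continuous_map_in_subtopology Ktop B(2) by blast
  have cq2: "continuous_map (subtopology ?E ?K) (subtopology X (F2 \<union> e)) (\<phi>2 \<circ> q)"
    by (rule continuous_map_compose [OF cq r2(1)[OF sub(2)]])
  have Q: "continuous_map (subtopology ?E ?K) ?E Q"
    unfolding Q_def using continuous_map_compose [OF cq2 r(2)[OF sub(4)]] continuous_map_in_subtopology by blast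
  have injq: "inj_on q ?K"
  proof
    fix w w' assume w: "w \<in> ?K" "w' \<in> ?K" and eq: "q w = q w'"
    have w1: "1 \<le> rad n w" "1 \<le> rad n w'" using w by (auto simp: collar_def)
    have "1 / rad n w = 1 / rad n w'" using radq w eq by metis
    then have rr: "rad n w = rad n w'" using w1 by simp
    have "\<psi>2 (\<phi>1 (clamp n w)) = \<psi>2 (\<phi>1 (clamp n w'))"
      using eq w1 unfolding q_def rr by (auto simp: fun_eq_iff)
    then have "\<phi>1 (clamp n w) = \<phi>1 (clamp n w')"
      using inj_onD [OF r2(4)[OF ecl(2)]] e1 w by blast
    then have "clamp n w = clamp n w'"
      using inj_onD [OF r1(3)[OF ecl(1)]] w by (auto simp: collar_def A_def)
    then show "w = w'" using scale_clamp [OF w1(1)] scale_clamp [OF w1(2)] rr by metis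
  qed
  have qK: "q ` ?K \<subseteq> \<psi>2 ` (F2 \<union> e)" using qin B(2) by auto
  then have pqK: "(\<phi>2 \<circ> q) ` ?K \<subseteq> F2 \<union> e"
    using r2(5)[OF sub(2)] by (auto simp: image_subset_iff; blast)
  have injQ: "inj_on Q ?K"
    unfolding Q_def
    by (intro comp_inj_on injq inj_on_subset [OF r2(3)[OF sub(2)] qK] inj_on_subset [OF r(4)[OF sub(4)] pqK])
  have QA: "Q z = P z" if z: "z \<in> A" for z
  proof -
    obtain y where y: "y \<in> e" "z = \<psi>1 y" using z by (auto simp: A_def)
    have z1: "rad n z = 1" "z \<in> topspace ?E" using A(1) z by (auto simp: ball_sets_rad)
    then have zK: "z \<in> ?K" using z clamp_inside[of n z] by (simp add: collar_def)
    have "q z = \<psi>2 (\<phi>1 z)" by (rule qon [OF zK z1(1)])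
    moreover have "\<phi>1 z \<in> cl F2" using e1 [OF zK] clamp_inside[of n z] z1 ecl by auto
    ultimately show ?thesis
      using N.chartD(4)[OF ch2] by (simp add: P_def Q_def)
  qed
  have Qim: "Q ` ?K \<subseteq> \<psi> ` (F2 \<union> e)" using pqK by (auto simp: Q_def)
  have inj\<psi>: "inj_on \<psi> (cl \<alpha>)" using M.chartD(12)[OF ch] .
  have P1: "P ` oball_set n = \<psi> ` F1"
    using N.chartD(7)[OF ch1] d' unfolding P_def by (metis image_comp)
  have dPQ: "P ` oball_set n \<inter> Q ` ?K = {}"
  proof -
    have "\<psi> ` F1 \<inter> \<psi> ` (F2 \<union> e) = \<psi> ` (F1 \<inter> (F2 \<union> e))"
      using inj_on_image_Int [OF inj\<psi>, of F1 "F2 \<union> e"] sub by blast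
    then have "\<psi> ` F1 \<inter> \<psi> ` (F2 \<union> e) = {}" using disj by (simp add: Int_Un_distrib)
    then show ?thesis using P1 Qim by blast
  qed
  define Y where "Y = P ` oball_set n \<union> Q ` ?K"
  have Yopen: "openin ?E Y"
    unfolding Y_def by (rule openin_collar_extension [OF A(1,2) P(1,2) Q injQ QA dPQ])
  have Ysub: "Y \<subseteq> \<psi> ` (F1 \<union> e \<union> F2)" unfolding Y_def using P1 Qim by auto
  have eY: "\<psi> ` e \<subseteq> Y"
  proof -
    have "A \<subseteq> ?K" using A(1) clamp_inside by (auto simp: collar_def ball_sets_rad subset_iff)
    moreover have "P ` A = \<psi> ` e"
      unfolding P_def A_def using r1(5)[OF ecl(1)] by (metis image_comp)
    ultimately show ?thesis unfolding Y_def using QA by force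
  qed
  have "Y \<subseteq> oball_set n"
    using Ysub image_mono [of "F1 \<union> e \<union> F2" \<alpha> \<psi>] M.chartD(8)[OF ch] F1(2) F2(2) e(2) unfolding n_def by blast
  then have "openin (subtopology X \<alpha>) (\<phi> ` Y)"
    using M.chart_openin_inverse [OF ch _ _ a] Yopen by (simp add: n_def)
  then obtain S where S: "openin X S" "\<phi> ` Y = S \<inter> \<alpha>"
    by (auto simp: openin_subtopology)
  have inv: "\<phi> (\<psi> y) = y" if "y \<in> \<alpha>" for y
    using M.chartD(4)[OF ch] M.cell_subset_closure [OF a] that by blast
  \<comment> \<open>\<open>S\<close> cuts out a neighbourhood of \<open>e\<close> in \<alpha> that
    is covered by \<open>F1\<close>, \<open>e\<close> and \<open>F2\<close>. As \<open>F3\<close>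
    accumulates at a point of \<open>e\<close>, it must enter this neighbourhood.\<close>
  have YS: "S \<inter> \<alpha> \<subseteq> F1 \<union> e \<union> F2"
  proof -
    have "\<phi> ` Y \<subseteq> \<phi> ` \<psi> ` (F1 \<union> e \<union> F2)" using Ysub by blast
    also have "\<dots> \<subseteq> F1 \<union> e \<union> F2" using inv F1(2) F2(2) e(2) by auto
    finally show ?thesis using S(2) by simp
  qed
  obtain x where x: "x \<in> e" using N.cell_nonempty [OF e(1)] by blast
  have "x \<in> \<phi> ` Y" using eY x inv e(2) by (metis image_subset_iff subsetD rev_image_eqI)
  then have "x \<in> S" using S(2) by blast
  moreover have "x \<in> cl F3" using x F3(3) by blast
  ultimately obtain y where "y \<in> F3" "y \<in> S" using S(1) unfolding in_closure_of by blast
  then have y: "y \<in> F3" "y \<in> F1 \<union> e \<union> F2" using YS F3(2) by auto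
  have "y \<notin> e" using N.cells_eqI [OF F3(1) e(1) y(1)] d' by force
  then show ?thesis using y N.cells_eqI [OF F3(1) _ y(1)] F1(1) F2(1) by blast
qed

text \<open>The same argument at the boundary: \<open>F \<union> e\<close> is extended radially to the outside of the closed
  cell \<open>\<beta>\<close>.\<close>

lemma facet_boundary_unique_coface:
  assumes b: "\<beta> \<in> cells M" and e: "e \<in> cells N" "e \<subseteq> cl \<beta> - \<beta>"
    and F: "F \<in> cells N" "F \<subseteq> \<beta>" "e \<subseteq> cl F" and F': "F' \<in> cells N" "F' \<subseteq> \<beta>" "e \<subseteq> cl F'"
    and d: "Suc (cdim N e) = cdim M \<beta>" "cdim N F = cdim M \<beta>" "cdim N F' = cdim M \<beta>"
  shows "F' = F"
proof -
  define n where "n = cdim M \<beta>"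
  let ?E = "Euclidean_space n"
  note d' = d [folded n_def]
  obtain \<phi> \<psi> where ch: "M.chart \<beta> \<phi> \<psi>" using M.obtain_chart [OF b] .
  obtain \<phi>1 \<psi>1 where ch1: "N.chart F \<phi>1 \<psi>1" using N.obtain_chart [OF F(1)] .
  define A where "A = \<psi>1 ` e"
  have A: "A \<subseteq> bsphere_set n" "closedin ?E (bsphere_set n - A)" "\<psi>1 ` (F \<union> e) = oball_set n \<union> A"
    using N.chart_facet [OF finite_N F(1) e(1) F(3) _ ch1] d' by (simp_all add: A_def)
  have sub: "F \<union> e \<subseteq> cl F" "F \<union> e \<subseteq> cl \<beta>" "e \<subseteq> cl F" "e \<subseteq> cl \<beta>"
    using N.cell_subset_closure M.cell_subset_closure [OF b] F e by auto
  note r = M.chart_restrict [OF ch, folded n_def]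
  note r1 = N.chart_restrict [OF ch1, unfolded d']
  define P where "P = \<psi> \<circ> \<phi>1"
  \<comment> \<open>Homogeneous extension: the radius is kept and the direction is moved by
    \<open>P\<close>, so collar points of radius above 1 land outside the model of the closed
    cell.\<close>
  define Q where "Q w = (\<lambda>i. rad n w * P (clamp n w) i)" for w
  have P: "continuous_map (subtopology ?E (oball_set n \<union> A)) ?E P" "inj_on P (oball_set n \<union> A)"
  proof -
    have "continuous_map (subtopology X (F \<union> e)) ?E \<psi>"
      using r(2)[OF sub(2)] continuous_map_in_subtopology by blast
    then show "continuous_map (subtopology ?E (oball_set n \<union> A)) ?E P"
      unfolding P_def using r1(1)[OF sub(1)] A(3) continuous_map_compose by metis
    show "inj_on P (oball_set n \<union> A)"
      unfolding P_def A(3) [symmetric]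
      using r1(3,5)[OF sub(1)] r(4)[OF sub(2)] by (intro comp_inj_on) auto
  qed
  have PA: "P ` A = \<psi> ` e"
    unfolding P_def A_def using r1(5)[OF sub(3)] by (metis image_comp)
  then have Ps: "P ` A \<subseteq> bsphere_set n"
    using M.chartD(10)[OF ch] e(2) by (auto simp: n_def)
  have Po: "P ` oball_set n = \<psi> ` F"
    using N.chartD(7)[OF ch1] d' unfolding P_def by (metis image_comp)
  then have Po': "P ` oball_set n \<subseteq> oball_set n"
    using M.chartD(8)[OF ch] F(2) by (auto simp: n_def)
  let ?K = "collar n A"
  have Ktop: "topspace (subtopology ?E ?K) = ?K"
    by (auto simp: collar_def)
  have "continuous_map (subtopology ?E ?K) (subtopology ?E (oball_set n \<union> A)) (clamp n)"
    unfolding continuous_map_in_subtopology Ktop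
    by (auto intro: continuous_map_from_subtopology [OF continuous_map_clamp] simp: collar_def)
  then have Q: "continuous_map (subtopology ?E ?K) ?E Q"
    unfolding Q_def using continuous_map_compose [OF _ P(1), of _ "clamp n"]
    by (intro continuous_map_Euclidean_space_scale continuous_map_from_subtopology [OF continuous_map_rad])
      (auto simp: o_def)
  have radQ: "rad n (Q w) = rad n w" "Q w \<in> topspace ?E" "1 \<le> rad n w" if "w \<in> ?K" for w
  proof -
    have "P (clamp n w) \<in> bsphere_set n" using Ps that by (auto simp: collar_def)
    then show "rad n (Q w) = rad n w" "Q w \<in> topspace ?E"
      unfolding Q_def rad_scale by (simp_all add: ball_sets_rad scale_in_Euclidean_space)
    show "1 \<le> rad n w" using that by (simp add: collar_def)
  qed
  have injQ: "inj_on Q ?K"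
  proof
    fix w w' assume w: "w \<in> ?K" "w' \<in> ?K" and eq: "Q w = Q w'"
    have rr: "rad n w = rad n w'" using radQ w eq by metis
    have "P (clamp n w) = P (clamp n w')"
      using eq radQ(3)[OF w(2)] unfolding Q_def rr by (auto simp: fun_eq_iff)
    then have "clamp n w = clamp n w'"
      using inj_onD [OF P(2)] w by (auto simp: collar_def)
    then show "w = w'" using scale_clamp radQ(3) rr w by metis
  qed
  have QA: "Q z = P z" if "z \<in> A" for z
    using that A(1) clamp_inside[of n z] by (auto simp: Q_def ball_sets_rad subset_iff)
  have dPQ: "P ` oball_set n \<inter> Q ` ?K = {}"
    using Po' radQ(1,3) by (force simp: ball_sets_rad)
  define Y where "Y = P ` oball_set n \<union> Q ` ?K"
  have Yopen: "openin ?E Y"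
    unfolding Y_def by (rule openin_collar_extension [OF A(1,2) P Q injQ QA dPQ])
  \<comment> \<open>Only the points of radius 1 in the collar, namely \<open>A\<close>, return to
    the closed ball. Inside the closed cell the open set \<open>Y\<close> therefore shows nothing
    but \<open>F\<close> and \<open>e\<close>.\<close>
  have Yc: "Y \<inter> cball_set n \<subseteq> \<psi> ` (F \<union> e)"
  proof -
    have "Q w \<in> \<psi> ` e" if w: "w \<in> ?K" "Q w \<in> cball_set n" for w
    proof -
      have "rad n w = 1" using w radQ[OF w(1)] by (simp add: ball_sets_rad)
      then have "w \<in> A" using w(1) clamp_inside[of n w] by (simp add: collar_def)
      then show ?thesis using QA PA by auto
    qed
    then show ?thesis unfolding Y_def image_Un using Po by blast
  qed
  have "continuous_map (subtopology X (cl \<beta>)) ?E \<psi>"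
    using M.chartD(2)[OF ch] continuous_map_in_subtopology by (auto simp: n_def)
  then have "openin (subtopology X (cl \<beta>)) {y \<in> topspace (subtopology X (cl \<beta>)). \<psi> y \<in> Y}"
    using Yopen by (rule openin_continuous_map_preimage)
  then obtain S where S: "openin X S" "{y \<in> cl \<beta>. \<psi> y \<in> Y} = S \<inter> cl \<beta>"
    unfolding M.topspace_subtopology_closure [OF order_refl] by (auto simp: openin_subtopology)
  obtain x where x: "x \<in> e" using N.cell_nonempty [OF e(1)] by blast
  have "\<psi> x \<in> P ` A" using PA x by blast
  moreover have "A \<subseteq> ?K" using A(1) clamp_inside by (auto simp: collar_def ball_sets_rad subset_iff)
  ultimately have "\<psi> x \<in> Y" using QA unfolding Y_def by (force simp: image_iff)
  then have "x \<in> S" using S(2) x e(2) by blast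
  moreover have "x \<in> cl F'" using x F'(3) by blast
  ultimately obtain y where y: "y \<in> F'" "y \<in> S" using S(1) unfolding in_closure_of by blast
  then have yb: "y \<in> cl \<beta>" using F'(2) M.cell_subset_closure [OF b] by blast
  then have "\<psi> y \<in> Y" using S(2) y by blast
  moreover have "\<psi> y \<in> cball_set n" using M.chartD(6)[OF ch] yb by (auto simp: n_def)
  ultimately have "\<psi> y \<in> \<psi> ` (F \<union> e)" using Yc by blast
  then have "y \<in> F \<union> e"
    using inj_on_image_mem_iff [OF M.chartD(12)[OF ch] yb sub(2)] by blast
  moreover have "y \<notin> e" using y e(2) F'(2) by blast
  ultimately show ?thesis using y N.cells_eqI [OF F'(1) F(1)] by blast
qed

end

section \<open>Acyclic matchings\<close>

text \<open>The rank counts all strict predecessors under the transitive closure. A predecessor has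
  fewer of them, since it is not its own predecessor.\<close>

lemma wf_finite_nat_rank:
  assumes "finite r" "wf r"
  obtains \<rho> :: "'b \<Rightarrow> nat" where "\<And>x y. (y, x) \<in> r \<Longrightarrow> \<rho> y < \<rho> x"
proof
  define \<rho> where "\<rho> x = card {y. (y, x) \<in> r\<^sup>+}" for x
  fix x y assume yx: "(y, x) \<in> r"
  have fin: "finite {z. (z, x) \<in> r\<^sup>+}"
    by (rule finite_subset [of _ "fst ` r\<^sup>+"]) (use assms(1) in \<open>force simp: image_iff\<close>)+
  have "{z. (z, y) \<in> r\<^sup>+} \<subseteq> {z. (z, x) \<in> r\<^sup>+}"
    using yx by (auto intro: trancl_into_trancl)
  moreover have "y \<in> {z. (z, x) \<in> r\<^sup>+}" "y \<notin> {z. (z, y) \<in> r\<^sup>+}"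
    using yx assms(2) by (auto dest: wf_acyclic simp: acyclic_def)
  ultimately show "\<rho> y < \<rho> x"
    unfolding \<rho>_def using fin by (intro psubset_card_mono) blast+
qed

text \<open>\<open>d\<close> is the least length of an \<open>R\<close>-path into \<open>Z\<close>,
  and the first step of a shortest path decreases it. Both the dual tree and the forest of edges are
  obtained from this.\<close>

lemma distance_to_set:
  obtains d :: "'b \<Rightarrow> nat" where
    "\<And>x z. (x, z) \<in> R\<^sup>* \<Longrightarrow> z \<in> Z \<Longrightarrow> x \<notin> Z \<Longrightarrow> \<exists>y. (x, y) \<in> R \<and> d y < d x \<and> (\<exists>z\<in>Z. (y, z) \<in> R\<^sup>*)"
proof
  define d where "d x = (LEAST n. \<exists>z\<in>Z. (x, z) \<in> R ^^ n)" for x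
  fix x z assume xz: "(x, z) \<in> R\<^sup>*" "z \<in> Z" "x \<notin> Z"
  then have "\<exists>n. \<exists>z\<in>Z. (x, z) \<in> R ^^ n" using rtrancl_imp_relpow by metis
  then have "\<exists>z\<in>Z. (x, z) \<in> R ^^ d x" unfolding d_def by (rule LeastI_ex)
  then obtain z' where z': "z' \<in> Z" "(x, z') \<in> R ^^ d x" by blast
  then have "d x \<noteq> 0" using xz(3) by (metis pair_in_Id_conv relpow.simps(1))
  then obtain m where m: "d x = Suc m" using not0_implies_Suc by blast
  then obtain y where y: "(x, y) \<in> R" "(y, z') \<in> R ^^ m" using z'(2) relpow_Suc_D2 by metis
  have "d y \<le> m" unfolding d_def using y(2) z'(1) by (intro Least_le) blast
  then show "\<exists>y. (x, y) \<in> R \<and> d y < d x \<and> (\<exists>z\<in>Z. (y, z) \<in> R\<^sup>*)"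
    using y m z'(1) relpow_imp_rtrancl by (metis less_Suc_eq_le)
qed

lemma discrete_vector_field_unique:
  assumes "discrete_vector_field X N W"
  shows "(\<kappa>, \<sigma>) \<in> W \<Longrightarrow> (\<kappa>, \<sigma>') \<in> W \<Longrightarrow> \<sigma> = \<sigma>'" "(\<kappa>, \<sigma>) \<in> W \<Longrightarrow> (\<kappa>', \<sigma>) \<in> W \<Longrightarrow> \<kappa> = \<kappa>'"
    "(\<kappa>, \<sigma>) \<in> W \<Longrightarrow> (\<sigma>, \<tau>) \<notin> W" "(\<kappa>, \<sigma>) \<in> W \<Longrightarrow> facet X N \<kappa> \<sigma>"
proof -
  have f: "facet X N \<kappa> \<sigma>" if "(\<kappa>, \<sigma>) \<in> W" for \<kappa> \<sigma>
    using assms that by (auto simp: discrete_vector_field_def)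
  have u: "p = q" if "p \<in> W" "q \<in> W" "c \<in> cells N" "c \<in> {fst p, snd p}" "c \<in> {fst q, snd q}" for p q c
    using assms that unfolding discrete_vector_field_def by blast
  show "(\<kappa>, \<sigma>) \<in> W \<Longrightarrow> (\<kappa>, \<sigma>') \<in> W \<Longrightarrow> \<sigma> = \<sigma>'"
    using u[of "(\<kappa>, \<sigma>)" "(\<kappa>, \<sigma>')" \<kappa>] f[of \<kappa> \<sigma>] by (simp add: facet_def)
  show "(\<kappa>, \<sigma>) \<in> W \<Longrightarrow> (\<kappa>', \<sigma>) \<in> W \<Longrightarrow> \<kappa> = \<kappa>'"
    using u[of "(\<kappa>, \<sigma>)" "(\<kappa>', \<sigma>)" \<sigma>] f[of \<kappa> \<sigma>] by (simp add: facet_def)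
  show "(\<kappa>, \<sigma>) \<in> W \<Longrightarrow> (\<sigma>, \<tau>) \<notin> W"
    using u[of "(\<kappa>, \<sigma>)" "(\<sigma>, \<tau>)" \<sigma>] f[of \<kappa> \<sigma>] by (auto simp: facet_def)
  show "(\<kappa>, \<sigma>) \<in> W \<Longrightarrow> facet X N \<kappa> \<sigma>" by (rule f)
qed

text \<open>The Morse function is the dimension on critical cells; on a pair \<open>(\<kappa>, \<sigma>)\<close> it takes one value in
  \<open>[dim \<kappa> + 1/2, dim \<kappa> + 1)\<close>, increasing with the rank of \<open>\<kappa>\<close>.\<close>

lemma discrete_gradient_if_rank_decreasing:
  fixes \<rho> :: "'a set \<Rightarrow> nat"
  assumes dvf: "discrete_vector_field X N W" and fin: "finite (cells N)"
    and rank: "\<And>\<kappa> \<sigma> \<kappa>' \<sigma>'. (\<kappa>, \<sigma>) \<in> W \<Longrightarrow> (\<kappa>', \<sigma>') \<in> W \<Longrightarrow> facet X N \<kappa>' \<sigma> \<Longrightarrow> \<kappa>' \<noteq> \<kappa> \<Longrightarrow> \<rho> \<kappa>' < \<rho> \<kappa>"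
  shows "discrete_gradient_vector_field X N W"
proof -
  note u = discrete_vector_field_unique [OF dvf]
  define q where "q \<kappa> = cdim N \<kappa> + 1 - 1 / (2 * (real (\<rho> \<kappa>) + 1))" for \<kappa>
  have q: "cdim N \<kappa> + 1/2 \<le> q \<kappa>" "q \<kappa> < cdim N \<kappa> + 1" for \<kappa>
    by (auto simp: q_def field_simps)
  have qmono: "q \<kappa>' < q \<kappa>" if "\<rho> \<kappa>' < \<rho> \<kappa>" "cdim N \<kappa>' = cdim N \<kappa>" for \<kappa> \<kappa>'
    using that by (simp add: q_def frac_less2)
  define f where "f c = (if \<exists>\<sigma>. (c, \<sigma>) \<in> W then q c else if \<exists>\<kappa>. (\<kappa>, c) \<in> W then q (THE \<kappa>. (\<kappa>, c) \<in> W) else cdim N c)" for c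
  have f_low: "f \<kappa> = q \<kappa>" and f_up: "f \<sigma> = q \<kappa>" if "(\<kappa>, \<sigma>) \<in> W" for \<kappa> \<sigma>
  proof -
    show "f \<kappa> = q \<kappa>" using that by (auto simp: f_def)
    have "(THE \<kappa>. (\<kappa>, \<sigma>) \<in> W) = \<kappa>" using that u(2) by (intro the_equality) auto
    then show "f \<sigma> = q \<kappa>" using that u(3) by (auto simp: f_def)
  qed
  have grad: "f \<sigma> \<le> f \<tau> \<longleftrightarrow> (\<tau>, \<sigma>) \<in> W" if fac: "facet X N \<tau> \<sigma>" for \<tau> \<sigma>
  proof
    assume "(\<tau>, \<sigma>) \<in> W" then show "f \<sigma> \<le> f \<tau>" using f_low f_up by simp
  next
    assume le: "f \<sigma> \<le> f \<tau>"
    show "(\<tau>, \<sigma>) \<in> W"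
    proof (rule ccontr)
      assume no: "(\<tau>, \<sigma>) \<notin> W"
      have dim: "cdim N \<sigma> = Suc (cdim N \<tau>)" using fac by (simp add: facet_def)
      \<comment> \<open>This is where the offset of one half matters. The value at \<tau> reaches
        \<open>cdim N \<tau> + 1/2\<close> only for the lower cell of a pair: a critical cell has
        its dimension as value, and an upper cell stays below its own dimension.\<close>
      have t: "f \<tau> < cdim N \<tau> + 1/2 \<or> (\<exists>\<sigma>'. (\<tau>, \<sigma>') \<in> W)"
      proof (cases "\<exists>\<kappa>. (\<kappa>, \<tau>) \<in> W")
        case True
        then obtain \<kappa> where k: "(\<kappa>, \<tau>) \<in> W" by blast
        have "cdim N \<tau> = Suc (cdim N \<kappa>)" using u(4)[OF k] by (simp add: facet_def)
        then show ?thesis using q(2)[of \<kappa>] f_up [OF k] by simp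
      qed (auto simp: f_def)
      have s: "cdim N \<sigma> \<le> f \<sigma> \<or> (\<exists>\<kappa>. (\<kappa>, \<sigma>) \<in> W)"
        using q(1)[of \<sigma>] by (auto simp: f_def)
      show False
      proof (cases "\<exists>\<kappa>. (\<kappa>, \<sigma>) \<in> W")
        case True
        then obtain \<kappa> where k: "(\<kappa>, \<sigma>) \<in> W" by blast
        have d: "cdim N \<kappa> = cdim N \<tau>" using u(4)[OF k] dim by (simp add: facet_def)
        show False
        proof (cases "\<exists>\<sigma>'. (\<tau>, \<sigma>') \<in> W")
          case True
          then obtain \<sigma>' where t: "(\<tau>, \<sigma>') \<in> W" by blast
          have "\<tau> \<noteq> \<kappa>" using k no by blast
          then have "q \<tau> < q \<kappa>" using rank [OF k t fac] qmono d by simp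
          then show False using le f_low [OF t] f_up [OF k] by simp
        next
          case False
          then show False using t le f_up [OF k] q(1)[of \<kappa>] d by auto
        qed
      next
        case False
        then have "cdim N \<sigma> \<le> f \<sigma>" using s by blast
        moreover have "f \<tau> < cdim N \<tau> + 1" using t f_low q(2) by fastforce
        ultimately show False using le dim by simp
      qed
    qed
  qed
  have finite_facets: "finite {\<beta>. facet X N \<alpha> \<beta> \<and> P \<beta>}" "finite {\<gamma>. facet X N \<gamma> \<alpha> \<and> P \<gamma>}" for \<alpha> P
    by (auto intro: finite_subset [OF _ fin] simp: facet_def)
  have "discrete_morse_function X N f"
    unfolding discrete_morse_function_def
  proof (intro ballI conjI finite_facets)
    fix \<alpha>
    show "card {\<beta>. facet X N \<alpha> \<beta> \<and> f \<beta> \<le> f \<alpha>} \<le> 1"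
      unfolding One_nat_def card_le_Suc0_iff_eq [OF finite_facets(1)] using grad u(1) by blast
    show "card {\<gamma>. facet X N \<gamma> \<alpha> \<and> f \<gamma> \<ge> f \<alpha>} \<le> 1"
      unfolding One_nat_def card_le_Suc0_iff_eq [OF finite_facets(2)] using grad u(2) by blast
  qed
  moreover have "W = gradient_field X N f"
    using grad u(4) by (auto simp: gradient_field_def)
  ultimately show ?thesis
    using dvf by (auto simp: discrete_gradient_vector_field_def)
qed

context regular_complex
begin

text \<open>Acyclicity is certified by a rank that drops along every path step, instead of by the
  absence of closed paths, so that the ranks of different carriers can enter one lexicographic
  order. The cell \<open>r\<close> stays free for a pair coming from \<open>V\<close>, or to be
  critical.\<close>

definition acyclic_matching :: "'a set \<Rightarrow> 'a set \<Rightarrow> ('a set \<times> 'a set) set \<Rightarrow> ('a set \<Rightarrow> nat) \<Rightarrow> bool" where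
  "acyclic_matching c r W \<rho> \<longleftrightarrow>
    (\<forall>\<kappa> \<sigma>. (\<kappa>, \<sigma>) \<in> W \<longrightarrow> facet X N \<kappa> \<sigma> \<and> \<kappa> \<subseteq> c \<and> \<sigma> \<subseteq> c \<and> \<kappa> \<noteq> r \<and> \<sigma> \<noteq> r) \<and>
    (\<forall>p\<in>W. \<forall>q\<in>W. \<forall>x. x \<in> {fst p, snd p} \<longrightarrow> x \<in> {fst q, snd q} \<longrightarrow> p = q) \<and>
    (\<forall>\<kappa> \<sigma> \<kappa>' \<sigma>'. (\<kappa>, \<sigma>) \<in> W \<longrightarrow> (\<kappa>', \<sigma>') \<in> W \<longrightarrow> facet X N \<kappa>' \<sigma> \<longrightarrow> \<kappa>' \<noteq> \<kappa> \<longrightarrow> \<rho> \<kappa>' < \<rho> \<kappa>)"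

text \<open>Kept apart from \<open>acyclic_matching\<close> because in arbitrary dimension the empty
  matching is used.\<close>

definition covers_all_but :: "'a set \<Rightarrow> 'a set \<Rightarrow> ('a set \<times> 'a set) set \<Rightarrow> bool" where
  "covers_all_but c r W \<longleftrightarrow> (\<forall>x\<in>cells N. x \<subseteq> c \<longrightarrow> x \<noteq> r \<longrightarrow> (\<exists>p\<in>W. x \<in> {fst p, snd p}))"

end

context refined_complex
begin

text \<open>Along a path of \<open>V'\<close> the carrier moves to faces inside the matchings \<open>W c\<close> and follows a path of \<open>V\<close>
  at the pairs \<open>(h a, h b)\<close>; this is measured lexicographically by \<open>key\<close> below.\<close>

lemma combine_matchings:
  fixes \<rho> :: "'a set \<Rightarrow> 'a set \<Rightarrow> nat"
  assumes V: "discrete_gradient_vector_field X M V"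
    and top: "\<forall>\<alpha>\<in>cells M. h \<alpha> \<in> cells N \<and> h \<alpha> \<subseteq> \<alpha> \<and> cdim N (h \<alpha>) = cdim M \<alpha>"
    and adj: "\<forall>(a, b)\<in>V. h a \<subseteq> cl (h b)"
    and match: "\<forall>c\<in>cells M. N.acyclic_matching c (h c) (W c) (\<rho> c)"
    and no_return: "\<forall>(a, b)\<in>V. \<forall>(\<kappa>, \<sigma>)\<in>W b. \<not> facet X N (h a) \<sigma>"
  defines "V' \<equiv> {(h a, h b) |a b. (a, b) \<in> V} \<union> (\<Union>c\<in>cells M. W c)"
  shows "discrete_gradient_vector_field X N V'" "refinement_choice X M V N V' h"
    "\<forall>c\<in>cells M. N.covers_all_but c (h c) (W c) \<Longrightarrow>
      bij_betw h (critical_cells M V) (critical_cells N V')"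
proof -
  have h: "\<And>\<alpha>. \<alpha> \<in> cells M \<Longrightarrow> h \<alpha> \<in> cells N" "\<And>\<alpha>. \<alpha> \<in> cells M \<Longrightarrow> h \<alpha> \<subseteq> \<alpha>"
    "\<And>\<alpha>. \<alpha> \<in> cells M \<Longrightarrow> cdim N (h \<alpha>) = cdim M \<alpha>"
    using top by auto
  have hV: "h a \<subseteq> cl (h b)" if "(a, b) \<in> V" for a b
    using adj that by auto
  have W1: "facet X N \<kappa> \<sigma> \<and> \<kappa> \<subseteq> c \<and> \<sigma> \<subseteq> c \<and> \<kappa> \<noteq> h c \<and> \<sigma> \<noteq> h c" if "c \<in> cells M" "(\<kappa>, \<sigma>) \<in> W c" for c \<kappa> \<sigma>
    using bspec [OF match that(1)] that(2) unfolding N.acyclic_matching_def by metis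
  have W2: "p = q" if "c \<in> cells M" "p \<in> W c" "q \<in> W c" "x \<in> {fst p, snd p}" "x \<in> {fst q, snd q}" for c p q x
    using bspec [OF match that(1)] that(2-) unfolding N.acyclic_matching_def by metis
  have W3: "\<rho> c \<kappa>' < \<rho> c \<kappa>"
    if "c \<in> cells M" "(\<kappa>, \<sigma>) \<in> W c" "(\<kappa>', \<sigma>') \<in> W c" "facet X N \<kappa>' \<sigma>" "\<kappa>' \<noteq> \<kappa>" for c \<kappa> \<sigma> \<kappa>' \<sigma>'
    using bspec [OF match that(1)] that(2-) unfolding N.acyclic_matching_def by metis
  have U: "\<not> facet X N (h a) \<sigma>" if "(a, b) \<in> V" "(\<kappa>, \<sigma>) \<in> W b" for a b \<kappa> \<sigma>
    using no_return that by fast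
  obtain f where f: "V = gradient_field X M f" and Vdvf: "discrete_vector_field X M V"
    using V by (auto simp: discrete_gradient_vector_field_def)
  note uV = discrete_vector_field_unique [OF Vdvf]
  have Vc: "a \<in> cells M" "b \<in> cells M" "cdim M b = Suc (cdim M a)" "a \<subseteq> cl b" if "(a, b) \<in> V" for a b
    using uV(4)[OF that] by (auto simp: facet_def)
  have carh: "car (h \<alpha>) = \<alpha>" if "\<alpha> \<in> cells M" for \<alpha>
    using carrier_eq h that by blast
  have injh: "\<alpha> = \<beta>" if "\<alpha> \<in> cells M" "\<beta> \<in> cells M" "h \<alpha> = h \<beta>" for \<alpha> \<beta>
    using carh that by metis
  have Wc: "\<kappa> \<in> cells N" "\<sigma> \<in> cells N" "cdim N \<sigma> = Suc (cdim N \<kappa>)" "\<kappa> \<subseteq> cl \<sigma>"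
    "car \<kappa> = c" "car \<sigma> = c" "\<kappa> \<noteq> h c" "\<sigma> \<noteq> h c" "facet X N \<kappa> \<sigma>" "Suc (cdim N \<kappa>) \<le> cdim M c"
    if "c \<in> cells M" "(\<kappa>, \<sigma>) \<in> W c" for c \<kappa> \<sigma>
    using W1[OF that] carrier_eq that(1) dim_le [of c \<sigma>] by (auto simp: facet_def)
  have V'cases: thesis
    if "(\<kappa>, \<sigma>) \<in> V'" and "\<And>a b. (a, b) \<in> V \<Longrightarrow> \<kappa> = h a \<Longrightarrow> \<sigma> = h b \<Longrightarrow> thesis"
      and "\<And>c. c \<in> cells M \<Longrightarrow> (\<kappa>, \<sigma>) \<in> W c \<Longrightarrow> thesis" for \<kappa> \<sigma> thesis
    using that unfolding V'_def by blast
  have dvf: "discrete_vector_field X N V'"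
  proof -
    have "facet X N \<kappa> \<sigma>" if "(\<kappa>, \<sigma>) \<in> V'" for \<kappa> \<sigma>
      using that
    proof (rule V'cases)
      fix a b assume "(a, b) \<in> V" "\<kappa> = h a" "\<sigma> = h b"
      then show ?thesis using h Vc hV by (simp add: facet_def)
    qed (use Wc(9) in blast)
    moreover have "p = q" if p: "p \<in> V'" and q: "q \<in> V'" and x: "x \<in> {fst p, snd p}" "x \<in> {fst q, snd q}" for p q x
    proof -
      have no: False if ab: "(a, b) \<in> V" and c: "c \<in> cells M" "(\<kappa>, \<sigma>) \<in> W c"
        and x: "x \<in> {h a, h b}" "x \<in> {\<kappa>, \<sigma>}" for a b c \<kappa> \<sigma>
        using Wc(5-8)[OF c] x carh Vc(1,2)[OF ab] by auto
      obtain k s k' s' where pq: "p = (k, s)" "q = (k', s')" by (metis surj_pair)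
      from p [unfolded pq] show ?thesis
      proof (rule V'cases)
        fix a b assume ab: "(a, b) \<in> V" "k = h a" "s = h b"
        from q [unfolded pq] show ?thesis
        proof (rule V'cases)
          fix a' b' assume ab': "(a', b') \<in> V" "k' = h a'" "s' = h b'"
          have "\<exists>c. c \<in> {a, b} \<and> c \<in> {a', b'}"
            using x injh [of a a'] injh [of a b'] injh [of b a'] injh [of b b'] Vc(1,2)[OF ab(1)] Vc(1,2)[OF ab'(1)]
            unfolding pq ab(2,3) ab'(2,3) by auto
          then have "(a, b) = (a', b')"
            using uV(1)[of a b b'] uV(2)[of a b a'] uV(3)[of a b b'] uV(3)[of a' b' b] ab(1) ab'(1) by auto
          then show ?thesis using pq ab ab' by simp
        next
          fix c assume "c \<in> cells M" "(k', s') \<in> W c"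
          then show ?thesis using no [OF ab(1)] x ab(2,3) pq by auto
        qed
      next
        fix c assume c: "c \<in> cells M" "(k, s) \<in> W c"
        from q [unfolded pq] show ?thesis
        proof (rule V'cases)
          fix a' b' assume ab': "(a', b') \<in> V" "k' = h a'" "s' = h b'"
          then show ?thesis using no [OF ab'(1) c] x pq by auto
        next
          fix c' assume c': "c' \<in> cells M" "(k', s') \<in> W c'"
          have "c' = c" using Wc(5,6)[OF c] Wc(5,6)[OF c'] x pq by auto
          then show ?thesis using W2 [OF c(1)] c(2) c'(2) x pq by blast
        qed
      qed
    qed
    ultimately show ?thesis unfolding discrete_vector_field_def by blast
  qed
  \<comment> \<open>Counting the cells of smaller value replaces the real-valued Morse function by
    natural numbers with the same comparisons, as a well-founded key requires.\<close>
  define F where "F c = card {a \<in> cells M. f a < f c}" for c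
  have Fmono: "F a < F b" if "a \<in> cells M" "f a < f b" for a b
    unfolding F_def using that finite_M by (intro psubset_card_mono) auto
  have Fmono': "F a \<le> F b" if "f a \<le> f b" for a b
    unfolding F_def using that finite_M by (intro card_mono) auto
  have FV: "F b \<le> F a" if "(a, b) \<in> V" for a b
    using that Fmono' unfolding f by (auto simp: gradient_field_def)
  have Fn: "F a < F b" if "facet X M a b" "(a, b) \<notin> V" for a b
    using that Fmono [of a b] unfolding f by (auto simp: gradient_field_def facet_def)
  \<comment> \<open>The components in turn: the dimension of the carrier while \<kappa> has
    codimension at least two in it, and 0 otherwise; the Morse rank of the carrier, or of
    \<open>b\<close> if \<kappa> is \<open>h a\<close> with \<open>(a, b)\<close> in
    \<open>V\<close>; a 1 that places \<open>h a\<close> above the pairs inside \<open>b\<close>,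
    with which the second component ties; the rank inside the carrier. Because of
    \<open>+ 2\<close>, the first component of a pair in \<open>W c\<close> vanishes exactly when
    its upper cell has the full dimension of \<open>c\<close>.\<close>
  define key where "key \<kappa> = (if \<exists>b. (car \<kappa>, b) \<in> V \<and> \<kappa> = h (car \<kappa>) then (0::nat, F (THE b. (car \<kappa>, b) \<in> V), 1::nat, 0::nat)
    else (if cdim N \<kappa> + 2 \<le> cdim M (car \<kappa>) then cdim M (car \<kappa>) else 0, F (car \<kappa>), 0, \<rho> (car \<kappa>) \<kappa>))" for \<kappa>
  have key1: "key (h a) = (0, F b, 1, 0)" if "(a, b) \<in> V" for a b
  proof -
    have "(THE b. (a, b) \<in> V) = b" using that uV(1) by (intro the_equality) auto
    then show ?thesis using that carh Vc(1)[OF that] by (auto simp: key_def)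
  qed
  have key2: "key \<kappa> = (if cdim N \<kappa> + 2 \<le> cdim M c then cdim M c else 0, F c, 0, \<rho> c \<kappa>)"
    if "c \<in> cells M" "(\<kappa>, \<sigma>) \<in> W c" for c \<kappa> \<sigma>
    using Wc(5,7)[OF that] by (simp add: key_def)
  define r where "r = {(\<kappa>', \<kappa>). \<exists>\<sigma> \<sigma>'. (\<kappa>, \<sigma>) \<in> V' \<and> (\<kappa>', \<sigma>') \<in> V' \<and> facet X N \<kappa>' \<sigma> \<and> \<kappa>' \<noteq> \<kappa>}"
  have "r \<subseteq> cells N \<times> cells N"
    using discrete_vector_field_unique(4)[OF dvf] by (auto simp: r_def facet_def)
  then have rfin: "finite r" using finite_N by (meson finite_SigmaI finite_subset)
  let ?lex = "less_than <*lex*> less_than <*lex*> less_than <*lex*> less_than"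
  have step: "(key \<kappa>', key \<kappa>) \<in> ?lex"
    if ks: "(\<kappa>, \<sigma>) \<in> V'" and ks': "(\<kappa>', \<sigma>') \<in> V'" and fac: "facet X N \<kappa>' \<sigma>" and ne: "\<kappa>' \<noteq> \<kappa>" for \<kappa> \<sigma> \<kappa>' \<sigma>'
  proof -
    have kN: "\<kappa>' \<in> cells N" "\<sigma> \<in> cells N" and dk: "cdim N \<sigma> = Suc (cdim N \<kappa>')" and sub: "\<kappa>' \<subseteq> cl \<sigma>"
      using fac by (auto simp: facet_def)
    have cf: "car \<kappa>' \<subseteq> cl (car \<sigma>)" by (rule carrier_face [OF kN sub])
    from ks show ?thesis
    proof (rule V'cases)
      fix a b assume ab: "(a, b) \<in> V" "\<kappa> = h a" "\<sigma> = h b"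
      have carb: "car \<sigma> = b" using ab carh Vc(2) by simp
      have d: "cdim N \<kappa>' = cdim M a" "cdim M b = Suc (cdim M a)"
        using ab Vc[OF ab(1)] h(3) dk by auto
      from ks' show ?thesis
      proof (rule V'cases)
        fix a' b' assume ab': "(a', b') \<in> V" "\<kappa>' = h a'" "\<sigma>' = h b'"
        have "facet X M a' b"
          using Vc(1,2)[OF ab(1)] Vc(1,2)[OF ab'(1)] cf d h(3) carh unfolding carb ab'(2) by (simp add: facet_def)
        moreover have "(a', b) \<notin> V" using uV(2)[OF ab(1)] ne ab ab' by blast
        ultimately have "F b' < F b" using Fn FV [OF ab'(1)] by fastforce
        then show ?thesis using key1 ab ab' by simp
      next
        fix c' assume c': "c' \<in> cells M" "(\<kappa>', \<sigma>') \<in> W c'"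
        \<comment> \<open>The partner of \<open>\<kappa>'\<close> also lies in \<open>c'\<close>, so
          \<open>c'\<close> has at least the dimension of \<open>b\<close>; being contained in the
          closure of \<open>b\<close>, it must be \<open>b\<close>.\<close>
        have "c' = b"
        proof (rule ccontr)
          assume "c' \<noteq> b"
          then have "cdim M c' < cdim M b"
            using M.subset_closure_dim [OF Vc(2)[OF ab(1)] c'(1)] cf Wc(5)[OF c'] carb by simp
          then show False using Wc(10)[OF c'] d by simp
        qed
        then show ?thesis using key1 [OF ab(1)] key2 [OF c'] ab d by simp
      qed
    next
      fix c assume c: "c \<in> cells M" "(\<kappa>, \<sigma>) \<in> W c"
      have d: "cdim N \<kappa>' = cdim N \<kappa>" using Wc(3)[OF c] dk by simp
      have carc: "car \<sigma> = c" by (rule Wc(6)[OF c])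
      from ks' show ?thesis
      proof (rule V'cases)
        fix a' b' assume ab': "(a', b') \<in> V" "\<kappa>' = h a'" "\<sigma>' = h b'"
        show ?thesis
        proof (cases "cdim N \<kappa> + 2 \<le> cdim M c")
          case True
          then show ?thesis using key1 [OF ab'(1)] key2 [OF c] ab' by simp
        next
          case False
          then have "cdim M c = Suc (cdim M a')"
            using Wc(10)[OF c] d h(3) Vc(1)[OF ab'(1)] ab'(2) by simp
          then have "facet X M a' c"
            using Vc(1)[OF ab'(1)] c(1) cf carh unfolding carc ab'(2) by (simp add: facet_def)
          \<comment> \<open>Without \<open>no_return\<close> a path could re-enter
            \<open>h a'\<close> from a top cell inside \<open>c\<close> and close up.\<close>
          moreover have "(a', c) \<notin> V" using U c(2) fac ab'(2) by blast
          ultimately have "F b' < F c" using Fn FV [OF ab'(1)] by fastforce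
          then show ?thesis using key1 [OF ab'(1)] key2 [OF c] ab' False by simp
        qed
      next
        fix c' assume c': "c' \<in> cells M" "(\<kappa>', \<sigma>') \<in> W c'"
        show ?thesis
        proof (cases "c' = c")
          case True
          then show ?thesis using key2 [OF c] key2 [OF c'] W3 [OF c] c'(2) fac ne d by simp
        next
          case False
          then have "cdim M c' < cdim M c"
            using M.subset_closure_dim [OF c(1) c'(1)] cf Wc(5)[OF c'] carc by simp
          then show ?thesis using key2 [OF c] key2 [OF c'] Wc(10)[OF c'] d by simp
        qed
      qed
    qed
  qed
  then have "(key y, key x) \<in> ?lex" if "(y, x) \<in> r" for x y
    using that unfolding r_def by blast
  then have "r \<subseteq> inv_image ?lex key"
    by (metis in_inv_image subrelI)
  moreover have "wf (inv_image ?lex key)" by (intro wf_inv_image wf_lex_prod wf_less_than)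
  ultimately have "wf r" using wf_subset by blast
  then obtain \<mu> :: "'a set \<Rightarrow> nat" where mu: "\<And>x y. (y, x) \<in> r \<Longrightarrow> \<mu> y < \<mu> x"
    using wf_finite_nat_rank rfin by metis
  show "discrete_gradient_vector_field X N V'"
    by (rule discrete_gradient_if_rank_decreasing [OF dvf finite_N, of \<mu>], rule mu) (auto simp: r_def)
  have hcrit: "h \<alpha> \<in> critical_cells N V'" if al: "\<alpha> \<in> critical_cells M V" for \<alpha>
  proof -
    have aM: "\<alpha> \<in> cells M" using al by (simp add: critical_cells_def)
    have "False" if "(\<kappa>, \<sigma>) \<in> V'" and x: "h \<alpha> = \<kappa> \<or> h \<alpha> = \<sigma>" for \<kappa> \<sigma>
      using that(1)
    proof (rule V'cases)
      fix a b assume ab: "(a, b) \<in> V" "\<kappa> = h a" "\<sigma> = h b"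
      then have "\<alpha> = a \<or> \<alpha> = b" using x injh aM Vc(1,2) by metis
      then show False using al ab(1) by (force simp: critical_cells_def)
    next
      fix c assume c: "c \<in> cells M" "(\<kappa>, \<sigma>) \<in> W c"
      then show False using Wc(5-8)[OF c] x carh [OF aM] by auto
    qed
    then show ?thesis using h(1)[OF aM] by (force simp: critical_cells_def)
  qed
  show "refinement_choice X M V N V' h"
    unfolding refinement_choice_def
  proof (intro conjI ballI)
    fix \<alpha> assume "\<alpha> \<in> cells M"
    then show "h \<alpha> \<in> cells N" "cdim N (h \<alpha>) = cdim M \<alpha>" "cl (h \<alpha>) \<subseteq> cl \<alpha>"
      by (simp_all add: h closure_of_mono)
  next
    fix p assume "p \<in> V" then show "case p of (\<alpha>, \<beta>) \<Rightarrow> (h \<alpha>, h \<beta>) \<in> V'" by (auto simp: V'_def)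
  next
    fix p assume "p \<in> V'"
    moreover obtain \<kappa> \<sigma> where p: "p = (\<kappa>, \<sigma>)" by (metis surj_pair)
    ultimately have ks: "(\<kappa>, \<sigma>) \<in> V'" by simp
    have "car \<kappa> = car \<sigma>" if "\<kappa> \<noteq> h (car \<kappa>)"
      using ks
    proof (rule V'cases)
      fix a b assume "(a, b) \<in> V" "\<kappa> = h a" "\<sigma> = h b"
      then show ?thesis using that carh Vc(1) by simp
    qed (use Wc(5,6) in simp)
    then show "case p of (\<kappa>, \<sigma>) \<Rightarrow> \<kappa> \<noteq> h (car \<kappa>) \<longrightarrow> car \<kappa> = car \<sigma>" by (simp add: p)
  qed (use hcrit in blast)
  assume cover: "\<forall>c\<in>cells M. N.covers_all_but c (h c) (W c)"
  have complete: "\<exists>p\<in>W c. x \<in> {fst p, snd p}" if "c \<in> cells M" "x \<in> cells N" "x \<subseteq> c" "x \<noteq> h c" for c x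
    using bspec [OF cover that(1)] that(2-) unfolding N.covers_all_but_def by blast
  show "bij_betw h (critical_cells M V) (critical_cells N V')"
    unfolding bij_betw_def
  proof (intro conjI equalityI subsetI)
    show "inj_on h (critical_cells M V)"
      using injh by (auto simp: inj_on_def critical_cells_def)
    fix x assume x: "x \<in> critical_cells N V'"
    then have xN: "x \<in> cells N" and xV: "\<And>p. p \<in> V' \<Longrightarrow> x \<noteq> fst p \<and> x \<noteq> snd p"
      by (auto simp: critical_cells_def)
    have c: "car x \<in> cells M" "x \<subseteq> car x" using carrier [OF xN] .
    have xh: "x = h (car x)"
    proof (rule ccontr)
      assume "x \<noteq> h (car x)"
      then obtain p where "p \<in> W (car x)" "x \<in> {fst p, snd p}" using complete [OF c(1) xN c(2)] by blast
      moreover then have "p \<in> V'" using c(1) unfolding V'_def by blast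
      ultimately show False using xV by blast
    qed
    have "car x \<in> critical_cells M V"
    proof (rule ccontr)
      assume "car x \<notin> critical_cells M V"
      then obtain a b where ab: "(a, b) \<in> V" "car x = a \<or> car x = b"
        using c(1) by (auto simp: critical_cells_def)
      then have "(h a, h b) \<in> V'" unfolding V'_def by blast
      then show False using xV ab(2) xh by fastforce
    qed
    then show "x \<in> h ` critical_cells M V" using xh by blast
  qed (use hcrit in blast)
qed

text \<open>The cell \<open>h \<alpha>\<close> has the dimension of \<alpha>, so it does not fit
  into a proper face of \<alpha> and its carrier is \<alpha>. Hence \<open>carrier_cell\<close>
  inverts \<open>h\<close>, which embeds the critical cells of \<open>V\<close> into those of
  \<open>W\<close>.\<close>

lemma critical_cells_card_le:
  assumes "vector_field_refinement X M V N W"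
  shows "card (critical_cells M V) \<le> card (critical_cells N W)"
proof -
  obtain h where h: "refinement_choice X M V N W h"
    using assms by (auto simp: vector_field_refinement_def)
  have car: "car (h \<alpha>) = \<alpha>" if a: "\<alpha> \<in> cells M" for \<alpha>
  proof -
    have ha: "h \<alpha> \<in> cells N" "cdim N (h \<alpha>) = cdim M \<alpha>" "cl (h \<alpha>) \<subseteq> cl \<alpha>"
      using h a by (auto simp: refinement_choice_def)
    note c = carrier [OF ha(1)]
    obtain x where x: "x \<in> h \<alpha>" using N.cell_nonempty [OF ha(1)] by blast
    then have "x \<in> cl \<alpha>" "x \<in> car (h \<alpha>)" using ha(3) N.cell_subset_closure [OF ha(1)] c(2) by auto
    then show ?thesis
      using M.meets_closure(2)[OF a c(1)] dim_le [OF c(1) ha(1) c(2)] ha(2) by fastforce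
  qed
  then have "inj_on h (critical_cells M V)"
    by (intro inj_on_inverseI [of _ car]) (simp add: critical_cells_def)
  moreover have "h ` critical_cells M V \<subseteq> critical_cells N W"
    using h by (auto simp: refinement_choice_def)
  moreover have "finite (critical_cells N W)"
    using finite_N by (simp add: critical_cells_def)
  ultimately show ?thesis by (rule card_inj_on_le)
qed

end

section \<open>The dual spanning tree of a subdivided cell\<close>

text \<open>Arcs and discs are treated together, with faces for cells of full dimension and walls
  for those of codimension one. Dimension zero is excluded because a point has nothing to be
  matched.\<close>

locale subdivided_cell = refined_complex +
  fixes c r :: "'a set"
  assumes c: "c \<in> cells M" and dim_c: "cdim M c = 1 \<or> cdim M c = 2"
    and r: "r \<in> cells N" "r \<subseteq> c" "cdim N r = cdim M c"
begin

definition faces :: "'a set set" where "faces = {F \<in> cells N. F \<subseteq> c \<and> cdim N F = cdim M c}"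

definition walls :: "'a set set" where "walls = {e \<in> cells N. e \<subseteq> c \<and> Suc (cdim N e) = cdim M c}"

definition adjacent :: "('a set \<times> 'a set) set" where
  "adjacent = {(F, G). F \<in> faces \<and> G \<in> faces \<and> (\<exists>e\<in>walls. e \<subseteq> cl F \<and> e \<subseteq> cl G)}"

lemma r_face: "r \<in> faces"
  using r by (simp add: faces_def)

lemma c_closure: "c \<subseteq> cl c"
  by (rule M.cell_subset_closure [OF c])

lemma cells_in_c: 
  assumes "g \<in> cells N" "g \<subseteq> c"
  shows "g \<in> faces \<or> g \<in> walls \<or> (cdim M c = 2 \<and> cdim N g = 0)"
  using dim_le [OF c assms] dim_c assms by (auto simp: faces_def walls_def)

lemma wall_in_face: 
  assumes "e \<in> walls" obtains F where "F \<in> faces" "e \<subseteq> cl F"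
proof -
  have "e \<in> cells N" "e \<subseteq> cl c" using assms c_closure by (auto simp: walls_def)
  then obtain F where "F \<in> cells N" "F \<subseteq> c" "cdim N F = cdim M c" "e \<subseteq> cl F"
    by (rule exists_top_coface [OF c])
  then show thesis using that by (simp add: faces_def)
qed

lemma two_faces:
  assumes "e \<in> walls" "F \<in> faces" "G \<in> faces" "H \<in> faces" "e \<subseteq> cl F" "e \<subseteq> cl G" "e \<subseteq> cl H" "F \<noteq> G"
  shows "H = F \<or> H = G"
  using facet_interior_two_cofaces [OF c, of e F G H] assms by (auto simp: faces_def walls_def)

text \<open>Only cells of codimension at least two are taken out: none from an arc, and finitely
  many points from an open disc, which stays connected.\<close>

lemma connected_minus_low_cells:
  "connectedin X (c - \<Union>{v \<in> cells N. v \<subseteq> c \<and> cdim N v + 2 \<le> cdim M c})" (is "connectedin X (c - \<Union>?V)")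
proof (cases "cdim M c = 1")
  case True
  then have "?V = {}" by auto
  then show ?thesis using M.connectedin_cell(1)[OF c] by (simp del: Collect_empty_eq)
next
  case False
  then have 2: "cdim M c = 2" using dim_c by simp
  obtain \<phi> \<psi> where ch: "M.chart c \<phi> \<psi>" using M.obtain_chart [OF c] .
  have "finite v" if "v \<in> ?V" for v
  proof -
    have "v \<in> cells N" "cdim N v = 0" using that 2 by auto
    then show ?thesis using N.vertex_singleton by (metis finite.simps)
  qed
  moreover have "finite ?V" using finite_N by simp
  ultimately have "finite (\<Union>?V)" by (intro finite_Union)
  then have con: "connectedin (Euclidean_space 2) (oball_set 2 - \<psi> ` \<Union>?V)"
    using connectedin_oball_set_2_diff_finite by blast
  have "oball_set 2 - \<psi> ` \<Union>?V \<subseteq> oball_set 2" by blast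
  then have "connectedin (subtopology (Euclidean_space 2) (\<psi> ` c)) (oball_set 2 - \<psi> ` \<Union>?V)"
    using con M.chartD(8)[OF ch] 2 by (simp add: connectedin_subtopology)
  then have "connectedin (subtopology X c) (\<phi> ` (oball_set 2 - \<psi> ` \<Union>?V))"
    using connectedin_continuous_map_image [OF M.chart_restrict(1)[OF ch c_closure]] 2 by simp
  moreover have "\<phi> ` (oball_set 2 - \<psi> ` \<Union>?V) = c - \<Union>?V"
  proof -
    have "oball_set 2 - \<psi> ` \<Union>?V = \<psi> ` (c - \<Union>?V)"
    proof -
      have "\<psi> ` (c - \<Union>?V) = \<psi> ` c - \<psi> ` \<Union>?V"
        using inj_on_image_set_diff [OF M.chartD(12)[OF ch], of c "\<Union>?V"] c_closure by blast
      then show ?thesis using M.chartD(8)[OF ch] 2 by simp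
    qed
    moreover have "c - \<Union>?V \<subseteq> cl c" using c_closure by blast
    ultimately show ?thesis using M.chart_restrict(5)[OF ch] by simp
  qed
  ultimately show ?thesis by (simp add: connectedin_subtopology)
qed

text \<open>Otherwise the closed faces reachable from \<open>F\<close> and the remaining closed
  faces would split the connected set of \<open>connected_minus_low_cells\<close>. A common point of
  the two parts in that set lies on a wall between two faces, which makes these adjacent.\<close>

lemma adjacent_connected:
  assumes F: "F \<in> faces" shows "(F, r) \<in> adjacent\<^sup>*"
proof -
  let ?A = "{G \<in> faces. (F, G) \<in> adjacent\<^sup>*}"
  let ?B = "faces - ?A"
  let ?V = "{v \<in> cells N. v \<subseteq> c \<and> cdim N v + 2 \<le> cdim M c}"
  let ?Y = "c - \<Union>?V"
  let ?PA = "\<Union>(cl ` ?A)" and ?PB = "\<Union>(cl ` ?B)"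
  have finf: "finite faces" using finite_N by (simp add: faces_def)
  have fN: "G \<in> cells N" if "G \<in> faces" for G using that by (simp add: faces_def)
  have closed: "closedin X ?PA" "closedin X ?PB" using finf by (auto intro!: closedin_Union)
  have cov: "?Y \<subseteq> ?PA \<union> ?PB"
  proof
    fix y assume y: "y \<in> ?Y"
    then obtain g where g: "g \<in> cells N" "y \<in> g" using N.obtain_cell M.cell_subset_topspace [OF c] by blast
    then have gc: "g \<subseteq> c" using cell_in_cell [OF g(1) c g(2)] y by blast
    then have "\<not> cdim N g + 2 \<le> cdim M c" using y g by blast
    then have "g \<in> faces \<or> g \<in> walls" using cells_in_c [OF g(1) gc] by auto
    then obtain G where "G \<in> faces" "y \<in> cl G"
    proof
      assume "g \<in> faces" then show thesis using that g N.cell_subset_closure by blast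
    next
      assume "g \<in> walls" then show thesis using wall_in_face that g(2) by blast
    qed
    then show "y \<in> ?PA \<union> ?PB" by blast
  qed
  have disj: "?PA \<inter> ?PB \<inter> ?Y = {}"
  proof (rule ccontr)
    assume "?PA \<inter> ?PB \<inter> ?Y \<noteq> {}"
    then obtain y G H where G: "G \<in> ?A" "y \<in> cl G" and H: "H \<in> ?B" "y \<in> cl H" and y: "y \<in> ?Y" by blast
    then obtain g where g: "g \<in> cells N" "y \<in> g" using N.obtain_cell M.cell_subset_topspace [OF c] by blast
    then have gc: "g \<subseteq> c" using cell_in_cell [OF g(1) c g(2)] y by blast
    then have "\<not> cdim N g + 2 \<le> cdim M c" using y g by blast
    then have "g \<in> faces \<or> g \<in> walls" using cells_in_c [OF g(1) gc] by auto
    moreover have GH: "G \<in> cells N" "H \<in> cells N" "cdim N G = cdim M c" "cdim N H = cdim M c"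
      using G H by (auto simp: faces_def)
    moreover have "G \<noteq> H" using G H by blast
    moreover have "g \<subseteq> cl G" "g \<subseteq> cl H"
      using N.meets_closure_subset [OF _ g] GH(1,2) G(2) H(2) by auto
    moreover have "g = G" "g = H" if "g \<in> faces"
      using N.meets_closure(2)[OF _ g] GH G(2) H(2) that by (fastforce simp: faces_def)+
    ultimately have "(G, H) \<in> adjacent" using G H by (auto simp: adjacent_def)
    moreover have "(F, G) \<in> adjacent\<^sup>*" using G(1) by simp
    ultimately have "(F, H) \<in> adjacent\<^sup>*" by (simp add: rtrancl.rtrancl_into_rtrancl)
    then show False using H(1) by blast
  qed
  have ne: "cl G \<inter> ?Y \<noteq> {}" if "G \<in> faces" for G
  proof -
    obtain y where y: "y \<in> G" using N.cell_nonempty [OF fN [OF \<open>G \<in> faces\<close>]] by blast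
    have "y \<notin> v" if "v \<in> ?V" for v
      using N.cells_eqI [OF _ fN [OF \<open>G \<in> faces\<close>] _ y] that \<open>G \<in> faces\<close> by (auto simp: faces_def)
    then have "y \<in> ?Y" using y \<open>G \<in> faces\<close> by (auto simp: faces_def)
    then show ?thesis using y N.cell_subset_closure [OF fN [OF that]] by blast
  qed
  have "?PA \<inter> ?Y \<noteq> {}" using ne [OF F] F by blast
  then have "?PB \<inter> ?Y = {}"
    using connected_minus_low_cells closed cov disj unfolding connectedin_closedin by blast
  then have "r \<notin> ?B" using ne r_face by blast
  then show ?thesis using r_face by blast
qed

text \<open>A breadth-first tree of the dual graph: \<open>d\<close> measures the distance to the
  root, \<open>par F\<close> is the next face on a shortest path and \<open>\<pi> F\<close> is the
  wall crossed on the way.\<close>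

lemma obtain_tree:
  obtains d :: "'a set \<Rightarrow> nat" and \<pi> par :: "'a set \<Rightarrow> 'a set" where
    "\<And>F. F \<in> faces \<Longrightarrow> F \<noteq> r \<Longrightarrow> \<pi> F \<in> walls \<and> \<pi> F \<subseteq> cl F \<and> par F \<in> faces \<and> \<pi> F \<subseteq> cl (par F) \<and> d (par F) < d F"
proof -
  obtain d :: "'a set \<Rightarrow> nat" where
    d: "\<And>x z. (x, z) \<in> adjacent\<^sup>* \<Longrightarrow> z \<in> {r} \<Longrightarrow> x \<notin> {r} \<Longrightarrow> \<exists>y. (x, y) \<in> adjacent \<and> d y < d x \<and> (\<exists>z\<in>{r}. (y, z) \<in> adjacent\<^sup>*)"
    using distance_to_set [of adjacent "{r}"] by blast
  have "\<forall>F. \<exists>e G. F \<in> faces \<longrightarrow> F \<noteq> r \<longrightarrow> e \<in> walls \<and> e \<subseteq> cl F \<and> G \<in> faces \<and> e \<subseteq> cl G \<and> d G < d F"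
    using d [OF adjacent_connected] unfolding adjacent_def by blast
  then show thesis using that by metis
qed

end

section \<open>Walls crossed by the dual tree and walls left over\<close>

locale spanning_tree = subdivided_cell +
  fixes d :: "'a set \<Rightarrow> nat" and \<pi> par :: "'a set \<Rightarrow> 'a set"
  assumes tree: "\<And>F. F \<in> faces \<Longrightarrow> F \<noteq> r \<Longrightarrow> \<pi> F \<in> walls \<and> \<pi> F \<subseteq> cl F \<and> par F \<in> faces \<and> \<pi> F \<subseteq> cl (par F) \<and> d (par F) < d F"
begin

text \<open>The wall \<open>\<pi> G\<close> already lies in \<open>G\<close> and in
  \<open>par G\<close>, and no third face can contain it.\<close>

lemma parent_unique:
  assumes F: "F \<in> faces" and G: "G \<in> faces" "G \<noteq> r" and ne: "F \<noteq> G" and sub: "\<pi> G \<subseteq> cl F"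
  shows "F = par G" "d F < d G"
proof -
  note t = tree [OF G]
  have "par G \<noteq> G" using t by auto
  then show "F = par G" using two_faces [of "\<pi> G" G "par G" F] t F G ne sub by auto
  then show "d F < d G" using t by simp
qed

lemma tree_inj: 
  assumes "F \<in> faces" "F \<noteq> r" "G \<in> faces" "G \<noteq> r" "\<pi> F = \<pi> G" shows "F = G"
proof (rule ccontr)
  assume "F \<noteq> G"
  then have "d F < d G" "d G < d F"
    using parent_unique(2)[of F G] parent_unique(2)[of G F] tree assms by auto
  then show False by simp
qed

text \<open>The dual tree thickened to a subset of \<open>c\<close>: its nodes become open faces and
  its edges the open walls through which they pass.\<close>

definition tree_region :: "'a set" where "tree_region = \<Union>faces \<union> \<Union>(\<pi> ` (faces - {r}))"

text \<open>By induction on the distance to \<open>r\<close>, each face is attached through its wall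
  to a connected set that contains its parent and the root. All these sets share
  \<open>r\<close>.\<close>

lemma connected_tree_region: "connectedin X tree_region"
proof -
  have fN: "G \<in> cells N" if "G \<in> faces" for G using that by (simp add: faces_def)
  have *: "\<exists>C. connectedin X C \<and> F \<subseteq> C \<and> r \<subseteq> C \<and> C \<subseteq> tree_region \<and> (F \<noteq> r \<longrightarrow> \<pi> F \<subseteq> C)" if "F \<in> faces" for F
    using that
  proof (induction "d F" arbitrary: F rule: less_induct)
    case less
    show ?case
    proof (cases "F = r")
      case True
      then show ?thesis
        using N.connectedin_cell(1)[OF fN [OF less(2)]] less(2) unfolding tree_region_def by blast
    next
      case False
      note t = tree [OF less(2) False]
      obtain C where C: "connectedin X C" "par F \<subseteq> C" "r \<subseteq> C" "C \<subseteq> tree_region"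
        using less(1)[of "par F"] t by blast
      \<comment> \<open>A set between a connected set and its closure is connected, so a wall may be
        added to either face it bounds.\<close>
      have con: "connectedin X (G \<union> \<pi> F)" if "G \<in> faces" "\<pi> F \<subseteq> cl G" for G
        using connectedin_intermediate_closure_of [OF N.connectedin_cell(1)[OF fN [OF that(1)]], of "G \<union> \<pi> F"]
          N.cell_subset_closure [OF fN [OF that(1)]] that(2) by blast
      have ne: "\<pi> F \<noteq> {}" "par F \<noteq> {}"
        using t N.cell_nonempty fN by (auto simp: walls_def)
      have "connectedin X ((F \<union> \<pi> F) \<union> (par F \<union> \<pi> F))"
        by (rule connectedin_Un) (use con less(2) t ne in blast)+
      then have "connectedin X (((F \<union> \<pi> F) \<union> (par F \<union> \<pi> F)) \<union> C)"
        by (rule connectedin_Un) (use C ne in blast)+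
      moreover have "((F \<union> \<pi> F) \<union> (par F \<union> \<pi> F)) \<union> C \<subseteq> tree_region"
        using C(4) t less(2) False unfolding tree_region_def by blast
      ultimately show ?thesis using C(3) by blast
    qed
  qed
  define CC where "CC F = (SOME C. connectedin X C \<and> F \<subseteq> C \<and> r \<subseteq> C \<and> C \<subseteq> tree_region \<and> (F \<noteq> r \<longrightarrow> \<pi> F \<subseteq> C))" for F
  have CC: "connectedin X (CC F)" "F \<subseteq> CC F" "r \<subseteq> CC F" "CC F \<subseteq> tree_region" "F \<noteq> r \<longrightarrow> \<pi> F \<subseteq> CC F"
    if "F \<in> faces" for F
    using someI_ex [OF * [OF that], folded CC_def] by auto
  have "connectedin X (\<Union>(CC ` faces))"
    using CC r_face N.cell_nonempty [OF r(1)] by (intro connectedin_Union) blast+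
  moreover have "\<Union>(CC ` faces) = tree_region"
  proof
    show "\<Union>(CC ` faces) \<subseteq> tree_region" using CC(4) by blast
    show "tree_region \<subseteq> \<Union>(CC ` faces)" using CC(2,5) unfolding tree_region_def by fast
  qed
  ultimately show ?thesis by simp
qed

text \<open>In a disc these are the edges that remain for the interior vertices; in an arc there
  will turn out to be none.\<close>

definition leftover :: "'a set set" where "leftover = walls - \<pi> ` (faces - {r})"

text \<open>A path leaves a face \<open>F\<close> only through a wall \<open>\<pi> G\<close> with
  \<open>F = par G\<close>, so it moves away from the root. Subtracting the distance from its
  maximum makes the rank drop. The face is recovered from its wall by
  \<open>tree_inj\<close>.\<close>

definition tree_rank :: "'a set \<Rightarrow> nat" where
  "tree_rank \<kappa> = Max (d ` faces) - d (THE F. F \<in> faces \<and> F \<noteq> r \<and> \<pi> F = \<kappa>)"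

lemma tree_rank:
  assumes F: "F \<in> faces" "F \<noteq> r" and G: "G \<in> faces" "G \<noteq> r" and ne: "F \<noteq> G" and sub: "\<pi> G \<subseteq> cl F"
  shows "tree_rank (\<pi> G) < tree_rank (\<pi> F)"
proof -
  have the: "(THE F'. F' \<in> faces \<and> F' \<noteq> r \<and> \<pi> F' = \<pi> H) = H" if "H \<in> faces" "H \<noteq> r" for H
    using that tree_inj by (intro the_equality) auto
  have "finite (d ` faces)" using finite_N by (simp add: faces_def)
  then have "d G \<le> Max (d ` faces)" using G by (intro Max_ge) auto
  moreover have "d F < d G" by (rule parent_unique(2)[OF F(1) G ne sub])
  ultimately show ?thesis
    unfolding tree_rank_def the [OF F] the [OF G] by simp
qed

text \<open>In the open star of \<open>x\<close>, a cell other than \<open>e\<close> has larger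
  dimension than \<open>e\<close>; inside \<open>c\<close> it is therefore a face. Such a
  neighbourhood shows that a leftover wall is surrounded by the tree region.\<close>

lemma wall_star:
  assumes e: "e \<in> walls" and x: "x \<in> e"
  obtains S where "openin X S" "x \<in> S" "S \<inter> c \<subseteq> e \<union> \<Union>faces"
proof -
  have eN: "e \<in> cells N" and ec: "e \<subseteq> c" and de: "Suc (cdim N e) = cdim M c" using e by (auto simp: walls_def)
  obtain S where S: "openin X S" "x \<in> S" "\<And>g. g \<in> cells N \<Longrightarrow> g \<inter> S \<noteq> {} \<Longrightarrow> x \<in> cl g"
    using N.open_star [OF finite_N] x N.cell_subset_topspace [OF eN] by blast
  have "S \<inter> c \<subseteq> e \<union> \<Union>faces"
  proof
    fix y assume y: "y \<in> S \<inter> c"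
    then obtain g where g: "g \<in> cells N" "y \<in> g" using N.obtain_cell M.cell_subset_topspace [OF c] by blast
    then have gc: "g \<subseteq> c" using cell_in_cell [OF g(1) c g(2)] y by blast
    have "x \<in> cl g" using S(3)[OF g(1)] g(2) y by blast
    then have "g = e \<or> cdim N e < cdim N g" using N.meets_closure(2)[OF g(1) eN x] by blast
    then show "y \<in> e \<union> \<Union>faces"
    proof
      assume "cdim N e < cdim N g"
      then have "cdim N g = cdim M c" using dim_le [OF c g(1) gc] de by simp
      then show ?thesis using g gc by (auto simp: faces_def)
    qed (use g in blast)
  qed
  then show thesis using that S by blast
qed

text \<open>A cell that meets \<open>cl e\<close> and differs from \<open>e\<close> has smaller
  dimension than \<open>e\<close>, whereas the tree region consists of faces and walls.\<close>

lemma leftover_disjoint_tree_region: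
  assumes "e \<in> leftover" shows "cl e \<inter> tree_region = {}"
proof -
  have e: "e \<in> cells N" "Suc (cdim N e) = cdim M c" using assms by (auto simp: leftover_def walls_def)
  have "cl e \<inter> F = {}" if "F \<in> faces" for F
    using N.meets_closure(2)[OF e(1), of F] that e(2) by (fastforce simp: faces_def)
  moreover have "cl e \<inter> \<pi> F = {}" if F: "F \<in> faces" "F \<noteq> r" for F
  proof -
    have "\<pi> F \<in> cells N" "Suc (cdim N (\<pi> F)) = cdim M c" using tree [OF F] by (auto simp: walls_def)
    moreover have "\<pi> F \<noteq> e" using assms F by (auto simp: leftover_def)
    ultimately show ?thesis using N.meets_closure(2)[OF e(1), of "\<pi> F"] e(2) by fastforce
  qed
  ultimately show ?thesis unfolding tree_region_def by blast
qed

text \<open>In an open arc, an unused vertex would separate the connected union of all edges and used vertices.\<close>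

lemma leftover_empty_dim_1:
  assumes 1: "cdim M c = 1" shows "leftover = {}"
proof (rule ccontr)
  assume "leftover \<noteq> {}"
  then obtain v where v: "v \<in> leftover" by blast
  then have vw: "v \<in> walls" by (simp add: leftover_def)
  then have vN: "v \<in> cells N" "v \<subseteq> c" "cdim N v = 0" using 1 by (auto simp: walls_def)
  obtain p where p: "v = {p}" using N.vertex_singleton [OF vN(1,3)] by blast
  then have pc: "p \<in> c" using vN by blast
  obtain \<phi> \<psi> where ch: "M.chart c \<phi> \<psi>" using M.obtain_chart [OF c] .
  obtain S where S: "openin X S" "p \<in> S" "S \<inter> c \<subseteq> v \<union> \<Union>faces" using wall_star [OF vw] p by blast
  define t where "t = (\<lambda>x. x (0::nat) :: real) \<circ> \<psi>"
  have hl: "homeomorphic_map (Euclidean_space 1) euclideanreal (\<lambda>x. x 0)"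
    and cl: "continuous_map (Euclidean_space 1) euclideanreal (\<lambda>x. x 0)"
    using homeomorphic_maps_line unfolding homeomorphic_maps_map
    by (blast intro: homeomorphic_imp_continuous_map)+
  have ct: "continuous_map (subtopology X c) euclideanreal t"
    unfolding t_def using continuous_map_compose [OF _ cl, of "subtopology X c" \<psi>]
      M.chart_restrict(2)[OF ch c_closure] continuous_map_in_subtopology 1 by metis
  have injt: "inj_on t c"
  proof -
    have "inj_on (\<lambda>x. x (0::nat) :: real) (topspace (Euclidean_space 1))"
      using hl homeomorphic_imp_injective_map by blast
    then have "inj_on (\<lambda>x. x (0::nat) :: real) (\<psi> ` c)"
      using M.chart_restrict(6)[OF ch c_closure] ball_sets_subset(1)[of 1] unfolding 1
      by (meson inj_on_subset subset_trans)
    then show ?thesis unfolding t_def using M.chart_restrict(4)[OF ch c_closure] comp_inj_on by blast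
  qed
  have tr: "tree_region \<subseteq> c"
    using tree unfolding tree_region_def by (fastforce simp: faces_def walls_def)
  have "connected (t ` tree_region)"
    using connectedin_continuous_map_image [OF ct] connected_tree_region tr
    by (simp add: connectedin_subtopology)
  then have int: "is_interval (t ` tree_region)" by (simp add: is_interval_connected_1)
  have "openin (subtopology X c) (S \<inter> c)" using S(1) by (auto simp: openin_subtopology)
  then have "openin (Euclidean_space 1) (\<psi> ` (S \<inter> c))" using M.chart_openin [OF ch _ c] 1 by simp
  then have "open (t ` (S \<inter> c))"
    using homeomorphic_map_openness_eq [OF hl] by (simp add: t_def image_comp)
  moreover have "t p \<in> t ` (S \<inter> c)" using S(2) pc by blast
  ultimately obtain \<epsilon> where \<epsilon>: "\<epsilon> > 0" "ball (t p) \<epsilon> \<subseteq> t ` (S \<inter> c)" by (meson openE)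
  have near: "s \<in> t ` tree_region" if s: "s \<in> ball (t p) \<epsilon>" "s \<noteq> t p" for s
  proof -
    obtain y where y: "y \<in> S \<inter> c" "s = t y" using subsetD [OF \<epsilon>(2) s(1)] by blast
    then have "y \<in> \<Union>faces" using S(3) p s(2) by auto
    then show ?thesis using y(2) unfolding tree_region_def by blast
  qed
  \<comment> \<open>Points on both sides of \<open>t p\<close> come from faces and so lie in the
    image of the tree region, which is an interval; hence \<open>t p\<close> does too.\<close>
  have "t p - \<epsilon>/2 \<in> t ` tree_region" "t p + \<epsilon>/2 \<in> t ` tree_region"
    using \<epsilon>(1) by (auto intro!: near simp: dist_real_def)
  then have "t p \<in> t ` tree_region"
    by (rule mem_is_interval_1_I [OF int]) (use \<epsilon>(1) in auto)
  then have "p \<in> tree_region"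
    using inj_on_image_mem_iff [OF injt pc tr] by blast
  then show False using leftover_disjoint_tree_region [OF v] N.cell_subset_closure [OF vN(1)] p by blast
qed

end

section \<open>Planar topology of closed two-cells\<close>

text \<open>An arc in \<open>K\<close> closes \<gamma> to a Jordan curve. The point \<open>x\<close>
  lies on the frontier of its inside and of its outside, so \<open>S\<close> meets both, and off the
  curve \<open>S\<close> is contained in \<open>U\<close>. But \<open>U\<close> is connected and
  misses the curve.\<close>

lemma Jordan_curve_not_crossed:
  fixes K U S :: "complex set"
  assumes \<gamma>: "arc \<gamma>" "pathstart \<gamma> \<in> K" "pathfinish \<gamma> \<in> K" "K \<inter> path_image \<gamma> \<subseteq> {pathstart \<gamma>, pathfinish \<gamma>}"
    and K: "path_connected K"
    and U: "connected U" "U \<inter> K = {}" "U \<inter> path_image \<gamma> = {}"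
    and S: "open S" "x \<in> S" "x \<in> path_image \<gamma>" "S \<subseteq> path_image \<gamma> \<union> U"
  shows False
proof -
  have ne: "pathfinish \<gamma> \<noteq> pathstart \<gamma>" using \<gamma>(1) by (simp add: arc_distinct_ends)
  then obtain g where g: "arc g" "path_image g \<subseteq> K" "pathstart g = pathfinish \<gamma>" "pathfinish g = pathstart \<gamma>"
    using K \<gamma>(2,3) unfolding path_connected_arcwise by metis
  define h where "h = g +++ \<gamma>"
  have sp: "simple_path h"
    unfolding h_def by (rule simple_path_join_loop) (use \<gamma> g in auto)
  have fin: "pathfinish h = pathstart h" by (simp add: h_def g)
  have im: "path_image h = path_image g \<union> path_image \<gamma>"
    unfolding h_def by (rule path_image_join) (simp add: g)
  note J = Jordan_inside_outside [OF sp fin]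
  have "x \<in> path_image h" using S(3) im by simp
  then have "x \<in> closure (inside (path_image h))" "x \<in> closure (outside (path_image h))"
    using J by (metis DiffD1 frontier_def)+
  then have "S \<inter> inside (path_image h) \<noteq> {}" "S \<inter> outside (path_image h) \<noteq> {}"
    using S(1,2) by (meson disjoint_iff closure_iff_nhds_not_empty order_refl)+
  moreover have "inside (path_image h) \<union> outside (path_image h) = - path_image h" using J by blast
  ultimately have "U \<inter> inside (path_image h) \<noteq> {}" "U \<inter> outside (path_image h) \<noteq> {}"
    using S(4) im by blast+
  moreover have "U \<subseteq> inside (path_image h) \<union> outside (path_image h)"
  proof -
    have "U \<inter> path_image h = {}" using U(2,3) g(2) unfolding im by blast
    then show ?thesis using J by blast
  qed
  moreover have "inside (path_image h) \<inter> outside (path_image h) \<inter> U = {}" using J by blast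
  ultimately show False
    using connectedD [OF U(1), of "inside (path_image h)" "outside (path_image h)"] J by blast
qed

context regular_complex
begin

lemma closedin_chart_image:
  assumes e: "e \<in> cells N" and ch: "chart e \<phi> \<psi>" and T: "closedin (Euclidean_space (dim e)) T" "T \<subseteq> cball_set (dim e)"
  shows "closedin X (\<phi> ` T)"
proof -
  have "compactin (subtopology (Euclidean_space (dim e)) (cball_set (dim e))) T"
    using closed_compactin [OF compactin_cball_set T(2,1)] T(2) by (simp add: compactin_subtopology)
  moreover have "continuous_map (subtopology (Euclidean_space (dim e)) (cball_set (dim e))) X \<phi>"
    using chartD(1)[OF ch] continuous_map_in_subtopology by blast
  ultimately have "compactin X (\<phi> ` T)" by (rule image_compactin)
  then show ?thesis using Hausdorff compactin_imp_closedin by blast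
qed

lemma closedin_boundary:
  assumes e: "e \<in> cells N" shows "closedin X (cl e - e)"
proof -
  obtain \<phi> \<psi> where ch: "chart e \<phi> \<psi>" using obtain_chart [OF e] .
  then show ?thesis
    using closedin_chart_image [OF e ch closedin_bsphere_set] chartD(9)[OF ch] ball_sets_Un by (metis Un_upper2)
qed

lemma path_connectedin_boundary:
  assumes e: "e \<in> cells N" "dim e = 2" shows "path_connectedin X (cl e - e)"
proof -
  obtain \<phi> \<psi> where ch: "chart e \<phi> \<psi>" using obtain_chart [OF e(1)] .
  have "path_connectedin (subtopology (Euclidean_space 2) (cball_set 2)) (bsphere_set 2)"
    using path_connectedin_bsphere_set_2 ball_sets_Un by (metis path_connectedin_subtopology Un_upper2)
  moreover have "continuous_map (subtopology (Euclidean_space 2) (cball_set 2)) X \<phi>"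
    using chartD(1)[OF ch] continuous_map_in_subtopology e(2) by metis
  ultimately show ?thesis
    using path_connectedin_continuous_map_image chartD(9)[OF ch] e(2) by metis
qed

lemma connectedin_boundary_diff:
  assumes F: "F \<in> cells N" "dim F = 2" and A: "connectedin X A" "A \<subseteq> cl F - F"
  shows "connectedin X (cl F - F - A)"
proof -
  obtain \<phi> \<psi> where ch: "chart F \<phi> \<psi>" using obtain_chart [OF F(1)] .
  have "connectedin (subtopology X (cl F)) A" using A by (auto simp: connectedin_subtopology)
  moreover have "continuous_map (subtopology X (cl F)) (Euclidean_space 2) \<psi>"
    using chartD(2)[OF ch] continuous_map_in_subtopology F(2) by metis
  ultimately have "connectedin (Euclidean_space 2) (\<psi> ` A)" by (metis connectedin_continuous_map_image)
  moreover have "\<psi> ` A \<subseteq> bsphere_set 2" using chartD(10)[OF ch] A(2) F(2) by auto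
  ultimately have "connectedin (Euclidean_space 2) (bsphere_set 2 - \<psi> ` A)"
    by (rule connectedin_bsphere_set_2_diff)
  moreover have im: "bsphere_set 2 - \<psi> ` A = \<psi> ` (cl F - F - A)"
    using inj_on_image_set_diff [OF chartD(12)[OF ch], of "cl F - F" A] chartD(10)[OF ch] A(2) F(2) by auto
  ultimately have "connectedin (subtopology (Euclidean_space 2) (\<psi> ` (cl F - F - A))) (\<psi> ` (cl F - F - A))"
    by (simp add: connectedin_subtopology)
  moreover have "cl F - F - A \<subseteq> cl F" by blast
  ultimately have "connectedin (subtopology X (cl F - F - A)) (\<phi> ` \<psi> ` (cl F - F - A))"
    using connectedin_continuous_map_image chart_restrict(1)[OF ch] F(2) by metis
  moreover have "\<phi> ` \<psi> ` (cl F - F - A) = cl F - F - A" by (rule chart_restrict(5)[OF ch]) blast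
  ultimately show ?thesis by (simp add: connectedin_subtopology)
qed

text \<open>Openness is asserted only inside the open cell, since at the boundary of the closed disc
  relatively open sets need not have open image in the plane.\<close>

lemma obtain_plane_chart:
  assumes e: "e \<in> cells N" "dim e = 2"
  obtains \<theta> :: "'a \<Rightarrow> complex" where "continuous_map (subtopology X (cl e)) euclidean \<theta>" "inj_on \<theta> (cl e)"
    "\<And>S. openin X S \<Longrightarrow> open (\<theta> ` (S \<inter> e))"
proof -
  obtain \<phi> \<psi> where ch: "chart e \<phi> \<psi>" using obtain_chart [OF e(1)] .
  have hom: "homeomorphic_map (Euclidean_space 2) euclidean to_complex"
    using homeomorphic_maps_complex unfolding homeomorphic_maps_map by blast
  show thesis
  proof
    have "continuous_map (subtopology X (cl e)) (Euclidean_space 2) \<psi>"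
      using chartD(2)[OF ch] continuous_map_in_subtopology e(2) by metis
    then show "continuous_map (subtopology X (cl e)) euclidean (to_complex \<circ> \<psi>)"
      using continuous_map_compose homeomorphic_imp_continuous_map [OF hom] by blast
    have "inj_on to_complex (cball_set 2)"
      using homeomorphic_imp_injective_map [OF hom] ball_sets_subset(1) inj_on_subset by blast
    then show "inj_on (to_complex \<circ> \<psi>) (cl e)"
      using chartD(6,12)[OF ch] e(2) by (intro comp_inj_on) auto
    fix S assume "openin X S"
    then have "openin (subtopology X e) (S \<inter> e)" by (auto simp: openin_subtopology)
    then have "openin (Euclidean_space 2) (\<psi> ` (S \<inter> e))" using chart_openin [OF ch _ e(1)] e(2) by simp
    then show "open ((to_complex \<circ> \<psi>) ` (S \<inter> e))"
      using homeomorphic_map_openness_eq [OF hom] by (simp add: image_comp)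
  qed
qed

lemma obtain_edge_arc:
  fixes \<theta> :: "'a \<Rightarrow> 'b::topological_space"
  assumes e: "e \<in> cells N" "dim e = 1" and \<theta>: "continuous_map (subtopology X T) euclidean \<theta>" "inj_on \<theta> T" "cl e \<subseteq> T"
  obtains \<gamma> p q where "arc \<gamma>" "path_image \<gamma> = \<theta> ` cl e" "pathstart \<gamma> = \<theta> p" "pathfinish \<gamma> = \<theta> q" "cl e - e = {p, q}"
proof -
  obtain \<phi> \<psi> where ch: "chart e \<phi> \<psi>" using obtain_chart [OF e(1)] .
  have inc: "cl e - e = {\<phi> (of_line (-1)), \<phi> (of_line 1)}"
    using chartD(9)[OF ch] unfolding e(2) bsphere_set_1 by simp
  \<comment> \<open>Paths are parametrised by \<open>{0..1}\<close>, the one-dimensional ball by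
    \<open>{-1..1}\<close>.\<close>
  define l :: "real \<Rightarrow> real" where "l t = 2 * t - 1" for t
  have l: "l ` {0..1} = {-1..1}"
  proof
    show "{-1..1} \<subseteq> l ` {0..1}"
    proof
      fix s :: real assume "s \<in> {-1..1}"
      then show "s \<in> l ` {0..1}" by (intro image_eqI [of _ _ "(s + 1) / 2"]) (auto simp: l_def field_simps)
    qed
  qed (auto simp: l_def)
  define \<gamma> where "\<gamma> = \<theta> \<circ> (\<phi> \<circ> (of_line \<circ> l))"
  have im: "(of_line \<circ> l) ` {0..1} = cball_set 1"
    unfolding cball_set_1 image_comp [symmetric] l ..
  have "continuous_map euclideanreal (Euclidean_space 1) of_line"
    using homeomorphic_maps_line homeomorphic_maps_def by blast
  moreover have "continuous_map euclideanreal euclideanreal l"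
    unfolding l_def by (simp add: continuous_intros)
  ultimately have "continuous_map euclideanreal (Euclidean_space 1) (of_line \<circ> l)"
    using continuous_map_compose by blast
  then have 1: "continuous_map (top_of_set {0..1}) (subtopology (Euclidean_space 1) (cball_set 1)) (of_line \<circ> l)"
    using im by (auto simp: continuous_map_in_subtopology intro: continuous_map_from_subtopology)
  have 2: "continuous_map (subtopology (Euclidean_space 1) (cball_set 1)) (subtopology X T) \<phi>"
    using chartD(1)[OF ch] \<theta>(3) unfolding e(2) by (auto simp: continuous_map_in_subtopology)
  have "continuous_map (top_of_set {0..1}) euclidean \<gamma>"
    unfolding \<gamma>_def by (intro continuous_map_compose [OF continuous_map_compose [OF 1 2] \<theta>(1)])
  then have "path \<gamma>" by (simp add: path_def)
  moreover have "inj_on \<gamma> {0..1}"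
  proof -
    have "inj_on l {0..1}" by (auto simp: inj_on_def l_def)
    moreover have "inj_on of_line (l ` {0..1})" by (auto simp: inj_on_def of_line_def fun_eq_iff)
    ultimately have "inj_on (of_line \<circ> l) {0..1}" by (rule comp_inj_on)
    moreover have "inj_on \<phi> ((of_line \<circ> l) ` {0..1})" unfolding im using chartD(11)[OF ch] e(2) by simp
    ultimately have "inj_on (\<phi> \<circ> (of_line \<circ> l)) {0..1}" by (rule comp_inj_on)
    moreover have "(\<phi> \<circ> (of_line \<circ> l)) ` {0..1} = cl e"
      unfolding image_comp [symmetric, of \<phi>] im using chartD(5)[OF ch] e(2) by simp
    moreover have "inj_on \<theta> (cl e)" using \<theta>(2,3) by (rule inj_on_subset)
    ultimately show ?thesis
      unfolding \<gamma>_def by (metis comp_inj_on)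
  qed
  ultimately have "arc \<gamma>" by (simp add: arc_def)
  moreover have "path_image \<gamma> = \<theta> ` cl e"
    unfolding path_image_def \<gamma>_def image_comp [symmetric, of \<theta>] image_comp [symmetric, of \<phi>] im
    using chartD(5)[OF ch] e(2) by simp
  moreover have "pathstart \<gamma> = \<theta> (\<phi> (of_line (-1)))" "pathfinish \<gamma> = \<theta> (\<phi> (of_line 1))"
    by (simp_all add: \<gamma>_def pathstart_def pathfinish_def l_def)
  ultimately show thesis using that inc by blast
qed

definition vertices :: "'a set set" where "vertices = {v \<in> cells N. dim v = 0}"

text \<open>A colouring of the vertices that is constant on each closed cell is constant on a
  connected union of cells. Otherwise the closed cells of the two colours would split
  \<open>T\<close>: a point common to both lies in a cell, and any vertex of that cell would carry
  both colours.\<close>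

lemma monochromatic_subcomplex:
  assumes fin: "finite (cells N)" and T: "closedin X T" "connectedin X T"
    and un: "\<And>x. x \<in> T \<Longrightarrow> \<exists>g\<in>cells N. x \<in> g \<and> g \<subseteq> T"
    and mono: "\<And>g v w. g \<in> cells N \<Longrightarrow> g \<subseteq> T \<Longrightarrow> v \<in> vertices \<Longrightarrow> w \<in> vertices \<Longrightarrow> v \<subseteq> cl g \<Longrightarrow> w \<subseteq> cl g \<Longrightarrow> P v \<Longrightarrow> P w"
    and v: "v \<in> vertices" "v \<subseteq> T" "P v" and w: "w \<in> vertices" "w \<subseteq> T"
  shows "P w"
proof (rule ccontr)
  assume "\<not> P w"
  define A where "A = \<Union>(cl ` {g \<in> cells N. g \<subseteq> T \<and> (\<exists>v\<in>vertices. v \<subseteq> cl g \<and> P v)})"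
  define B where "B = \<Union>(cl ` {g \<in> cells N. g \<subseteq> T \<and> (\<exists>v\<in>vertices. v \<subseteq> cl g \<and> \<not> P v)})"
  have closed: "closedin X A" "closedin X B" unfolding A_def B_def using fin by (auto intro!: closedin_Union)
  have cov: "T \<subseteq> A \<union> B"
  proof
    fix x assume "x \<in> T"
    then obtain g where g: "g \<in> cells N" "x \<in> g" "g \<subseteq> T" using un by blast
    obtain u where "u \<in> vertices" "u \<subseteq> cl g" using exists_vertex [OF g(1)] by (auto simp: vertices_def)
    then show "x \<in> A \<union> B" using g cell_subset_closure [OF g(1)] unfolding A_def B_def by blast
  qed
  have disj: "A \<inter> B \<inter> T = {}"
  proof (rule ccontr)
    assume "A \<inter> B \<inter> T \<noteq> {}"
    then obtain x g g' u u' where x: "x \<in> cl g" "x \<in> cl g'" and g: "g \<in> cells N" "g \<subseteq> T" and g': "g' \<in> cells N" "g' \<subseteq> T"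
      and u: "u \<in> vertices" "u \<subseteq> cl g" "P u" and u': "u' \<in> vertices" "u' \<subseteq> cl g'" "\<not> P u'"
      unfolding A_def B_def by blast
    then obtain k where k: "k \<in> cells N" "x \<in> k"
      using obtain_cell closure_of_subset_topspace by (metis subsetD)
    obtain t where t: "t \<in> vertices" "t \<subseteq> cl k" using exists_vertex [OF k(1)] by (auto simp: vertices_def)
    have "t \<subseteq> cl g" "t \<subseteq> cl g'"
      using meets_closure_subset [OF g(1) k x(1)] meets_closure_subset [OF g'(1) k x(2)] t(2) subset_closure_trans by blast+
    then show False using mono [OF g u(1) t(1) u(2)] mono [OF g' t(1) u'(1)] u u' by blast
  qed
  have vN: "v \<in> cells N" "w \<in> cells N" using v w by (auto simp: vertices_def)
  have "v \<subseteq> A"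
    unfolding A_def using v cell_subset_closure [OF vN(1)] vN(1) by blast
  moreover have "w \<subseteq> B"
    unfolding B_def using w cell_subset_closure [OF vN(2)] vN(2) \<open>\<not> P w\<close> by blast
  ultimately have "A \<inter> T \<noteq> {}" "B \<inter> T \<noteq> {}"
    using v(2) w(2) cell_nonempty vN by (metis Int_greatest subset_empty)+
  then show False using T(2) closed cov disj unfolding connectedin_closedin by blast
qed

end

section \<open>The spanning forest of a subdivided two-cell\<close>

lemma (in regular_complex) edge_vertices:
  assumes e: "e \<in> cells N" "dim e = 1" and v: "v \<in> vertices" "v \<subseteq> cl e" and w: "w \<in> vertices" "w \<subseteq> cl e"
    and u: "u \<in> vertices" "u \<subseteq> cl e" and ne: "v \<noteq> w"
  shows "u = v \<or> u = w"
proof -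
  obtain p q where pq: "cl e - e = {p, q}" using edge_ends [OF e] by metis
  have "t = {p} \<or> t = {q}" if t: "t \<in> vertices" "t \<subseteq> cl e" for t
  proof -
    have tN: "t \<in> cells N" "dim t = 0" using t by (auto simp: vertices_def)
    obtain a where a: "t = {a}" using vertex_singleton [OF tN] by blast
    have "t \<noteq> e" using tN e by auto
    then have "t \<subseteq> cl e - e" using meets_closure(1)[OF e(1) tN(1), of a] t a by blast
    then show ?thesis using pq a by auto
  qed
  then show ?thesis using u v w ne by metis
qed

section \<open>Reaching the boundary circle along leftover edges\<close>

context spanning_tree
begin

definition link :: "('a set \<times> 'a set) set" where
  "link = {(v, w). v \<in> N.vertices \<and> w \<in> N.vertices \<and> v \<subseteq> cl c \<and> w \<subseteq> cl c \<and> (\<exists>e\<in>leftover. v \<subseteq> cl e \<and> w \<subseteq> cl e)}"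

definition rim :: "'a set set" where "rim = {v \<in> N.vertices. v \<subseteq> cl c - c}"

definition reach :: "'a set \<Rightarrow> bool" where "reach v \<longleftrightarrow> (\<exists>z\<in>rim. (v, z) \<in> link\<^sup>*)"

text \<open>The vertices are coloured by whether leftover edges lead from them to the boundary
  circle; a cell is uniform if its closure has a single colour. This is the local condition from
  which \<open>monochromatic_subcomplex\<close> draws a global conclusion.\<close>

definition uniform :: "'a set \<Rightarrow> bool" where
  "uniform g \<longleftrightarrow> (\<forall>v\<in>N.vertices. \<forall>w\<in>N.vertices. v \<subseteq> cl g \<longrightarrow> w \<subseteq> cl g \<longrightarrow> reach v \<longrightarrow> reach w)"

lemma reach_link: "(v, w) \<in> link \<Longrightarrow> reach w \<Longrightarrow> reach v"
  unfolding reach_def using converse_rtrancl_into_rtrancl by metis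

lemma uniform_rim:
  assumes "g \<subseteq> cl c - c" shows "uniform g"
proof -
  have "cl g \<subseteq> cl c - c"
    by (rule closure_of_minimal [OF assms M.closedin_boundary [OF c]])
  then have "reach w" if "w \<in> N.vertices" "w \<subseteq> cl g" for w
    using that unfolding reach_def rim_def by blast
  then show ?thesis by (simp add: uniform_def)
qed

lemma uniform_leftover:
  assumes e: "e \<in> leftover" shows "uniform e"
proof -
  have "e \<subseteq> cl c" using e c_closure by (auto simp: leftover_def walls_def)
  then have "cl e \<subseteq> cl c" by (rule M.closure_mono_cells)
  then have "(w, v) \<in> link" if "v \<in> N.vertices" "w \<in> N.vertices" "v \<subseteq> cl e" "w \<subseteq> cl e" for v w
    using that e unfolding link_def by blast
  then show ?thesis
    unfolding uniform_def using reach_link by blast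
qed

lemma uniform_vertex:
  assumes g: "g \<in> cells N" "cdim N g = 0" shows "uniform g"
proof -
  obtain p where p: "cl g = {p}" using N.vertex_singleton [OF g] by metis
  have "v = {p}" if "v \<in> N.vertices" "v \<subseteq> cl g" for v
    using that N.cell_nonempty[of v] p by (auto simp: N.vertices_def)
  then show ?thesis unfolding uniform_def by metis
qed

lemma inside_or_rim: "g \<in> cells N \<Longrightarrow> g \<subseteq> cl c \<Longrightarrow> g \<subseteq> c \<or> g \<subseteq> cl c - c"
  using cell_in_cell [OF _ c] by blast

lemma uniform_subset: "uniform g \<Longrightarrow> e \<subseteq> cl g \<Longrightarrow> uniform e"
  unfolding uniform_def using N.closure_mono_cells [of e g] by (meson subset_trans)

text \<open>Starting with the leaves of the dual tree: all edges of a face except the one towards its parent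
  are already known to be uniform, and they form a connected set.\<close>

lemma uniform_face:
  assumes 2: "cdim M c = 2" and "F \<in> faces" shows "uniform F"
  using assms(2)
proof (induction "Max (d ` faces) - d F" arbitrary: F rule: less_induct)
  case less
  have FN: "F \<in> cells N" "F \<subseteq> c" "cdim N F = 2" using less(2) 2 by (auto simp: faces_def)
  have fin: "finite (d ` faces)" using finite_N by (simp add: faces_def)
  \<comment> \<open>The edge towards the parent is the one whose uniformity is not yet known. The
    root has no such edge, and the empty set stands in for it.\<close>
  define E where "E = (if F = r then {} else \<pi> F)"
  define T where "T = cl F - F - E"
  have E: "E \<in> cells N" "cdim N E = 1" "E \<subseteq> cl F" if "F \<noteq> r"
    using tree [OF less(2) that] that 2 by (auto simp: E_def walls_def)
  have T1: "closedin X T"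
  proof (cases "F = r")
    case True
    then show ?thesis using N.closedin_boundary [OF FN(1)] by (simp add: T_def E_def)
  next
    case False
    then show ?thesis
      unfolding T_def using N.closedin_boundary_minus_facet [OF finite_N FN(1) E(1)] E FN(3) by simp
  qed
  \<comment> \<open>\<open>T\<close> is a circle, or a circle with a connected open edge
    removed.\<close>
  have T2: "connectedin X T"
  proof (cases "F = r")
    case True
    then show ?thesis using N.connectedin_boundary_diff [OF FN(1,3), of "{}"] by (simp add: T_def E_def)
  next
    case False
    obtain x where x: "x \<in> E" using N.cell_nonempty [OF E(1)[OF False]] by blast
    have "E \<noteq> F" using E(2)[OF False] FN(3) by auto
    then have "E \<subseteq> cl F - F" using N.meets_closure(1)[OF FN(1) E(1)[OF False] x] E(3)[OF False] x by blast
    then show ?thesis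
      unfolding T_def using N.connectedin_boundary_diff [OF FN(1,3) N.connectedin_cell(1)[OF E(1)[OF False]]] by simp
  qed
  have sub: "g \<subseteq> T" if g: "g \<in> cells N" "x \<in> g" "x \<in> cl F" "g \<noteq> F" "g \<noteq> E" for g x
  proof -
    have "g \<inter> E = {}"
    proof (cases "F = r")
      case False
      then show ?thesis using N.cells_eqI [OF g(1) E(1)] g(5) by blast
    qed (simp add: E_def)
    then show ?thesis using N.meets_closure(1)[OF FN(1) g(1,2,3,4)] by (auto simp: T_def)
  qed
  have un: "\<exists>g\<in>cells N. x \<in> g \<and> g \<subseteq> T" if "x \<in> T" for x
  proof -
    have x: "x \<in> cl F" "x \<notin> F" "x \<notin> E" using that by (auto simp: T_def)
    then obtain g where g: "g \<in> cells N" "x \<in> g"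
      using N.obtain_cell closure_of_subset_topspace by (metis subsetD)
    then show ?thesis using sub [OF g x(1)] x by blast
  qed
  have unif: "uniform g" if g: "g \<in> cells N" "g \<subseteq> T" for g
  proof -
    have gF: "g \<subseteq> cl F" "g \<noteq> F" "g \<noteq> E" using g N.cell_nonempty [OF g(1)] by (auto simp: T_def)
    then have "cdim N g < 2" using N.subset_closure_dim [OF FN(1) g(1)] FN(3) by simp
    then consider "cdim N g = 0" | "cdim N g = 1" by linarith
    then show ?thesis
    proof cases
      case 1
      then show ?thesis using uniform_vertex g(1) by blast
    next
      case 2
      have "cl F \<subseteq> cl c" using FN(2) by (rule closure_of_mono)
      then have "g \<subseteq> c \<or> g \<subseteq> cl c - c" using inside_or_rim [OF g(1)] gF(1) by blast
      then show ?thesis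
      proof
        assume "g \<subseteq> c"
        then have gw: "g \<in> walls" using g(1) 2 \<open>cdim M c = 2\<close> by (simp add: walls_def)
        show ?thesis
        proof (cases "g \<in> leftover")
          case True
          then show ?thesis by (rule uniform_leftover)
        next
          case False
          \<comment> \<open>An edge of \<open>F\<close> other than \<open>E\<close> that the tree
            crosses leads to a child \<open>G\<close> of \<open>F\<close>. It is farther from the
            root, so the induction hypothesis covers it.\<close>
          then obtain G where G: "G \<in> faces" "G \<noteq> r" "g = \<pi> G" using gw by (auto simp: leftover_def)
          have "F \<noteq> G"
          proof
            assume "F = G"
            then have "E = g" using G by (simp add: E_def)
            then show False using gF(3) by simp
          qed
          then have "d F < d G" using parent_unique(2)[OF less(2) G(1,2)] gF(1) G(3) by simp
          moreover have "d G \<le> Max (d ` faces)" using fin G(1) by (intro Max_ge) auto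
          ultimately have "uniform G" using less(1)[OF _ G(1)] by simp
          then show ?thesis using uniform_subset tree [OF G(1,2)] G(3) by blast
        qed
      qed (rule uniform_rim)
    qed
  qed
  have mono: "reach w" if "g \<in> cells N" "g \<subseteq> T" "v \<in> N.vertices" "w \<in> N.vertices"
      "v \<subseteq> cl g" "w \<subseteq> cl g" "reach v" for g v w
    using unif [OF that(1,2)] that(3-) unfolding uniform_def by blast
  show ?case
    unfolding uniform_def
  proof (intro ballI impI)
    fix v w assume v: "v \<in> N.vertices" and w: "w \<in> N.vertices" and vF: "v \<subseteq> cl F" and wF: "w \<subseteq> cl F" and rv: "reach v"
    have vT: "u \<subseteq> T" if u: "u \<in> N.vertices" "u \<subseteq> cl F" for u
    proof -
      have uN: "u \<in> cells N" "cdim N u = 0" using u by (auto simp: N.vertices_def)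
      obtain x where "x \<in> u" using N.cell_nonempty [OF uN(1)] by blast
      moreover have "u \<noteq> F" using uN FN(3) by auto
      moreover have "u \<noteq> E" using uN E(2) N.cell_nonempty by (cases "F = r") (auto simp: E_def)
      ultimately show ?thesis using sub uN(1) u(2) by blast
    qed
    show "reach w"
      by (rule N.monochromatic_subcomplex [where P = reach and T = T and v = v,
            OF finite_N T1 T2 un mono v vT [OF v vF] rv w vT [OF w wF]])
  qed
qed

text \<open>The boundary of \<open>c\<close> is nonempty and a union of cells of the refinement, so
  it contains a vertex. Every cell in the closed disc is uniform, hence reachability spreads from
  this vertex over the connected set \<open>cl c\<close>.\<close>

lemma reach_all:
  assumes 2: "cdim M c = 2" and w: "w \<in> N.vertices" "w \<subseteq> cl c" shows "reach w"
proof -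
  obtain \<phi> \<psi> where ch: "M.chart c \<phi> \<psi>" using M.obtain_chart [OF c] .
  have "cl c - c \<noteq> {}" using M.chartD(9)[OF ch] bsphere_set_nonempty[of 2] 2 by auto
  then obtain x where x: "x \<in> cl c" "x \<notin> c" by blast
  then obtain g where g: "g \<in> cells N" "x \<in> g"
    using N.obtain_cell closure_of_subset_topspace by (metis subsetD)
  then have gsub: "g \<subseteq> cl c - c" using inside_or_rim cell_in_closed_cell [OF g(1) c g(2) x(1)] x by blast
  obtain v where v: "v \<in> cells N" "cdim N v = 0" "v \<subseteq> cl g" using N.exists_vertex [OF g(1)] .
  have "cl g \<subseteq> cl c - c" by (rule closure_of_minimal [OF gsub M.closedin_boundary [OF c]])
  then have vr: "v \<in> rim" using v by (auto simp: rim_def N.vertices_def)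
  then have v': "v \<in> N.vertices" "v \<subseteq> cl c" "reach v" by (auto simp: rim_def reach_def)
  have unif: "uniform g" if g: "g \<in> cells N" "g \<subseteq> cl c" for g
  proof -
    have "g \<in> leftover \<or> (\<exists>G. G \<in> faces \<and> G \<noteq> r \<and> g = \<pi> G)" if "g \<in> walls"
      using that by (auto simp: leftover_def)
    then consider "g \<in> faces" | "g \<in> leftover" | G where "G \<in> faces" "G \<noteq> r" "g = \<pi> G" | "cdim N g = 0" | "g \<subseteq> cl c - c"
      using inside_or_rim [OF g] cells_in_c [OF g(1)] by metis
    then show ?thesis
    proof cases
      case 3
      then show ?thesis using uniform_subset [OF uniform_face [OF 2 3(1)]] tree [OF 3(1,2)] by blast
    qed (use uniform_face [OF 2] uniform_leftover uniform_vertex g uniform_rim in auto)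
  qed
  have mono: "reach w" if "g \<in> cells N" "g \<subseteq> cl c" "v \<in> N.vertices" "w \<in> N.vertices"
      "v \<subseteq> cl g" "w \<subseteq> cl g" "reach v" for g v w
    using unif [OF that(1,2)] that(3-) unfolding uniform_def by blast
  have con: "connectedin X (cl c)"
    by (rule path_connectedin_imp_connectedin [OF M.connectedin_cell(2)[OF c]])
  have un: "\<exists>g\<in>cells N. x \<in> g \<and> g \<subseteq> cl c" if x: "x \<in> cl c" for x
  proof -
    obtain g where "g \<in> cells N" "x \<in> g"
      using x N.obtain_cell closure_of_subset_topspace by (metis subsetD)
    then show ?thesis using cell_in_closed_cell [OF _ c _ x] by blast
  qed
  show ?thesis
    by (rule N.monochromatic_subcomplex [where P = reach and T = "cl c" and v = v,
          OF finite_N closedin_closure_of con un mono v' w])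
qed

text \<open>\<open>\<delta>\<close> is the distance to the rim along leftover edges and
  \<open>\<mu> v\<close> the first edge of a shortest path, which exists because a vertex inside
  \<open>c\<close> is not on the rim. The whole rim serves as the set of roots.\<close>

lemma obtain_forest:
  assumes 2: "cdim M c = 2"
  obtains \<delta> :: "'a set \<Rightarrow> nat" and \<mu> :: "'a set \<Rightarrow> 'a set" where
    "\<And>v. v \<in> N.vertices \<Longrightarrow> v \<subseteq> c \<Longrightarrow> \<mu> v \<in> leftover \<and> v \<subseteq> cl (\<mu> v) \<and>
      (\<exists>w\<in>N.vertices. w \<subseteq> cl c \<and> w \<subseteq> cl (\<mu> v) \<and> \<delta> w < \<delta> v)"
proof -
  obtain \<delta> :: "'a set \<Rightarrow> nat" where
    d: "\<And>x z. (x, z) \<in> link\<^sup>* \<Longrightarrow> z \<in> rim \<Longrightarrow> x \<notin> rim \<Longrightarrow> \<exists>y. (x, y) \<in> link \<and> \<delta> y < \<delta> x \<and> (\<exists>z\<in>rim. (y, z) \<in> link\<^sup>*)"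
    using distance_to_set [of link rim] by blast
  have "\<exists>e. e \<in> leftover \<and> v \<subseteq> cl e \<and> (\<exists>w\<in>N.vertices. w \<subseteq> cl c \<and> w \<subseteq> cl e \<and> \<delta> w < \<delta> v)"
    if v: "v \<in> N.vertices" "v \<subseteq> c" for v
  proof -
    have "reach v" using reach_all [OF 2 v(1)] v(2) c_closure by blast
    moreover have "v \<notin> rim" using v N.cell_nonempty by (auto simp: rim_def N.vertices_def)
    ultimately obtain y where "(v, y) \<in> link" "\<delta> y < \<delta> v" using d unfolding reach_def by blast
    then show ?thesis unfolding link_def by blast
  qed
  then show thesis using that by metis
qed

end

section \<open>The forest uses every leftover edge\<close>

locale spanning_forest = spanning_tree +
  fixes \<delta> :: "'a set \<Rightarrow> nat" and \<mu> :: "'a set \<Rightarrow> 'a set"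
  assumes dim_2: "cdim M c = 2"
    and forest: "\<And>v. v \<in> N.vertices \<Longrightarrow> v \<subseteq> c \<Longrightarrow> \<mu> v \<in> leftover \<and> v \<subseteq> cl (\<mu> v) \<and>
      (\<exists>w\<in>N.vertices. w \<subseteq> cl c \<and> w \<subseteq> cl (\<mu> v) \<and> \<delta> w < \<delta> v)"
begin

lemma leftover_edge: "e \<in> leftover \<Longrightarrow> e \<in> cells N \<and> e \<subseteq> c \<and> cdim N e = 1"
  using dim_2 by (auto simp: leftover_def walls_def)

text \<open>An edge has just two vertices, so the other end of \<open>\<mu> v\<close> is the
  neighbour closer to the rim. Injectivity of \<open>\<mu>\<close> and acyclicity of the vertex-edge
  pairs both follow from this.\<close>

lemma forest_other_end:
  assumes v: "v \<in> N.vertices" "v \<subseteq> c" and u: "u \<in> N.vertices" "u \<subseteq> cl (\<mu> v)" "u \<noteq> v"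
  shows "\<delta> u < \<delta> v"
proof -
  note f = forest [OF v]
  obtain w where w: "w \<in> N.vertices" "w \<subseteq> cl (\<mu> v)" "\<delta> w < \<delta> v" using f by blast
  have e: "\<mu> v \<in> cells N" "cdim N (\<mu> v) = 1" using f leftover_edge by auto
  have "u = v \<or> u = w"
    using N.edge_vertices [OF e v(1) _ w(1,2) u(1,2)] f w(3) by blast
  then show ?thesis using u(3) w(3) by blast
qed

lemma forest_inj:
  assumes "v \<in> N.vertices" "v \<subseteq> c" "w \<in> N.vertices" "w \<subseteq> c" "\<mu> v = \<mu> w" shows "v = w"
proof (rule ccontr)
  assume "v \<noteq> w"
  have "v \<subseteq> cl (\<mu> v)" "w \<subseteq> cl (\<mu> v)"
    using forest [OF assms(1,2)] forest [OF assms(3,4)] assms(5) by auto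
  then have "\<delta> w < \<delta> v" "\<delta> v < \<delta> w"
    using forest_other_end [OF assms(1,2,3)] forest_other_end [OF assms(3,4,1)] assms(5) \<open>v \<noteq> w\<close> by auto
  then show False by simp
qed

text \<open>The boundary circle with the closed edges of the forest attached; it plays the role of
  \<open>K\<close> in \<open>Jordan_curve_not_crossed\<close>.\<close>

definition skeleton :: "'a set" where
  "skeleton = (cl c - c) \<union> \<Union>(cl ` \<mu> ` {v \<in> N.vertices. v \<subseteq> c})"

lemma skeleton_subset: "skeleton \<subseteq> cl c"
proof -
  have "cl (\<mu> v) \<subseteq> cl c" if "v \<in> N.vertices" "v \<subseteq> c" for v
    using forest [OF that] leftover_edge [of "\<mu> v"] by (simp add: closure_of_mono)
  then show ?thesis by (auto simp: skeleton_def)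
qed

lemma path_connected_skeleton: "path_connectedin X skeleton"
proof -
  have top: "topspace (subtopology X skeleton) = skeleton"
    by (rule M.topspace_subtopology_closure [OF skeleton_subset])
  have joined: "path_component_of (subtopology X skeleton) x y"
    if "path_connectedin X S" "S \<subseteq> skeleton" "x \<in> S" "y \<in> S" for S x y
  proof -
    have "path_connectedin (subtopology X skeleton) S" using that by (simp add: path_connectedin_subtopology)
    from path_component_of_maximal [OF this that(3)] show ?thesis using that(4) by auto
  qed
  have "cl c - c \<noteq> {}"
  proof -
    obtain \<phi> \<psi> where ch: "M.chart c \<phi> \<psi>" using M.obtain_chart [OF c] .
    then show ?thesis using M.chartD(9)[OF ch] bsphere_set_nonempty[of 2] dim_2 by auto
  qed
  then obtain b where b: "b \<in> cl c - c" by blast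
  have rimp: "path_component_of (subtopology X skeleton) b x" if "x \<in> cl c - c" for x
    by (rule joined [OF M.path_connectedin_boundary [OF c dim_2]]) (use b that in \<open>auto simp: skeleton_def\<close>)
  have star: "cl (\<mu> v) \<subseteq> skeleton" "path_connectedin X (cl (\<mu> v))" if "v \<in> N.vertices" "v \<subseteq> c" for v
    using forest [OF that] leftover_edge N.connectedin_cell(2) that by (auto simp: skeleton_def)
  have vert: "path_component_of (subtopology X skeleton) b x"
    if "v \<in> N.vertices" "v \<subseteq> cl c" "x \<in> v" for v x
    using that
  proof (induction "\<delta> v" arbitrary: v x rule: less_induct)
    case less
    show ?case
    proof (cases "v \<subseteq> c")
      case True
      note f = forest [OF less(2) True]
      obtain w where w: "w \<in> N.vertices" "w \<subseteq> cl c" "w \<subseteq> cl (\<mu> v)" "\<delta> w < \<delta> v" using f by blast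
      obtain y where y: "y \<in> w" using w(1) N.cell_nonempty by (auto simp: N.vertices_def)
      have "path_component_of (subtopology X skeleton) b y" by (rule less(1)[OF w(4,1,2) y])
      moreover have "path_component_of (subtopology X skeleton) y x"
        by (rule joined [OF star(2,1)[OF less(2) True]]) (use y w f less in auto)
      ultimately show ?thesis using path_component_of_trans by metis
    next
      case False
      then have "v \<subseteq> cl c - c" using inside_or_rim less(2,3) by (auto simp: N.vertices_def)
      then show ?thesis using rimp less(4) by blast
    qed
  qed
  have all: "path_component_of (subtopology X skeleton) b x" if "x \<in> skeleton" for x
  proof (cases "x \<in> cl c - c")
    case False
    then obtain v where v: "v \<in> N.vertices" "v \<subseteq> c" "x \<in> cl (\<mu> v)"
      using \<open>x \<in> skeleton\<close> unfolding skeleton_def by blast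
    obtain y where y: "y \<in> v" using v(1) N.cell_nonempty by (auto simp: N.vertices_def)
    have "path_component_of (subtopology X skeleton) b y" using vert v y c_closure by blast
    moreover have "path_component_of (subtopology X skeleton) y x"
      by (rule joined [OF star(2,1)[OF v(1,2)]]) (use v y forest [OF v(1,2)] in auto)
    ultimately show ?thesis using path_component_of_trans by metis
  qed (use rimp in blast)
  have "path_connected_space (subtopology X skeleton)"
    unfolding path_connected_space_iff_path_component top
    using all path_component_of_sym path_component_of_trans by metis
  then show ?thesis
    using skeleton_subset closure_of_subset_topspace [of X c] by (auto simp: path_connectedin_def)
qed

text \<open>An edge not used by the forest closes up, inside the path-connected skeleton, to a Jordan curve. It
  would separate the faces on its two sides, although these are joined by the dual tree.\<close>

lemma forest_surj:
  assumes e: "e \<in> leftover" obtains v where "v \<in> N.vertices" "v \<subseteq> c" "e = \<mu> v"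
proof (rule ccontr)
  assume "\<not> thesis"
  then have no: "\<mu> v \<noteq> e" if "v \<in> N.vertices" "v \<subseteq> c" for v
    using that \<open>\<And>v. \<lbrakk>v \<in> N.vertices; v \<subseteq> c; e = \<mu> v\<rbrakk> \<Longrightarrow> thesis\<close> by blast
  have eN: "e \<in> cells N" "e \<subseteq> c" "cdim N e = 1" using leftover_edge [OF e] by auto
  have ecl: "cl e \<subseteq> cl c" using eN(2) by (rule closure_of_mono)
  obtain \<theta> :: "'a \<Rightarrow> complex" where \<theta>: "continuous_map (subtopology X (cl c)) euclidean \<theta>" "inj_on \<theta> (cl c)"
    and op: "\<And>S. openin X S \<Longrightarrow> open (\<theta> ` (S \<inter> c))"
    using M.obtain_plane_chart [OF c dim_2] by metis
  obtain \<gamma> p q where \<gamma>: "arc \<gamma>" "path_image \<gamma> = \<theta> ` cl e" "pathstart \<gamma> = \<theta> p" "pathfinish \<gamma> = \<theta> q" and pq: "cl e - e = {p, q}"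
    using N.obtain_edge_arc [OF eN(1,3) \<theta> ecl] by metis
  have esk: "e \<inter> skeleton = {}"
  proof -
    have "e \<inter> cl (\<mu> v) = {}" if v: "v \<in> N.vertices" "v \<subseteq> c" for v
    proof -
      have "\<mu> v \<in> cells N" "cdim N (\<mu> v) = 1" using forest [OF v] leftover_edge by auto
      moreover have "\<mu> v \<noteq> e" using no v by blast
      ultimately show ?thesis using N.meets_closure(2)[of "\<mu> v" e] eN by fastforce
    qed
    then show ?thesis using eN(2) by (auto simp: skeleton_def)
  qed
  have ends: "x \<in> skeleton" if x: "x \<in> cl e - e" for x
  proof -
    obtain v where v: "v \<in> cells N" "x \<in> v"
      using x N.obtain_cell closure_of_subset_topspace by (metis DiffD1 subsetD)
    have "v \<noteq> e" using v x by blast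
    then have "cdim N v < 1" "v \<subseteq> cl e" using N.meets_closure [OF eN(1) v] x eN(3) by auto
    then have vV: "v \<in> N.vertices" "v \<subseteq> cl c" using v ecl by (auto simp: N.vertices_def)
    then have "v \<subseteq> c \<or> v \<subseteq> cl c - c" using inside_or_rim v(1) by blast
    then show ?thesis
    proof
      assume "v \<subseteq> c"
      then show ?thesis using forest [OF vV(1)] vV(1) v(2) by (auto simp: skeleton_def)
    qed (use v(2) in \<open>auto simp: skeleton_def\<close>)
  qed
  have tree_in: "tree_region \<subseteq> c"
    using tree unfolding tree_region_def by (fastforce simp: faces_def walls_def)
  obtain x where x: "x \<in> e" using N.cell_nonempty [OF eN(1)] by blast
  have ew: "e \<in> walls" using e by (simp add: leftover_def)
  obtain S where S: "openin X S" "x \<in> S" "S \<inter> c \<subseteq> e \<union> \<Union>faces" using wall_star [OF ew x] .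
  have img: "\<theta> ` A \<inter> \<theta> ` B = \<theta> ` (A \<inter> B)" if "A \<subseteq> cl c" "B \<subseteq> cl c" for A B
    using inj_on_image_Int [OF \<theta>(2) that] by simp
  have c1: "path_connected (\<theta> ` skeleton)"
    using path_connectedin_continuous_map_image [OF \<theta>(1)] path_connected_skeleton skeleton_subset
    by (simp add: path_connectedin_subtopology)
  have c2: "connected (\<theta> ` tree_region)"
    using connectedin_continuous_map_image [OF \<theta>(1)] connected_tree_region tree_in c_closure
    by (auto simp: connectedin_subtopology)
  have t1: "tree_region \<inter> skeleton = {}"
    using leftover_disjoint_tree_region forest tree_in unfolding skeleton_def by blast
  have t2: "tree_region \<inter> cl e = {}"
    using leftover_disjoint_tree_region [OF e] by blast
  have ecle: "e \<subseteq> cl e" by (rule N.cell_subset_closure [OF eN(1)])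
  have tcl: "tree_region \<subseteq> cl c" using tree_in c_closure by blast
  show False
  proof (rule Jordan_curve_not_crossed [OF \<gamma>(1) _ _ _ c1 c2])
    show "pathstart \<gamma> \<in> \<theta> ` skeleton" "pathfinish \<gamma> \<in> \<theta> ` skeleton"
      using ends pq unfolding \<gamma>(3,4) by auto
    have "skeleton \<inter> cl e \<subseteq> {p, q}" using pq esk by blast
    then show "\<theta> ` skeleton \<inter> path_image \<gamma> \<subseteq> {pathstart \<gamma>, pathfinish \<gamma>}"
      unfolding \<gamma>(2-4) img [OF skeleton_subset ecl] by blast
    show "\<theta> ` tree_region \<inter> \<theta> ` skeleton = {}"
      unfolding img [OF tcl skeleton_subset] t1 by simp
    show "\<theta> ` tree_region \<inter> path_image \<gamma> = {}"
      unfolding \<gamma>(2) img [OF tcl ecl] t2 by simp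
    show "open (\<theta> ` (S \<inter> c))" by (rule op [OF S(1)])
    show "\<theta> x \<in> \<theta> ` (S \<inter> c)" using x S(2) eN(2) by blast
    show "\<theta> x \<in> path_image \<gamma>" unfolding \<gamma>(2) using x ecle by blast
    have "S \<inter> c \<subseteq> cl e \<union> tree_region" using S(3) ecle unfolding tree_region_def by blast
    then show "\<theta> ` (S \<inter> c) \<subseteq> path_image \<gamma> \<union> \<theta> ` tree_region"
      unfolding \<gamma>(2) by blast
  qed
qed

end

section \<open>Existence of refinements\<close>

text \<open>\<open>Q\<close> is empty unless \<open>c\<close> is a disc, so arcs and discs share the
  proof. That \<open>\<mu>\<close> maps \<open>Q\<close> onto the leftover walls is what makes the
  matching miss no cell but \<open>r\<close>.\<close>

lemma (in spanning_tree) matching_from_trees: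
  fixes \<delta> :: "'a set \<Rightarrow> nat" and \<mu> :: "'a set \<Rightarrow> 'a set"
  defines "Q \<equiv> {v \<in> N.vertices. v \<subseteq> c \<and> cdim M c = 2}"
  assumes left: "leftover = \<mu> ` Q" and inj: "inj_on \<mu> Q" and sub: "\<And>v. v \<in> Q \<Longrightarrow> v \<subseteq> cl (\<mu> v)"
    and rank: "\<And>v u. v \<in> Q \<Longrightarrow> u \<in> N.vertices \<Longrightarrow> u \<subseteq> cl (\<mu> v) \<Longrightarrow> u \<noteq> v \<Longrightarrow> \<delta> u < \<delta> v"
  shows "\<exists>W (\<rho> :: 'a set \<Rightarrow> nat). N.acyclic_matching c r W \<rho> \<and> N.covers_all_but c r W"
proof -
  define k where "k = cdim M c"
  define W where "W = {(\<pi> F, F) |F. F \<in> faces \<and> F \<noteq> r} \<union> {(v, \<mu> v) |v. v \<in> Q}"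
  \<comment> \<open>Walls and vertices of a disc have different dimensions, so a path never passes
    between the two kinds of pairs and their ranks need not be compared.\<close>
  define \<rho> where "\<rho> \<kappa> = (if Suc (cdim N \<kappa>) = k then tree_rank \<kappa> else \<delta> \<kappa>)" for \<kappa>
  have F: "F \<in> cells N" "F \<subseteq> c" "cdim N F = k" "\<pi> F \<in> cells N" "\<pi> F \<subseteq> c" "Suc (cdim N (\<pi> F)) = k" "\<pi> F \<subseteq> cl F"
    "\<pi> F \<notin> leftover"
    if "F \<in> faces" "F \<noteq> r" for F
    using tree [OF that] that unfolding k_def leftover_def by (auto simp: faces_def walls_def)
  have Qv: "v \<in> cells N" "v \<subseteq> c" "cdim N v = 0" "\<mu> v \<in> cells N" "\<mu> v \<subseteq> c" "cdim N (\<mu> v) = 1" "v \<subseteq> cl (\<mu> v)" "k = 2"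
    "\<mu> v \<in> leftover"
    if "v \<in> Q" for v
  proof -
    show "v \<in> cells N" "v \<subseteq> c" "cdim N v = 0" and k: "k = 2" using that by (auto simp: Q_def N.vertices_def k_def)
    show "\<mu> v \<in> leftover" using that left by blast
    then show "\<mu> v \<in> cells N" "\<mu> v \<subseteq> c" "cdim N (\<mu> v) = 1" using k unfolding k_def by (auto simp: leftover_def walls_def)
    show "v \<subseteq> cl (\<mu> v)" by (rule sub [OF that])
  qed
  have cases: thesis if "(\<kappa>, \<sigma>) \<in> W" and "\<And>G. G \<in> faces \<Longrightarrow> G \<noteq> r \<Longrightarrow> \<kappa> = \<pi> G \<Longrightarrow> \<sigma> = G \<Longrightarrow> thesis"
    and "\<And>v. v \<in> Q \<Longrightarrow> \<kappa> = v \<Longrightarrow> \<sigma> = \<mu> v \<Longrightarrow> thesis" for \<kappa> \<sigma> thesis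
    using that unfolding W_def by blast
  have rk: "cdim N r = k" using r(3) by (simp add: k_def)
  have "facet X N \<kappa> \<sigma> \<and> \<kappa> \<subseteq> c \<and> \<sigma> \<subseteq> c \<and> \<kappa> \<noteq> r \<and> \<sigma> \<noteq> r" if "(\<kappa>, \<sigma>) \<in> W" for \<kappa> \<sigma>
    using that
  proof (rule cases)
    fix G assume G: "G \<in> faces" "G \<noteq> r" "\<kappa> = \<pi> G" "\<sigma> = G"
    then show ?thesis using F [OF G(1,2)] rk by (auto simp: facet_def)
  next
    fix v assume v: "v \<in> Q" "\<kappa> = v" "\<sigma> = \<mu> v"
    then show ?thesis using Qv [OF v(1)] rk by (auto simp: facet_def)
  qed
  moreover have "p = q" if "p \<in> W" "q \<in> W" and x: "x \<in> {fst p, snd p}" "x \<in> {fst q, snd q}" for p q x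
  proof -
    obtain k1 s1 k2 s2 where pq: "p = (k1, s1)" "q = (k2, s2)" by (metis surj_pair)
    have mixed: False if G: "G \<in> faces" "G \<noteq> r" and v: "v \<in> Q" and "x \<in> {\<pi> G, G}" "x \<in> {v, \<mu> v}" for G v
    proof -
      have "\<pi> G \<noteq> \<mu> v" using F(8)[OF G] Qv(9)[OF v] by metis
      moreover have "\<pi> G \<noteq> v" "G \<noteq> v" "G \<noteq> \<mu> v" using F(3,6)[OF G] Qv(3,6,8)[OF v] by auto
      ultimately show False using that by blast
    qed
    have x': "x \<in> {k1, s1}" "x \<in> {k2, s2}" using x pq by auto
    from that(1) [unfolded pq] show ?thesis
    proof (rule cases)
      fix G assume G: "G \<in> faces" "G \<noteq> r" "k1 = \<pi> G" "s1 = G"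
      from that(2) [unfolded pq] show ?thesis
      proof (rule cases)
        fix H assume H: "H \<in> faces" "H \<noteq> r" "k2 = \<pi> H" "s2 = H"
        have "\<pi> G \<noteq> H" "\<pi> H \<noteq> G" using F(3,6)[OF G(1,2)] F(3,6)[OF H(1,2)] by auto
        then have "\<pi> G = \<pi> H \<or> G = H" using x' G H by blast
        then have "G = H" using tree_inj [OF G(1,2) H(1,2)] by blast
        then show ?thesis using pq G H by simp
      next
        fix v assume "v \<in> Q" "k2 = v" "s2 = \<mu> v"
        then show ?thesis using mixed [OF G(1,2)] x' G by blast
      qed
    next
      fix v assume v: "v \<in> Q" "k1 = v" "s1 = \<mu> v"
      from that(2) [unfolded pq] show ?thesis
      proof (rule cases)
        fix H assume "H \<in> faces" "H \<noteq> r" "k2 = \<pi> H" "s2 = H"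
        then show ?thesis using mixed [OF _ _ v(1)] x' v by blast
      next
        fix w assume w: "w \<in> Q" "k2 = w" "s2 = \<mu> w"
        have "v \<noteq> \<mu> w" "w \<noteq> \<mu> v" using Qv(3,6)[OF v(1)] Qv(3,6)[OF w(1)] by auto
        then have "v = w \<or> \<mu> v = \<mu> w" using x' v w by blast
        then have "v = w" using inj_onD [OF inj _ v(1) w(1)] by blast
        then show ?thesis using pq v w by simp
      qed
    qed
  qed
  moreover have "\<rho> \<kappa>' < \<rho> \<kappa>" if "(\<kappa>, \<sigma>) \<in> W" "(\<kappa>', \<sigma>') \<in> W" and fac: "facet X N \<kappa>' \<sigma>" "\<kappa>' \<noteq> \<kappa>" for \<kappa> \<sigma> \<kappa>' \<sigma>'
    using that(1)
  proof (rule cases)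
    fix G assume G: "G \<in> faces" "G \<noteq> r" "\<kappa> = \<pi> G" "\<sigma> = G"
    from that(2) show ?thesis
    proof (rule cases)
      fix H assume H: "H \<in> faces" "H \<noteq> r" "\<kappa>' = \<pi> H" "\<sigma>' = H"
      then have "G \<noteq> H" "\<pi> H \<subseteq> cl G" using fac G by (auto simp: facet_def)
      then have "tree_rank (\<pi> H) < tree_rank (\<pi> G)" by (intro tree_rank G(1,2) H(1,2))
      then show ?thesis using F(6)[OF G(1,2)] F(6)[OF H(1,2)] G(3) H(3) by (simp add: \<rho>_def)
    next
      fix v assume v: "v \<in> Q" "\<kappa>' = v" "\<sigma>' = \<mu> v"
      then have False using fac F(3)[OF G(1,2)] Qv(3,8)[OF v(1)] G by (simp add: facet_def)
      then show ?thesis ..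
    qed
  next
    fix v assume v: "v \<in> Q" "\<kappa> = v" "\<sigma> = \<mu> v"
    from that(2) show ?thesis
    proof (rule cases)
      fix H assume H: "H \<in> faces" "H \<noteq> r" "\<kappa>' = \<pi> H" "\<sigma>' = H"
      then have False using fac F(6)[OF H(1,2)] Qv(6,8)[OF v(1)] v by (simp add: facet_def)
      then show ?thesis ..
    next
      fix w assume w: "w \<in> Q" "\<kappa>' = w" "\<sigma>' = \<mu> w"
      then have "\<delta> w < \<delta> v" using rank [OF v(1), of w] fac v by (auto simp: facet_def Q_def)
      then show ?thesis using Qv(3,8)[OF v(1)] Qv(3)[OF w(1)] v w by (simp add: \<rho>_def)
    qed
  qed
  moreover have "\<exists>p\<in>W. x \<in> {fst p, snd p}" if x: "x \<in> cells N" "x \<subseteq> c" "x \<noteq> r" for x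
  proof -
    consider "x \<in> faces" | "x \<in> walls" | "cdim M c = 2" "cdim N x = 0" using cells_in_c [OF x(1,2)] by metis
    then show ?thesis
    proof cases
      case 1
      then have "(\<pi> x, x) \<in> W" using x(3) by (auto simp: W_def)
      then show ?thesis by force
    next
      case 2
      show ?thesis
      proof (cases "x \<in> leftover")
        case True
        then obtain v where "v \<in> Q" "x = \<mu> v" using left by blast
        then have "(v, x) \<in> W" by (auto simp: W_def)
        then show ?thesis by force
      next
        case False
        then obtain G where "G \<in> faces" "G \<noteq> r" "x = \<pi> G" using 2 by (auto simp: leftover_def)
        then have "(x, G) \<in> W" by (auto simp: W_def)
        then show ?thesis by force
      qed
    next
      case 3
      then have "(x, \<mu> x) \<in> W" using x by (auto simp: W_def Q_def N.vertices_def)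
      then show ?thesis by force
    qed
  qed
  ultimately have "N.acyclic_matching c r W \<rho>" "N.covers_all_but c r W"
    unfolding N.acyclic_matching_def N.covers_all_but_def by (intro conjI allI ballI impI; metis)+
  then show ?thesis by blast
qed

context refined_complex
begin

lemma cell_matching:
  assumes c: "c \<in> cells M" "cdim M c \<le> 2" and r: "r \<in> cells N" "r \<subseteq> c" "cdim N r = cdim M c"
  shows "\<exists>W (\<rho> :: 'a set \<Rightarrow> nat). N.acyclic_matching c r W \<rho> \<and> N.covers_all_but c r W"
proof (cases "cdim M c = 0")
  case True
  obtain p where "c = {p}" using M.vertex_singleton [OF c(1) True] by blast
  then have "x = r" if "x \<in> cells N" "x \<subseteq> c" for x
    using that r(1,2) N.cell_nonempty [of x] N.cell_nonempty [of r] by blast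
  then show ?thesis by (intro exI [of _ "{}"]) (auto simp: N.acyclic_matching_def N.covers_all_but_def)
next
  case False
  then interpret S: subdivided_cell X M N c r
    using c r by unfold_locales auto
  obtain d :: "'a set \<Rightarrow> nat" and \<pi> par where tree: "\<And>F. F \<in> S.faces \<Longrightarrow> F \<noteq> r \<Longrightarrow>
      \<pi> F \<in> S.walls \<and> \<pi> F \<subseteq> cl F \<and> par F \<in> S.faces \<and> \<pi> F \<subseteq> cl (par F) \<and> d (par F) < d F"
    using S.obtain_tree by metis
  then interpret T: spanning_tree X M N c r d \<pi> par by unfold_locales
  show ?thesis
  proof (cases "cdim M c = 2")
    case False
    \<comment> \<open>In an arc no wall is left over, so the forest arguments below are arbitrary
      placeholders.\<close>
    then have "T.leftover = {}" using T.leftover_empty_dim_1 S.dim_c by blast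
    then show ?thesis
      using False by (intro T.matching_from_trees [of "\<lambda>v. v" "\<lambda>v. 0"]) auto
  next
    case True
    obtain \<delta> :: "'a set \<Rightarrow> nat" and \<mu> where f: "\<And>v. v \<in> N.vertices \<Longrightarrow> v \<subseteq> c \<Longrightarrow> \<mu> v \<in> T.leftover \<and> v \<subseteq> cl (\<mu> v) \<and>
      (\<exists>w\<in>N.vertices. w \<subseteq> cl c \<and> w \<subseteq> cl (\<mu> v) \<and> \<delta> w < \<delta> v)"
      using T.obtain_forest [OF True] by metis
    interpret F: spanning_forest X M N c r d \<pi> par \<delta> \<mu>
      by unfold_locales (use True f in auto)
    show ?thesis
    proof (rule T.matching_from_trees [of \<mu> \<delta>])
      show "T.leftover = \<mu> ` {v \<in> N.vertices. v \<subseteq> c \<and> cdim M c = 2}"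
        using F.forest_surj f True by blast
      show "inj_on \<mu> {v \<in> N.vertices. v \<subseteq> c \<and> cdim M c = 2}"
        by (rule inj_onI) (use F.forest_inj in blast)
    qed (use f F.forest_other_end in auto)
  qed
qed

text \<open>No cell is both the lower cell of one pair and the upper cell of another. The choice can
  therefore be made freely on all cells except upper ones, and \<open>h b\<close> is then taken
  adjacent to the \<open>h a\<close> already chosen; since \<open>b\<close> is the upper cell of
  only one pair, the requirements do not conflict.\<close>

lemma choose_top_cells:
  assumes V: "discrete_vector_field X M V"
  shows "\<exists>h. (\<forall>\<alpha>\<in>cells M. h \<alpha> \<in> cells N \<and> h \<alpha> \<subseteq> \<alpha> \<and> cdim N (h \<alpha>) = cdim M \<alpha>) \<and> (\<forall>(a, b)\<in>V. h a \<subseteq> cl (h b))"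
proof -
  note uV = discrete_vector_field_unique [OF V]
  define P where "P \<alpha> \<sigma> \<longleftrightarrow> \<sigma> \<in> cells N \<and> \<sigma> \<subseteq> \<alpha> \<and> cdim N \<sigma> = cdim M \<alpha>" for \<alpha> \<sigma>
  have "\<forall>\<alpha>. \<exists>\<sigma>. \<alpha> \<in> cells M \<longrightarrow> P \<alpha> \<sigma>"
    using exists_top_cell unfolding P_def by metis
  then obtain g where g: "\<And>\<alpha>. \<alpha> \<in> cells M \<Longrightarrow> P \<alpha> (g \<alpha>)" by metis
  have "\<exists>\<sigma>. P b \<sigma> \<and> g a \<subseteq> cl \<sigma>" if ab: "(a, b) \<in> V" for a b
  proof -
    have f: "a \<in> cells M" "b \<in> cells M" "a \<subseteq> cl b" using uV(4)[OF ab] by (auto simp: facet_def)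
    then have "g a \<in> cells N" "g a \<subseteq> cl b" using g [OF f(1)] by (auto simp: P_def)
    then show ?thesis using exists_top_coface [OF f(2)] unfolding P_def by metis
  qed
  then obtain k where k: "\<And>a b. (a, b) \<in> V \<Longrightarrow> P b (k a b) \<and> g a \<subseteq> cl (k a b)" by metis
  define h where "h \<alpha> = (if \<exists>a. (a, \<alpha>) \<in> V then k (THE a. (a, \<alpha>) \<in> V) \<alpha> else g \<alpha>)" for \<alpha>
  have hb: "h b = k a b" if "(a, b) \<in> V" for a b
  proof -
    have "(THE a. (a, b) \<in> V) = a" using that uV(2) by (intro the_equality) auto
    then show ?thesis using that by (auto simp: h_def)
  qed
  have ha: "h a = g a" if "(a, b) \<in> V" for a b
    using that uV(3) by (auto simp: h_def)
  have "P \<alpha> (h \<alpha>)" if "\<alpha> \<in> cells M" for \<alpha>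
  proof (cases "\<exists>a. (a, \<alpha>) \<in> V")
    case True
    then show ?thesis using hb k by metis
  next
    case False
    then show ?thesis using g [OF that] by (simp add: h_def)
  qed
  moreover have "h a \<subseteq> cl (h b)" if "(a, b) \<in> V" for a b
    using k [OF that] ha [OF that] hb [OF that] by simp
  ultimately show ?thesis unfolding P_def by blast
qed

text \<open>With empty matchings inside all cells the conditions on them, including
  \<open>no_return\<close>, hold vacuously.\<close>

theorem gradient_refinement_exists:
  assumes V: "discrete_gradient_vector_field X M V"
  shows "\<exists>V'. discrete_gradient_vector_field X N V' \<and> vector_field_refinement X M V N V'"
proof -
  have dvf: "discrete_vector_field X M V" using V by (simp add: discrete_gradient_vector_field_def)
  obtain h where h: "\<forall>\<alpha>\<in>cells M. h \<alpha> \<in> cells N \<and> h \<alpha> \<subseteq> \<alpha> \<and> cdim N (h \<alpha>) = cdim M \<alpha>"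
    "\<forall>(a, b)\<in>V. h a \<subseteq> cl (h b)"
    using choose_top_cells [OF dvf] by blast
  have "\<forall>c\<in>cells M. N.acyclic_matching c (h c) {} (\<lambda>x. 0)"
    by (simp add: N.acyclic_matching_def)
  note cm = combine_matchings [where W = "\<lambda>c. {}", OF V h this]
  show ?thesis
    using cm(1,2) unfolding vector_field_refinement_def discrete_gradient_vector_field_def by blast
qed

theorem optimal_gradient_refinement_exists:
  assumes V: "discrete_gradient_vector_field X M V" and dim: "\<forall>c\<in>cells M. cdim M c \<le> 2"
  shows "\<exists>V' h. discrete_gradient_vector_field X N V' \<and> vector_field_refinement X M V N V' \<and>
    refinement_choice X M V N V' h \<and> bij_betw h (critical_cells M V) (critical_cells N V')"
proof -
  have dvf: "discrete_vector_field X M V" using V by (simp add: discrete_gradient_vector_field_def)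
  note uV = discrete_vector_field_unique [OF dvf]
  obtain h where h: "\<forall>\<alpha>\<in>cells M. h \<alpha> \<in> cells N \<and> h \<alpha> \<subseteq> \<alpha> \<and> cdim N (h \<alpha>) = cdim M \<alpha>"
    and hV: "\<forall>(a, b)\<in>V. h a \<subseteq> cl (h b)"
    using choose_top_cells [OF dvf] by blast
  have "\<exists>W (\<rho> :: 'a set \<Rightarrow> nat). N.acyclic_matching c (h c) W \<rho> \<and> N.covers_all_but c (h c) W" if "c \<in> cells M" for c
    using cell_matching [of c "h c"] that h dim by blast
  then obtain W and \<rho> :: "'a set \<Rightarrow> 'a set \<Rightarrow> nat" where
    W: "\<forall>c\<in>cells M. N.acyclic_matching c (h c) (W c) (\<rho> c)" and cover: "\<forall>c\<in>cells M. N.covers_all_but c (h c) (W c)"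
    by metis
  \<comment> \<open>The only top cell of \<open>b\<close> adjacent to \<open>h a\<close> is
    \<open>h b\<close>, and the matching inside \<open>b\<close> leaves \<open>h b\<close>
    out.\<close>
  have "\<not> facet X N (h a) \<sigma>" if ab: "(a, b) \<in> V" and ks: "(\<kappa>, \<sigma>) \<in> W b" for a b \<kappa> \<sigma>
  proof
    assume fac: "facet X N (h a) \<sigma>"
    have f: "a \<in> cells M" "b \<in> cells M" "a \<subseteq> cl b" "cdim M b = Suc (cdim M a)" using uV(4)[OF ab] by (auto simp: facet_def)
    note ha = bspec [OF h f(1)] and hb = bspec [OF h f(2)]
    have "a \<noteq> b" using f(4) by auto
    then have "a \<subseteq> cl b - b"
      using M.meets_closure(1)[OF f(2,1)] M.cell_nonempty [OF f(1)] f(3) by blast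
    then have e: "h a \<subseteq> cl b - b" using ha by blast
    have "facet X N \<kappa> \<sigma> \<and> \<sigma> \<subseteq> b \<and> \<sigma> \<noteq> h b"
      using bspec [OF W f(2)] ks unfolding N.acyclic_matching_def by metis
    then have s: "\<sigma> \<in> cells N" "\<sigma> \<subseteq> b" "\<sigma> \<noteq> h b" by (auto simp: facet_def)
    have "h a \<subseteq> cl (h b)" using hV ab by auto
    then show False
      using facet_boundary_unique_coface [OF f(2) _ e, of "h b" \<sigma>] ha hb s fac f(4) by (simp add: facet_def)
  qed
  then have U: "\<forall>(a, b)\<in>V. \<forall>(\<kappa>, \<sigma>)\<in>W b. \<not> facet X N (h a) \<sigma>" by auto
  note cm = combine_matchings [OF V h hV W U]
  show ?thesis
    using cm(1,2) cm(3)[OF cover] unfolding vector_field_refinement_def discrete_gradient_vector_field_def by blast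
qed

end

theorem lemma4p3:
  fixes X :: "'a topology" and M M' :: "'a cellulation" and V :: "('a set \<times> 'a set) set"
  assumes "cell_complex X M" and "finite (cells M)"
    and "discrete_gradient_vector_field X M V"
    and "cell_complex X M'" and "cellulation_refines M' M"
  shows "(\<exists>V'. discrete_gradient_vector_field X M' V' \<and> vector_field_refinement X M V M' V') \<and>
    ((\<forall>c\<in>cells M. cdim M c \<le> 2) \<longrightarrow>
      (\<exists>V' h. discrete_gradient_vector_field X M' V' \<and>
         vector_field_refinement X M V M' V' \<and> refinement_choice X M V M' V' h \<and>
         bij_betw h (critical_cells M V) (critical_cells M' V') \<and>
         card (critical_cells M' V') = card (critical_cells M V) \<and>
         (\<forall>W. vector_field_refinement X M V M' W \<longrightarrow>
            card (critical_cells M' V') \<le> card (critical_cells M' W))))"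
proof -
  interpret refined_complex X M M'
    using assms by unfold_locales
  show ?thesis
  proof (intro conjI impI)
    show "\<exists>V'. discrete_gradient_vector_field X M' V' \<and> vector_field_refinement X M V M' V'"
      by (rule gradient_refinement_exists [OF assms(3)])
    assume "\<forall>c\<in>cells M. cdim M c \<le> 2"
    then obtain V' h where V': "discrete_gradient_vector_field X M' V'" "vector_field_refinement X M V M' V'"
      "refinement_choice X M V M' V' h" and bij: "bij_betw h (critical_cells M V) (critical_cells M' V')"
      using optimal_gradient_refinement_exists [OF assms(3)] by blast
    have "card (critical_cells M' V') = card (critical_cells M V)"
      using bij_betw_same_card [OF bij] by simp
    with V' bij show "\<exists>V' h. discrete_gradient_vector_field X M' V' \<and>
         vector_field_refinement X M V M' V' \<and> refinement_choice X M V M' V' h \<and>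
         bij_betw h (critical_cells M V) (critical_cells M' V') \<and>
         card (critical_cells M' V') = card (critical_cells M V) \<and>
         (\<forall>W. vector_field_refinement X M V M' W \<longrightarrow>
            card (critical_cells M' V') \<le> card (critical_cells M' W))"
      using critical_cells_card_le by metis
  qed
qed

end
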